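(* The closure operation is a bijection between the set $\mathcal{T}_0$ of well-charged trees of total charge $0$ and the set $\bar{\mathcal{M}}$ of rooted bipartite plane maps. Moreover, this bijection preserves the vertex-degree distribution and the color of the root vertex.
   Context: A planar map is a proper embedding of a connected planar (multi)graph in the sphere, up to orientation-preserving homeomorphism; a corner is a pair of consecutive half-edges around a vertex; the degree of a vertex is its number of incident corners (half-edges). A map is rooted by distinguishing a corner (root corner); its vertex is the root vertex. A plane map is a map with an additional marked face (the outer face), which need not be the face containing the root corner. A bipartite map always comes with a fixed proper black/white coloring of its vertices; $\bar{\mathcal{M}}$ is the set of rooted bipartite plane maps. A blossoming tree is a plane tree (rooted at a corner) whose vertices may additionally carry dangling half-edges called opening stems (outgoing) and closing stems (ingoing); these count in vertex degrees. The charge of a blossoming tree is (number of closing stems) minus (number of opening stems); the charge of a vertex $v$ is the charge of the subtree rooted at $v$. A well-charged tree is a rooted blossoming tree with a proper black/white coloring of its vertices such that: black vertices carry no closing stems and every non-root black vertex has charge at most $1$; white vertices carry no opening stems and every non-root white vertex has nonnegative charge. $\mathcal{T}_0$ denotes the set of well-charged trees of total charge $0$. Closure: traverse the contour of the unique face of the blossoming tree clockwise, reading the cyclic sequence of opening and closing stems; this induces a parenthesis-type matching (opening stem = opening parenthesis). Each matched opening/closing pair is merged into a new edge, drawn so that the outer (infinite) face lies on its left when oriented from the opening stem to the closing stem. For charge $0$ all stems are matched and the result is a rooted plane map (rooted at the tree's root corner, outer face = the infinite face). *)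

theory Defs
  imports "Graph_Theory.Graph_Theory" "HOL-Combinatorics.Orbits"
begin

datatype colour = Black | White

section \<open>Rooted bipartite plane maps\<close>

text \<open>
  Maps are encoded as combinatorial maps with an explicit set of vertices (so that the map with
  one vertex and no edge is included). The arcs of the bidirected multigraph \<open>skeleton M\<close> are the
  half-edges of the map; \<open>tail\<close> is the vertex carrying a half-edge, \<open>mate M\<close> sends a half-edge to
  the other half of its edge, and \<open>rot M\<close> to the next half-edge in clockwise order around its
  vertex.

  \<open>Before h\<close> is the corner between the half-edge that precedes \<open>h\<close> in clockwise order and \<open>h\<close>;
  \<open>Isolated v\<close> is the unique corner at a vertex \<open>v\<close> without half-edges. A face is identified with
  the set of its corners.
\<close>

datatype ('v, 'h) corner = Before 'h | Isolated 'v

record ('v, 'h) rooted_map =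
  skeleton :: "('v, 'h) pre_digraph"
  mate :: "'h \<Rightarrow> 'h"
  rot :: "'h \<Rightarrow> 'h"
  colour_of :: "'v \<Rightarrow> colour"
  root_corner :: "('v, 'h) corner"
  outer_face :: "('v, 'h) corner set"

definition corners :: "('v, 'h) rooted_map \<Rightarrow> ('v, 'h) corner set" where
  "corners M = Before ` arcs (skeleton M) \<union>
     Isolated ` {v \<in> verts (skeleton M). out_arcs (skeleton M) v = {}}"

text \<open>
  From the corner before \<open>h\<close>, walking along \<open>h\<close> with the corner on the left-hand side, the next
  corner is the one that follows \<open>mate M h\<close> clockwise.
\<close>

fun next_corner :: "('v, 'h) rooted_map \<Rightarrow> ('v, 'h) corner \<Rightarrow> ('v, 'h) corner" where
  "next_corner M (Before h) = Before (rot M (mate M h))"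
| "next_corner M (Isolated v) = Isolated v"

definition faces :: "('v, 'h) rooted_map \<Rightarrow> ('v, 'h) corner set set" where
  "faces M = orbit (next_corner M) ` corners M"

definition edges :: "('v, 'h) rooted_map \<Rightarrow> 'h set set" where
  "edges M = (\<lambda>h. {h, mate M h}) ` arcs (skeleton M)"

text \<open>
  Planarity is expressed by Euler's relation: a connected combinatorial map has genus 0 iff
  V + F = E + 2. The outer face may be any face, whatever the root corner is.
\<close>

definition rooted_bipartite_plane_map :: "('v, 'h) rooted_map \<Rightarrow> bool" where
  "rooted_bipartite_plane_map M \<longleftrightarrow>
     (let G = skeleton M in
       fin_digraph G \<and> bidirected_digraph G (mate M) \<and> Digraph_Component.connected G \<and>
       rot M permutes arcs G \<and>
       (\<forall>v \<in> verts G. out_arcs G v \<noteq> {} \<longrightarrow> cyclic_on (rot M) (out_arcs G v)) \<and>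
       card (verts G) + card (faces M) = card (edges M) + 2 \<and>
       (\<forall>h \<in> arcs G. colour_of M (tail G h) \<noteq> colour_of M (head G h)) \<and>
       root_corner M \<in> corners M \<and> outer_face M \<in> faces M)"

text \<open>
  Orientation-preserving homeomorphisms of the sphere correspond to bijections that commute with
  \<open>mate\<close> and with the clockwise rotation \<open>rot\<close>.
\<close>

definition isomorphic_maps ::
    "('v, 'h) rooted_map \<Rightarrow> ('w, 'k) rooted_map \<Rightarrow> bool" where
  "isomorphic_maps M N \<longleftrightarrow>
     (\<exists>f g. bij_betw f (verts (skeleton M)) (verts (skeleton N)) \<and>
        bij_betw g (arcs (skeleton M)) (arcs (skeleton N)) \<and>
        (\<forall>h \<in> arcs (skeleton M).
           tail (skeleton N) (g h) = f (tail (skeleton M) h) \<and>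
           head (skeleton N) (g h) = f (head (skeleton M) h) \<and>
           mate N (g h) = g (mate M h) \<and> rot N (g h) = g (rot M h)) \<and>
        (\<forall>v \<in> verts (skeleton M). colour_of N (f v) = colour_of M v) \<and>
        root_corner N = map_corner f g (root_corner M) \<and>
        outer_face N = map_corner f g ` outer_face M)"

text \<open>
  Maps are finite, so every isomorphism class has representatives labelled by natural numbers; a
  map up to isomorphism is the set of all of these.
\<close>

definition map_class :: "('v, 'h) rooted_map \<Rightarrow> (nat, nat) rooted_map set" where
  "map_class M = {N. rooted_bipartite_plane_map N \<and> isomorphic_maps M N}"

definition rooted_bipartite_plane_maps :: "(nat, nat) rooted_map set set" where
  "rooted_bipartite_plane_maps = {map_class M | M :: (nat, nat) rooted_map. rooted_bipartite_plane_map M}"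

fun corner_vertex :: "('v, 'h) rooted_map \<Rightarrow> ('v, 'h) corner \<Rightarrow> 'v" where
  "corner_vertex M (Before h) = tail (skeleton M) h"
| "corner_vertex M (Isolated v) = v"

definition root_colour :: "('v, 'h) rooted_map \<Rightarrow> colour" where
  "root_colour M = colour_of M (corner_vertex M (root_corner M))"

text \<open>Number of vertices of given colour and given degree.\<close>

definition degree_distribution :: "('v, 'h) rooted_map \<Rightarrow> colour \<Rightarrow> nat \<Rightarrow> nat" where
  "degree_distribution M c k = card {v \<in> verts (skeleton M).
     colour_of M v = c \<and> card (out_arcs (skeleton M) v) = k}"


section \<open>Well-charged trees\<close>

text \<open>
  The branches at the root vertex are listed in clockwise order starting from the root corner; at
  any other vertex they are listed in clockwise order starting after the edge to the parent.
\<close>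

datatype blossoming_tree = Vertex colour "branch list"
  and branch = Opening | Closing | Edge blossoming_tree

primrec charge :: "blossoming_tree \<Rightarrow> int" and branch_charge :: "branch \<Rightarrow> int" where
  "charge (Vertex c bs) = sum_list (map branch_charge bs)"
| "branch_charge Opening = - 1"
| "branch_charge Closing = 1"
| "branch_charge (Edge t) = charge t"

primrec vertex_colour :: "blossoming_tree \<Rightarrow> colour" where
  "vertex_colour (Vertex c bs) = c"

primrec branches :: "blossoming_tree \<Rightarrow> branch list" where
  "branches (Vertex c bs) = bs"

text \<open>A vertex is addressed by the list of branch indices leading to it from the root.\<close>

fun subtree_at :: "blossoming_tree \<Rightarrow> nat list \<Rightarrow> blossoming_tree option" where
  "subtree_at t [] = Some t"
| "subtree_at (Vertex c bs) (i # p) =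
     (if i < length bs then case bs ! i of Edge s \<Rightarrow> subtree_at s p | _ \<Rightarrow> None else None)"

definition tree_vertices :: "blossoming_tree \<Rightarrow> nat list set" where
  "tree_vertices t = {p. subtree_at t p \<noteq> None}"

abbreviation subtree :: "blossoming_tree \<Rightarrow> nat list \<Rightarrow> blossoming_tree" where
  "subtree t p \<equiv> the (subtree_at t p)"

definition well_charged :: "blossoming_tree \<Rightarrow> bool" where
  "well_charged t \<longleftrightarrow>
     (\<forall>p \<in> tree_vertices t. p \<noteq> [] \<longrightarrow>
        vertex_colour (subtree t p) \<noteq> vertex_colour (subtree t (butlast p))) \<and>
     (\<forall>p \<in> tree_vertices t. vertex_colour (subtree t p) = Black \<longrightarrow>
        Closing \<notin> set (branches (subtree t p)) \<and>
        (p \<noteq> [] \<longrightarrow> charge (subtree t p) \<le> 1)) \<and>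
     (\<forall>p \<in> tree_vertices t. vertex_colour (subtree t p) = White \<longrightarrow>
        Opening \<notin> set (branches (subtree t p)) \<and>
        (p \<noteq> [] \<longrightarrow> charge (subtree t p) \<ge> 0))"

definition well_charged_trees_0 :: "blossoming_tree set" where
  "well_charged_trees_0 = {t. well_charged t \<and> charge t = 0}"

text \<open>
  Half-edges of a tree: \<open>ToBranch p i\<close> is the stem, or the half of a tree edge, at position \<open>i\<close> in
  the list of branches of the vertex \<open>p\<close>; \<open>ToParent p\<close> is the half-edge at the non-root vertex \<open>p\<close>
  of the edge to its parent.
\<close>

datatype half_edge = ToParent "nat list" | ToBranch "nat list" nat

primrec origin :: "half_edge \<Rightarrow> nat list" where
  "origin (ToParent p) = p"
| "origin (ToBranch p i) = p"

definition half_edges :: "blossoming_tree \<Rightarrow> half_edge set" where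
  "half_edges t = {ToParent p | p. p \<in> tree_vertices t \<and> p \<noteq> []} \<union>
     {ToBranch p i | p i. p \<in> tree_vertices t \<and> i < length (branches (subtree t p))}"

definition tree_degree_distribution :: "blossoming_tree \<Rightarrow> colour \<Rightarrow> nat \<Rightarrow> nat" where
  "tree_degree_distribution t c k = card {p \<in> tree_vertices t.
     vertex_colour (subtree t p) = c \<and> card {h \<in> half_edges t. origin h = p} = k}"

fun next_clockwise :: "blossoming_tree \<Rightarrow> half_edge \<Rightarrow> half_edge" where
  "next_clockwise t (ToParent p) =
     (if branches (subtree t p) = [] then ToParent p else ToBranch p 0)"
| "next_clockwise t (ToBranch p i) =
     (if Suc i < length (branches (subtree t p)) then ToBranch p (Suc i)
      else if p = [] then ToBranch [] 0 else ToParent p)"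


section \<open>Closure\<close>

definition opening_stem :: "blossoming_tree \<Rightarrow> half_edge \<Rightarrow> bool" where
  "opening_stem t h \<longleftrightarrow> h \<in> half_edges t \<and>
     (\<exists>p i. h = ToBranch p i \<and> branches (subtree t p) ! i = Opening)"

definition closing_stem :: "blossoming_tree \<Rightarrow> half_edge \<Rightarrow> bool" where
  "closing_stem t h \<longleftrightarrow> h \<in> half_edges t \<and>
     (\<exists>p i. h = ToBranch p i \<and> branches (subtree t p) ! i = Closing)"

text \<open>
  The contour, walked clockwise (that is, with the tree on the right-hand side) from the root
  corner: a stem is met once, and a tree edge is met at its upper end on the way down and at its
  lower end on the way up. The arguments of the second function are the address of the current
  vertex and the index of the first branch of the list.
\<close>

fun contour_from :: "nat list \<Rightarrow> blossoming_tree \<Rightarrow> half_edge list"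
  and contour_branches :: "nat list \<Rightarrow> nat \<Rightarrow> branch list \<Rightarrow> half_edge list" where
  "contour_from p (Vertex c bs) = contour_branches p 0 bs"
| "contour_branches p i [] = []"
| "contour_branches p i (Opening # bs) = ToBranch p i # contour_branches p (Suc i) bs"
| "contour_branches p i (Closing # bs) = ToBranch p i # contour_branches p (Suc i) bs"
| "contour_branches p i (Edge t # bs) =
     ToBranch p i # contour_from (p @ [i]) t @ ToParent (p @ [i]) #
       contour_branches p (Suc i) bs"

definition contour :: "blossoming_tree \<Rightarrow> half_edge list" where
  "contour t = contour_from [] t"

text \<open>Contour words whose stems form a balanced parenthesis word; tree edges are skipped.\<close>

inductive balanced :: "blossoming_tree \<Rightarrow> half_edge list \<Rightarrow> bool" for t where
  balanced_Nil: "balanced t []"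
| balanced_skip: "\<not> opening_stem t h \<Longrightarrow> \<not> closing_stem t h \<Longrightarrow> balanced t u \<Longrightarrow> balanced t (h # u)"
| balanced_pair: "opening_stem t a \<Longrightarrow> closing_stem t b \<Longrightarrow> balanced t u \<Longrightarrow> balanced t v \<Longrightarrow>
    balanced t (a # u @ b # v)"

text \<open>
  \<open>closure_edge t a u b\<close>: the opening stem \<open>a\<close> is matched with the closing stem \<open>b\<close> in the cyclic
  contour word, and \<open>u\<close> is the part of the contour that lies between them, clockwise.
\<close>

definition closure_edge ::
    "blossoming_tree \<Rightarrow> half_edge \<Rightarrow> half_edge list \<Rightarrow> half_edge \<Rightarrow> bool" where
  "closure_edge t a u b \<longleftrightarrow> opening_stem t a \<and> closing_stem t b \<and> balanced t u \<and>
     (\<exists>k v. rotate k (contour t) = a # u @ b # v)"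

definition closure_mate :: "blossoming_tree \<Rightarrow> half_edge \<Rightarrow> half_edge" where
  "closure_mate t h =
     (if h \<notin> half_edges t then h
      else if opening_stem t h then THE b. \<exists>u. closure_edge t h u b
      else if closing_stem t h then THE a. \<exists>u. closure_edge t a u h
      else case h of ToParent p \<Rightarrow> ToBranch (butlast p) (last p)
                   | ToBranch p i \<Rightarrow> ToParent (p @ [i]))"

text \<open>
  The new edge is drawn along the contour from \<open>a\<close> to \<open>b\<close>, with the infinite face on its left. It
  therefore cuts off from the infinite face exactly the corners met between \<open>a\<close> and \<open>b\<close>, the last
  one being the corner just before \<open>b\<close>.
\<close>

definition enclosed :: "blossoming_tree \<Rightarrow> (nat list, half_edge) corner \<Rightarrow> bool" where
  "enclosed t x \<longleftrightarrow> (\<exists>a u b. closure_edge t a u b \<and> x \<in> Before ` (set u \<union> {b}))"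

definition closure_skeleton :: "blossoming_tree \<Rightarrow> (nat list, half_edge) pre_digraph" where
  "closure_skeleton t = \<lparr> verts = tree_vertices t, arcs = half_edges t,
     tail = origin, head = (\<lambda>h. origin (closure_mate t h)) \<rparr>"

definition tree_root_corner :: "blossoming_tree \<Rightarrow> (nat list, half_edge) corner" where
  "tree_root_corner t = (if branches t = [] then Isolated [] else Before (ToBranch [] 0))"

definition tree_corners :: "blossoming_tree \<Rightarrow> (nat list, half_edge) corner set" where
  "tree_corners t = Before ` half_edges t \<union> (if branches t = [] then {Isolated []} else {})"

definition closure_map :: "blossoming_tree \<Rightarrow> (nat list, half_edge) rooted_map" where
  "closure_map t = \<lparr> skeleton = closure_skeleton t, mate = closure_mate t,
     rot = (\<lambda>h. if h \<in> half_edges t then next_clockwise t h else h),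
     colour_of = (\<lambda>p. vertex_colour (subtree t p)),
     root_corner = tree_root_corner t,
     outer_face = {x \<in> tree_corners t. \<not> enclosed t x} \<rparr>"

definition tree_closure :: "blossoming_tree \<Rightarrow> (nat, nat) rooted_map set" where
  "tree_closure t = map_class (closure_map t)"

end

theory Submission
  imports Defs
begin

text \<open>
  Orient every edge of a bipartite map from its black to its white end, and cross it dually from left
  to right. In a closed tree the non-tree edges then form a spanning tree of the dual graph that is
  oriented away from the outer face. Let every edge carry one unit of flow, slightly perturbed such
  that every vertex other than the root vertex supplies a small extra amount, and push all of this
  flow to the tree edges. The flow that a tree edge receives is determined by the charge of the
  subtree below it, and the conditions on the charges say exactly that it is positive; the
  perturbation accounts for the asymmetry between the two colours. Rerouting the flow amounts to
  adding the coboundary of a potential on the faces, namely the distance from the outer face along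
  the dual spanning tree. So a tree is well-charged iff its non-tree edges are exactly the dual edges
  on shortest paths from the outer face. Generic lengths make shortest paths unique, hence the tree
  can be recovered from the map; conversely the complement of a tree of shortest dual paths is a
  spanning tree, which opens up to a well-charged tree.
\<close>

text \<open>For a non-root vertex with sign \<open>s\<close> (black \<open>1\<close>, white
  \<open>- 1\<close>), charge \<open>c\<close> and \<open>m\<close> vertices in its subtree, the
  flow rerouted to its parent edge is \<open>N * (s - c) + m\<close>: an edge weighs
  \<open>N\<close>, and each vertex except the root supplies one extra unit. Measured from black to
  white it is \<open>N * (1 - c) + m\<close> or \<open>N * (1 + c) - m\<close>; as
  \<open>0 < m < N\<close>, these are positive iff \<open>c\<close> is at most 1 or at least 0,
  respectively. They never vanish: this is the genericity of the lengths. Dual edges are one-way, so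
  it is not evident that all faces can be reached from the outer face. Around a face the two
  directions alternate; hence as many dual edges enter as leave, and a set of faces that no dual
  edge leaves is not entered by one either. Paths are compared through potentials: the distance
  function is unique, and the tree edges are those of positive reduced length. Planarity enters the
  opening of a map only as a count: the complement of a shortest-path tree has a single contour in
  any genus, hence is connected, and Euler's relation gives it the number of edges of a
  tree.\<close>

section \<open>Parenthesis words and walks\<close>

text \<open>The letters are classified by arbitrary predicates because such words are read twice: on
  the stems of a tree, and on the half-edges of a map before any tree has been built from
  it.\<close>

inductive wbal :: "('a \<Rightarrow> bool) \<Rightarrow> ('a \<Rightarrow> bool) \<Rightarrow> 'a list \<Rightarrow> bool" for op cl where
  wbal_Nil: "wbal op cl []"
| wbal_skip: "\<not> op h \<Longrightarrow> \<not> cl h \<Longrightarrow> wbal op cl u \<Longrightarrow> wbal op cl (h # u)"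
| wbal_pair: "op a \<Longrightarrow> cl b \<Longrightarrow> wbal op cl u \<Longrightarrow> wbal op cl v \<Longrightarrow> wbal op cl (a # u @ b # v)"

lemma balanced_iff_wbal: "balanced t u \<longleftrightarrow> wbal (opening_stem t) (closing_stem t) u"
proof
  show "balanced t u \<Longrightarrow> wbal (opening_stem t) (closing_stem t) u"
    by (induction rule: balanced.induct) (auto intro: wbal.intros)
  show "wbal (opening_stem t) (closing_stem t) u \<Longrightarrow> balanced t u"
    by (induction rule: wbal.induct) (auto intro: balanced.intros)
qed

lemma wbal_append: "wbal op cl u \<Longrightarrow> wbal op cl v \<Longrightarrow> wbal op cl (u @ v)"
  by (induction rule: wbal.induct) (auto intro: wbal.intros)

lemma wbal_map:
  assumes "wbal op cl u" "\<And>x. x \<in> set u \<Longrightarrow> op' (f x) = op x" "\<And>x. x \<in> set u \<Longrightarrow> cl' (f x) = cl x"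
  shows "wbal op' cl' (map f u)"
  using assms
proof (induction rule: wbal.induct)
  case (wbal_skip h u)
  then show ?case by (simp add: wbal.wbal_skip)
next
  case (wbal_pair a b u v)
  then show ?case by (simp add: wbal.wbal_pair)
qed (simp add: wbal.wbal_Nil)

text \<open>Gives the nesting of the new edges: a stem between two matched stems has its partner
  between them as well.\<close>

lemma wbal_opening_split:
  assumes "wbal op cl w" "a \<in> set w" "op a" "\<And>h. op h \<Longrightarrow> \<not> cl h"
  shows "\<exists>v1 u b v2. w = v1 @ a # u @ b # v2 \<and> cl b \<and> wbal op cl u"
  using assms(1,2)
proof (induction rule: wbal.induct)
  case (wbal_skip h u)
  then show ?case using assms(3) by (metis append_Cons set_ConsD)
next
  case (wbal_pair a' b u v)
  consider "a = a'" | "a \<in> set u" | "a \<in> set v"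
    using wbal_pair.prems wbal_pair.hyps assms(3,4) by auto
  then show ?case
  proof cases
    case 1
    then show ?thesis using wbal_pair.hyps by (metis append_Nil)
  next
    case 2
    then obtain v1 u' b' v2 where "u = v1 @ a # u' @ b' # v2" "cl b'" "wbal op cl u'"
      using wbal_pair.IH(1) by blast
    then show ?thesis
      by (intro exI[of _ "a' # v1"] exI[of _ u'] exI[of _ b'] exI[of _ "v2 @ b # v"]) simp
  next
    case 3
    then obtain v1 u' b' v2 where "v = v1 @ a # u' @ b' # v2" "cl b'" "wbal op cl u'"
      using wbal_pair.IH(2) by blast
    then show ?thesis
      by (intro exI[of _ "a' # u @ b # v1"] exI[of _ u'] exI[of _ b'] exI[of _ "v2"]) simp
  qed
qed auto

lemma wbal_closing_split:
  assumes "wbal op cl w" "b \<in> set w" "cl b" "\<And>h. op h \<Longrightarrow> \<not> cl h"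
  shows "\<exists>v1 u a v2. w = v1 @ a # u @ b # v2 \<and> op a \<and> wbal op cl u"
  using assms(1,2)
proof (induction rule: wbal.induct)
  case (wbal_skip h u)
  then show ?case using assms(3) by (metis append_Cons set_ConsD)
next
  case (wbal_pair a' b' u v)
  consider "b = b'" | "b \<in> set u" | "b \<in> set v"
    using wbal_pair.prems wbal_pair.hyps assms(3,4) by auto
  then show ?case
  proof cases
    case 1
    then show ?thesis using wbal_pair.hyps by (metis append_Nil)
  next
    case 2
    then obtain v1 u' a v2 where "u = v1 @ a # u' @ b # v2" "op a" "wbal op cl u'"
      using wbal_pair.IH(1) by blast
    then show ?thesis
      by (intro exI[of _ "a' # v1"] exI[of _ u'] exI[of _ a] exI[of _ "v2 @ b' # v"]) simp
  next
    case 3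
    then obtain v1 u' a v2 where "v = v1 @ a # u' @ b # v2" "op a" "wbal op cl u'"
      using wbal_pair.IH(2) by blast
    then show ?thesis
      by (intro exI[of _ "a' # u @ b' # v1"] exI[of _ u'] exI[of _ a] exI[of _ "v2"]) simp
  qed
qed auto

section \<open>Heights of parenthesis words\<close>

locale parentheses =
  fixes op cl :: "'a \<Rightarrow> bool"
  assumes op_not_cl: "op h \<Longrightarrow> \<not> cl h"
begin

definition height :: "'a list \<Rightarrow> int" where
  "height u = (\<Sum>h\<leftarrow>u. if op h then 1 else if cl h then - 1 else 0)"

lemma height_simps [simp]:
  "height [] = 0"
  "height (h # u) = (if op h then 1 else if cl h then - 1 else 0) + height u"
  "height (u @ v) = height u + height v"
  by (simp_all add: height_def)

lemma height_wbal: "wbal op cl u \<Longrightarrow> height u = 0"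
  by (induction rule: wbal.induct) (auto simp: op_not_cl)

lemma height_wbal_take: "wbal op cl w \<Longrightarrow> 0 \<le> height (take n w)"
proof (induction arbitrary: n rule: wbal.induct)
  case (wbal_skip h u)
  then show ?case by (cases n) auto
next
  case (wbal_pair a b u v)
  show ?case
  proof (cases n)
    case (Suc m)
    show ?thesis
    proof (cases "m \<le> length u")
      case True
      then show ?thesis using wbal_pair Suc by (auto simp: add_nonneg_nonneg)
    next
      case False
      then obtain k where "m = length u + Suc k" by (metis less_iff_Suc_add add_Suc_right not_le)
      then show ?thesis using wbal_pair Suc op_not_cl by (auto simp: height_wbal)
    qed
  qed simp
qed simp

lemma height_wbal_prefix: "wbal op cl (u @ v) \<Longrightarrow> 0 \<le> height u"
  using height_wbal_take[of "u @ v" "length u"] by simp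

text \<open>If \<open>u\<close> were shorter than \<open>u'\<close>, then \<open>u @ [b]\<close>
  would be a prefix of height \<open>- 1\<close> of the balanced word \<open>u'\<close>.\<close>

lemma closing_unique:
  assumes "wbal op cl u" "wbal op cl u'" "cl b" "cl b'" "u @ b # v = u' @ b' # v'"
  shows "u = u'"
proof -
  have *: False if "wbal op cl u" "wbal op cl u'" "cl b" "u @ b # v = u' @ b' # v'" "length u < length u'"
    for u u' b b' v v'
  proof -
    have "u' = u @ b # drop (Suc (length u)) u'"
      using that(4,5) by (metis append_eq_append_conv_if append_take_drop_id drop_Suc_Cons
        drop_drop leD less_imp_le_nat list.inject nth_append_length Cons_nth_drop_Suc nth_append)
    then have "0 \<le> height (u @ [b])"
      using height_wbal_prefix[of "u @ [b]" "drop (Suc (length u)) u'"] that(2) by simp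
    then show False using that(1,3) height_wbal[OF that(1)] op_not_cl[of b] by (auto split: if_splits)
  qed
  have "length u = length u'"
    using *[of u u' b v b' v'] *[of u' u b' v' b v] assms by (metis linorder_neqE_nat)
  then show ?thesis using assms(5) by simp
qed

text \<open>If \<open>u\<close> were shorter than \<open>u'\<close>, then \<open>u'\<close> would
  end in \<open>a # u\<close>, which has height 1, and the prefix before it would have height
  \<open>- 1\<close>.\<close>

lemma opening_unique:
  assumes "wbal op cl u" "wbal op cl u'" "op a" "op a'" "v @ a # u = v' @ a' # u'"
  shows "u = u'"
proof -
  have *: False if "wbal op cl u" "wbal op cl u'" "op a" "v @ a # u = v' @ a' # u'" "length u < length u'"
    for u u' a a' v v'
  proof -
    note eq = that(4) and len = that(5)
    have "\<exists>w. u' = w @ a # u"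
    proof -
      obtain us where us: "v = v' @ us \<and> us @ a # u = a' # u' \<or> v @ us = v' \<and> a # u = us @ a' # u'"
        using eq by (auto simp: append_eq_append_conv2)
      have "us \<noteq> []" "length (us @ a' # u') > length (a # u)" using us len by auto
      then show ?thesis using us by (cases us) auto
    qed
    then obtain w where w: "u' = w @ a # u" by blast
    have "0 \<le> height w" using height_wbal_prefix[of w "a # u"] that(2) w by simp
    moreover have "height u' = 0" using height_wbal[OF that(2)] .
    ultimately show False using w that(1,3) height_wbal[of u] by auto
  qed
  have "length u = length u'"
    using *[of u u' a v v' a'] *[of u' u a' v' v a] assms by (metis linorder_neqE_nat)
  then show ?thesis using assms(5) by simp
qed

text \<open>A word with \<open>n\<close> pending opening letters, separated by balanced words: the
  state of a stack machine that reads from the left and matches each closing letter with the topmost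
  pending one.\<close>

inductive open_stack :: "nat \<Rightarrow> 'a list \<Rightarrow> bool" where
  "wbal op cl w \<Longrightarrow> open_stack 0 w"
| "open_stack n w \<Longrightarrow> op a \<Longrightarrow> wbal op cl u \<Longrightarrow> open_stack (Suc n) (w @ a # u)"

lemma open_stack_append: "open_stack n w \<Longrightarrow> wbal op cl v \<Longrightarrow> open_stack n (w @ v)"
proof (induction rule: open_stack.induct)
  case (2 n w a u)
  then show ?case using open_stack.intros(2)[of n w a "u @ v"] by (simp add: wbal_append)
qed (auto intro: open_stack.intros wbal_append)

lemma open_stack_height: "open_stack n w \<Longrightarrow> height w = int n"
  by (induction rule: open_stack.induct) (auto simp: height_wbal)

lemma open_stack_exists:
  "(\<And>n. 0 \<le> height (take n w)) \<Longrightarrow> \<exists>n. open_stack n w"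
proof (induction w rule: rev_induct)
  case (snoc h w)
  have "0 \<le> height (take n w)" for n
    using snoc.prems[of "min n (length w)"] by (simp add: min_def split: if_splits)
  then obtain n where n: "open_stack n w" using snoc.IH by blast
  have h0: "0 \<le> height (w @ [h])" using snoc.prems[of "length (w @ [h])"] by simp
  consider "op h" | "cl h" "\<not> op h" | "\<not> op h" "\<not> cl h" by blast
  then show ?case
  proof cases
    case 1
    then show ?thesis using open_stack.intros(2)[OF n 1 wbal_Nil] by blast
  next
    case 2
    \<comment> \<open>The height of the prefix is nonnegative, so some opening letter is still
      pending for the closing letter \<open>h\<close>.\<close>
    then have "n \<noteq> 0" using h0 open_stack_height[OF n] by auto
    with n obtain m w' a u where w: "w = w' @ a # u" "open_stack m w'" "op a" "wbal op cl u"
      by (auto elim: open_stack.cases)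
    then have "open_stack m (w' @ a # u @ h # [])"
      using 2 by (intro open_stack_append wbal_pair wbal_Nil) auto
    then show ?thesis using w by auto
  next
    case 3
    then show ?thesis using open_stack_append[OF n, of "[h]"] by (blast intro: wbal_skip wbal_Nil)
  qed
qed (auto intro: open_stack.intros wbal_Nil)

lemma wbal_if_heights:
  assumes "\<And>n. 0 \<le> height (take n w)" "height w = 0"
  shows "wbal op cl w"
proof -
  obtain n where n: "open_stack n w" using open_stack_exists assms(1) by blast
  then have "n = 0" using assms(2) open_stack_height by fastforce
  then show ?thesis using n by (auto elim: open_stack.cases)
qed

text \<open>Start reading where the height is minimal.\<close>

lemma wbal_rotate:
  assumes "height w = 0"
  shows "\<exists>k. wbal op cl (rotate k w)"
proof -
  define m where "m = arg_min_on (\<lambda>k. height (take k w)) {..length w}"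
  have m: "m \<le> length w" "\<And>k. k \<le> length w \<Longrightarrow> height (take m w) \<le> height (take k w)"
    using arg_min_if_finite(1)[of "{..length w}" "\<lambda>k. height (take k w)"]
      arg_min_least[of "{..length w}" _ "\<lambda>k. height (take k w)"]
    by (auto simp: m_def)
  have r: "rotate m w = drop m w @ take m w"
  proof (cases "m = length w")
    case False
    then show ?thesis using m(1) by (simp add: rotate_drop_take)
  qed simp
  have tot: "height (take m w) + height (drop m w) = 0"
    using assms height_simps(3)[of "take m w" "drop m w"] by simp
  \<comment> \<open>A prefix of the rotated word ends either before or after the point where
    \<open>w\<close> wraps around; in both cases its height is that of a prefix of \<open>w\<close>
    minus the minimal one.\<close>
  have "0 \<le> height (take n (rotate m w))" for n
  proof (cases "n \<le> length w - m")
    case True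
    have "height (take m w) + height (take n (drop m w)) = height (take (m + n) w)"
      by (metis height_simps(3) take_add)
    moreover have "height (take m w) \<le> height (take (m + n) w)" using m True by simp
    ultimately show ?thesis using True by (simp add: r)
  next
    case False
    then have "take n (rotate m w) = drop m w @ take (min (n - (length w - m)) m) w"
      using m(1) by (simp add: r min.commute)
    moreover have "height (take m w) \<le> height (take (min (n - (length w - m)) m) w)"
      using m by simp
    ultimately show ?thesis using tot by simp
  qed
  moreover have "height (rotate m w) = 0" using tot r by simp
  ultimately show ?thesis using wbal_if_heights by blast
qed

end

section \<open>Walks along the iterates of a function\<close>

abbreviation walk :: "('a \<Rightarrow> 'a) \<Rightarrow> 'a list \<Rightarrow> bool" where
  "walk f \<equiv> successively (\<lambda>x y. y = f x)"

lemma walk_nth: "walk f L \<Longrightarrow> Suc i < length L \<Longrightarrow> L ! Suc i = f (L ! i)"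
  by (induction L arbitrary: i rule: induct_list012) (auto simp: nth_Cons split: nat.splits)

lemma walk_funpow: "walk f L \<Longrightarrow> i < length L \<Longrightarrow> L ! i = (f ^^ i) (L ! 0)"
  by (induction i) (auto simp: walk_nth)

lemma walkI: "(\<And>i. Suc i < length L \<Longrightarrow> L ! Suc i = f (L ! i)) \<Longrightarrow> walk f L"
proof (induction L rule: induct_list012)
  case (3 x y zs)
  have "walk f (y # zs)" using 3(3)[of "Suc _"] by (intro 3(2)) simp
  then show ?case using 3(3)[of 0] by simp
qed auto

lemma walk_unique:
  assumes "walk f L" "walk f L'" "hd L = hd L'" "length L = length L'"
  shows "L = L'"
proof (cases "L = []")
  case False
  then have "L ! 0 = L' ! 0" using assms(3,4) by (metis hd_conv_nth length_0_conv)
  then show ?thesis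
    using walk_funpow[OF assms(1)] walk_funpow[OF assms(2)] assms(4) by (intro nth_equalityI) metis+
qed (use assms in simp)

section \<open>Orbits and cyclic lists\<close>

lemma walk_append:
  "walk f u \<Longrightarrow> walk f v \<Longrightarrow> u \<noteq> [] \<Longrightarrow> v \<noteq> [] \<Longrightarrow> hd v = f (last u) \<Longrightarrow> walk f (u @ v)"
  by (auto simp: successively_append_iff)

lemma walk_Cons: "walk f v \<Longrightarrow> v \<noteq> [] \<Longrightarrow> hd v = f x \<Longrightarrow> walk f (x # v)"
  by (cases v) auto

text \<open>The functions in question are bijections of a finite carrier and arbitrary elsewhere.
  Extended by the identity they become permutations, to which the general facts on orbits
  apply.\<close>

lemma
  assumes "bij_betw f A A" "finite A" "x \<in> A"
  shows bij_self_in_orbit: "x \<in> orbit f x"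
    and bij_orbit_subset: "orbit f x \<subseteq> A"
    and bij_orbit_iff: "y \<in> orbit f x \<longleftrightarrow> (\<exists>n. y = (f ^^ n) x)"
    and bij_orbit_eq: "y \<in> orbit f x \<Longrightarrow> orbit f y = orbit f x"
    and bij_orbit_step: "orbit f (f x) = orbit f x"
proof -
  define p where "p = (\<lambda>x. if x \<in> A then f x else x)"
  have "bij_betw p A A" using assms(1) by (simp add: p_def cong: bij_betw_cong)
  then have "p permutes A" by (rule bij_imp_permutes) (simp add: p_def)
  then have perm: "permutation p" using assms(2) permutation_permutes by blast
  have pow: "(p ^^ n) x = (f ^^ n) x \<and> (f ^^ n) x \<in> A" for n
    using assms(1,3) by (induction n) (auto simp: p_def bij_betw_def)
  have same: "orbit f x = orbit p x" using pow by (auto simp: orbit_altdef)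
  then show self: "x \<in> orbit f x" using permutation_self_in_orbit[OF perm] by simp
  show "orbit f x \<subseteq> A" using pow by (auto simp: orbit_altdef)
  show "y \<in> orbit f x \<longleftrightarrow> (\<exists>n. y = (f ^^ n) x)"
    using orbit_altdef_self_in[OF self] by auto
  show eq: "orbit f y = orbit f x" if "y \<in> orbit f x" for y
    using orbit_swap[OF self that] that by (blast intro: orbit_trans)
  show "orbit f (f x) = orbit f x" by (rule eq) (rule orbit.base)
qed

lemma orbit_invariant:
  assumes "y \<in> orbit f x" "x \<in> A" "\<And>x. x \<in> A \<Longrightarrow> f x \<in> A" "\<And>x. x \<in> A \<Longrightarrow> D (f x) = D x"
  shows "D y = D x"
proof -
  have "y \<in> A \<and> D y = D x" using assms(1) by induction (auto simp: assms)
  then show ?thesis ..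
qed

definition cyclic_list :: "('a \<Rightarrow> 'a) \<Rightarrow> 'a list \<Rightarrow> bool" where
  "cyclic_list f L \<longleftrightarrow> distinct L \<and> (\<forall>i < length L. f (L ! i) = L ! (Suc i mod length L))"

lemma cyclic_list_rotate: "cyclic_list f L \<Longrightarrow> cyclic_list f (rotate k L)"
proof -
  assume L: "cyclic_list f L"
  show ?thesis
  proof (cases "L = []")
    case False
    then show ?thesis using L
      by (auto simp: cyclic_list_def nth_rotate mod_Suc_eq mod_add_right_eq)
  qed (use L in simp)
qed

lemma cyclic_list_walk: "cyclic_list f L \<Longrightarrow> walk f L"
  by (rule walkI) (auto simp: cyclic_list_def dest: Suc_lessD)

lemma cyclic_list_last: "cyclic_list f L \<Longrightarrow> L \<noteq> [] \<Longrightarrow> f (last L) = hd L"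
  by (auto simp: cyclic_list_def last_conv_nth hd_conv_nth)

lemma cyclic_listI:
  assumes "distinct L" "walk f (L @ [hd L])"
  shows "cyclic_list f L"
proof -
  have "f (L ! i) = L ! (Suc i mod length L)" if i: "i < length L" for i
  proof (cases "Suc i < length L")
    case True
    then show ?thesis using walk_nth[OF assms(2), of i] i by (simp add: nth_append)
  next
    case False
    then have l: "Suc i = length L" "L \<noteq> []" using i by auto
    then have "hd L = f (L ! i)" using walk_nth[OF assms(2), of i] i by (simp add: nth_append)
    then show ?thesis using l by (simp add: hd_conv_nth)
  qed
  then show ?thesis using assms(1) by (simp add: cyclic_list_def)
qed

lemma cyclic_list_funpow:
  "cyclic_list f L \<Longrightarrow> i < length L \<Longrightarrow> (f ^^ n) (L ! i) = L ! ((i + n) mod length L)"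
proof (induction n)
  case (Suc n)
  have "(i + n) mod length L < length L" using Suc.prems(2) by (intro mod_less_divisor) auto
  then show ?case using Suc by (simp add: cyclic_list_def mod_Suc_eq)
qed simp

lemma cyclic_list_reach:
  assumes "cyclic_list f L" "x \<in> set L" "y \<in> set L"
  shows "\<exists>n. y = (f ^^ n) x"
proof -
  obtain i j where ij: "i < length L" "j < length L" "x = L ! i" "y = L ! j"
    using assms(2,3) by (auto simp: in_set_conv_nth)
  have "(i + (j + length L - i)) mod length L = j" using ij by simp
  then show ?thesis using cyclic_list_funpow[OF assms(1) ij(1), of "j + length L - i"] ij
    by (intro exI[of _ "j + length L - i"]) simp
qed

lemma cyclic_list_bij:
  assumes "cyclic_list f L"
  shows "bij_betw f (set L) (set L)"
proof -
  have m: "f x \<in> set L" if "x \<in> set L" for x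
    using that assms unfolding cyclic_list_def in_set_conv_nth
    by (metis length_pos_if_in_set mod_less_divisor nth_mem that)
  have "y \<in> f ` set L" if y: "y \<in> set L" for y
  proof -
    obtain n where "y = (f ^^ n) (f y)" using cyclic_list_reach[OF assms m[OF y] y] by blast
    then have "y = f ((f ^^ n) y)" by (metis funpow_swap1)
    moreover have "(f ^^ k) y \<in> set L" for k by (induction k) (auto simp: y m)
    ultimately show ?thesis by blast
  qed
  then have "f ` set L = set L" using m by auto
  then show ?thesis by (simp add: bij_betw_def eq_card_imp_inj_on)
qed

text \<open>Without repetitions the walk is no longer than the cycle, so it is a prefix of the
  rotation that starts at its head. This turns local information on successors into the rotations by
  which \<open>closure_edge\<close> is defined.\<close>

lemma cyclic_list_walk_segment:
  assumes "cyclic_list f L" "walk f w" "w \<noteq> []" "hd w \<in> set L" "distinct w"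
  shows "\<exists>k v. rotate k L = w @ v"
proof -
  obtain k where k: "k < length L" "L ! k = hd w" using assms(4) by (auto simp: in_set_conv_nth)
  then have "L \<noteq> []" by auto
  let ?R = "rotate k L"
  have R: "cyclic_list f ?R" "?R ! 0 = hd w" "length ?R = length L"
    using assms(1) k \<open>L \<noteq> []\<close> by (auto simp: cyclic_list_rotate nth_rotate)
  have w0: "w ! 0 = hd w" using assms(3) by (simp add: hd_conv_nth)
  have nth: "w ! i = ?R ! (i mod length L)" if "i < length w" for i
    using walk_funpow[OF assms(2) that] cyclic_list_funpow[OF R(1), of 0 i] \<open>L \<noteq> []\<close> R w0 by simp
  have "set w \<subseteq> set L"
  proof
    fix x assume "x \<in> set w"
    then obtain i where "i < length w" "x = w ! i" by (auto simp: in_set_conv_nth)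
    then have "x = ?R ! (i mod length L)" using nth by simp
    then have "x \<in> set ?R" using R(3) \<open>L \<noteq> []\<close> by (metis nth_mem length_greater_0_conv mod_less_divisor)
    then show "x \<in> set L" by simp
  qed
  then have "length w \<le> length L"
    using assms(5) by (metis card_length card_mono distinct_card le_trans List.finite_set)
  then have "w = take (length w) ?R"
    using nth R(3) by (intro nth_equalityI) auto
  then show ?thesis by (metis append_take_drop_id)
qed

section \<open>Addresses in blossoming trees\<close>

text \<open>The mutual recursion with branches is hidden: the predicate for branches only speaks of
  \<open>Edge\<close>.\<close>

lemma tree_induct [case_names Vertex]:
  assumes "\<And>c bs. (\<And>s. Edge s \<in> set bs \<Longrightarrow> P s) \<Longrightarrow> P (Vertex c bs)"
  shows "P t"
  by (rule blossoming_tree.induct[of "\<lambda>b. \<forall>s. b = Edge s \<longrightarrow> P s" P]) (auto intro: assms)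

lemma subtree_at_append:
  "subtree_at t (p @ q) = (case subtree_at t p of None \<Rightarrow> None | Some s \<Rightarrow> subtree_at s q)"
  by (induction t p rule: subtree_at.induct) (auto split: branch.splits)

lemma subtree_at_snoc:
  "subtree_at t p = Some (Vertex c bs) \<Longrightarrow>
    subtree_at t (p @ [i]) = (if i < length bs then case bs ! i of Edge s \<Rightarrow> Some s | _ \<Rightarrow> None else None)"
  by (simp add: subtree_at_append split: branch.splits)

lemma Nil_in_tree_vertices [simp]: "[] \<in> tree_vertices t"
  by (simp add: tree_vertices_def)

lemma tree_vertices_prefix: "p @ q \<in> tree_vertices t \<Longrightarrow> p \<in> tree_vertices t"
  by (auto simp: tree_vertices_def subtree_at_append split: option.splits)

lemma subtree_at_Some:
  "p \<in> tree_vertices t \<Longrightarrow> subtree_at t p = Some (subtree t p)"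
  by (auto simp: tree_vertices_def)

lemma snoc_in_tree_vertices_iff:
  "p @ [i] \<in> tree_vertices t \<longleftrightarrow> p \<in> tree_vertices t \<and> i < length (branches (subtree t p)) \<and>
     (\<exists>s. branches (subtree t p) ! i = Edge s)"
proof (cases "p \<in> tree_vertices t")
  case True
  obtain c bs where "subtree t p = Vertex c bs" by (cases "subtree t p")
  then show ?thesis using True subtree_at_snoc[of t p c bs i] subtree_at_Some[OF True]
    by (auto simp: tree_vertices_def split: branch.splits if_splits)
qed (auto dest: tree_vertices_prefix)

lemma subtree_snoc:
  assumes "p \<in> tree_vertices t" "i < length (branches (subtree t p))"
    "branches (subtree t p) ! i = Edge s"
  shows "subtree t (p @ [i]) = s"
proof -
  obtain c bs where "subtree t p = Vertex c bs" by (cases "subtree t p")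
  then show ?thesis using assms subtree_at_snoc[of t p c bs i] subtree_at_Some[OF assms(1)] by simp
qed

lemma tree_vertices_Vertex:
  "tree_vertices (Vertex c bs) =
     insert [] (\<Union>i < length bs. case bs ! i of Edge s \<Rightarrow> (#) i ` tree_vertices s | _ \<Rightarrow> {})"
proof -
  have "p \<in> tree_vertices (Vertex c bs) \<longleftrightarrow>
    p = [] \<or> (\<exists>i q. p = i # q \<and> i < length bs \<and> (\<exists>s. bs ! i = Edge s \<and> q \<in> tree_vertices s))" for p
    by (cases p) (auto simp: tree_vertices_def split: branch.splits if_splits)
  then show ?thesis by (fastforce split: branch.splits)
qed

text \<open>The number of vertices below a tree edge is the extra supply that this edge has to
  carry.\<close>

definition tree_size :: "blossoming_tree \<Rightarrow> nat" where
  "tree_size t = card (tree_vertices t)"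

definition branch_size :: "branch \<Rightarrow> nat" where
  "branch_size b = (case b of Edge s \<Rightarrow> tree_size s | _ \<Rightarrow> 0)"

lemma finite_tree_vertices [simp]: "finite (tree_vertices t)"
proof (induction t rule: tree_induct)
  case (Vertex c bs)
  have "finite (case bs ! i of Edge s \<Rightarrow> (#) i ` tree_vertices s | _ \<Rightarrow> {})" if "i < length bs" for i
    using Vertex nth_mem[OF that] by (auto split: branch.splits)
  then show ?case by (simp add: tree_vertices_Vertex)
qed

lemma tree_size_Vertex: "tree_size (Vertex c bs) = Suc (\<Sum>i < length bs. branch_size (bs ! i))"
proof -
  let ?A = "\<lambda>i. case bs ! i of Edge s \<Rightarrow> (#) i ` tree_vertices s | _ \<Rightarrow> {}"
  have "card (?A i) = branch_size (bs ! i)" for i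
    by (auto simp: branch_size_def tree_size_def card_image split: branch.splits)
  moreover have "card (\<Union>i < length bs. ?A i) = (\<Sum>i < length bs. card (?A i))"
    by (rule card_UN_disjoint) (auto split: branch.splits)
  moreover have "[] \<notin> (\<Union>i < length bs. ?A i)" by (auto split: branch.splits)
  moreover have "finite (\<Union>i < length bs. ?A i)" by (auto split: branch.splits)
  ultimately show ?thesis unfolding tree_size_def tree_vertices_Vertex by simp
qed

lemma tree_size_pos: "0 < tree_size t"
  by (cases t) (simp add: tree_size_Vertex)

lemma tree_size_subtree: "subtree_at t p = Some s \<Longrightarrow> tree_size s \<le> tree_size t"
proof (induction t p rule: subtree_at.induct)
  case (2 c bs i p)
  then obtain s' where s': "i < length bs" "bs ! i = Edge s'" "subtree_at s' p = Some s"
    by (auto split: if_splits branch.splits)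
  then have "tree_size s \<le> tree_size s'" using 2 by simp
  also have "\<dots> = branch_size (bs ! i)" using s' by (simp add: branch_size_def)
  also have "\<dots> \<le> (\<Sum>i < length bs. branch_size (bs ! i))"
    using s'(1) by (intro member_le_sum) auto
  finally show ?case by (simp add: tree_size_Vertex)
qed simp

fun same_kind :: "branch \<Rightarrow> branch \<Rightarrow> bool" where
  "same_kind Opening Opening = True"
| "same_kind Closing Closing = True"
| "same_kind (Edge s) (Edge s') = True"
| "same_kind _ _ = False"

text \<open>It suffices to look at addresses common to both trees: equal kinds of branches at a
  vertex yield the same addresses of children, so common addresses propagate from the root to all
  vertices.\<close>

lemma tree_eqI:
  assumes "\<And>p s s'. subtree_at t p = Some s \<Longrightarrow> subtree_at t' p = Some s' \<Longrightarrow>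
    vertex_colour s = vertex_colour s' \<and> list_all2 same_kind (branches s) (branches s')"
  shows "t = t'"
  using assms
proof (induction t arbitrary: t' rule: tree_induct)
  case (Vertex c bs)
  obtain c' bs' where t': "t' = Vertex c' bs'" by (cases t')
  have root: "c = c'" "list_all2 same_kind bs bs'" using Vertex.prems[of "[]" "Vertex c bs" t'] t' by auto
  have "bs ! i = bs' ! i" if i: "i < length bs" for i
  proof -
    have k: "same_kind (bs ! i) (bs' ! i)" "i < length bs'"
      using root i by (auto simp: list_all2_conv_all_nth)
    show ?thesis
    proof (cases "bs ! i")
      case (Edge s)
      then obtain s' where s': "bs' ! i = Edge s'" using k by (cases "bs' ! i") auto
      have "Edge s \<in> set bs" using Edge i by (metis nth_mem)
      moreover have "vertex_colour r = vertex_colour r' \<and> list_all2 same_kind (branches r) (branches r')"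
        if "subtree_at s p = Some r" "subtree_at s' p = Some r'" for p r r'
        using Vertex.prems[of "i # p" r r'] that t' Edge s' i k(2) by simp
      ultimately have "s = s'" using Vertex.IH by blast
      then show ?thesis using Edge s' by simp
    qed (use k in \<open>cases "bs' ! i"; simp\<close>)+
  qed
  moreover have "length bs = length bs'" using root by (simp add: list_all2_lengthD)
  ultimately show ?case using root t' by (simp add: nth_equalityI)
qed

section \<open>Half-edges and the contour of a tree\<close>

lemma half_edges_simps [simp]:
  "ToBranch p i \<in> half_edges t \<longleftrightarrow> p \<in> tree_vertices t \<and> i < length (branches (subtree t p))"
  "ToParent p \<in> half_edges t \<longleftrightarrow> p \<in> tree_vertices t \<and> p \<noteq> []"
  by (auto simp: half_edges_def)

lemma origin_in_tree_vertices: "h \<in> half_edges t \<Longrightarrow> origin h \<in> tree_vertices t"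
  by (cases h) auto

lemma stem_simps [simp]:
  "\<not> opening_stem t (ToParent p)" "\<not> closing_stem t (ToParent p)"
  "opening_stem t (ToBranch p i) \<longleftrightarrow> p \<in> tree_vertices t \<and> i < length (branches (subtree t p)) \<and>
     branches (subtree t p) ! i = Opening"
  "closing_stem t (ToBranch p i) \<longleftrightarrow> p \<in> tree_vertices t \<and> i < length (branches (subtree t p)) \<and>
     branches (subtree t p) ! i = Closing"
  by (auto simp: opening_stem_def closing_stem_def)

lemma opening_stem_half_edge: "opening_stem t h \<Longrightarrow> h \<in> half_edges t"
  and closing_stem_half_edge: "closing_stem t h \<Longrightarrow> h \<in> half_edges t"
  by (auto simp: opening_stem_def closing_stem_def)

lemma opening_not_closing: "opening_stem t h \<Longrightarrow> \<not> closing_stem t h"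
  by (cases h) auto

definition stem :: "blossoming_tree \<Rightarrow> half_edge \<Rightarrow> bool" where
  "stem t h \<longleftrightarrow> opening_stem t h \<or> closing_stem t h"

primrec tree_mate :: "half_edge \<Rightarrow> half_edge" where
  "tree_mate (ToParent p) = ToBranch (butlast p) (last p)"
| "tree_mate (ToBranch p i) = ToParent (p @ [i])"

text \<open>The face permutation of the tree when each stem is regarded as its own mate;
  \<open>contour\<close> lists its only cycle.\<close>

definition tour :: "blossoming_tree \<Rightarrow> half_edge \<Rightarrow> half_edge" where
  "tour t h = (if stem t h then next_clockwise t h else next_clockwise t (tree_mate h))"

lemma stem_simps2 [simp]:
  "\<not> stem t (ToParent p)"
  "ToBranch p i \<in> half_edges t \<Longrightarrow> stem t (ToBranch p i) \<longleftrightarrow> p @ [i] \<notin> tree_vertices t"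
  by (auto simp: stem_def snoc_in_tree_vertices_iff) (metis branch.exhaust)+

lemma tree_mate_simps:
  assumes "h \<in> half_edges t" "\<not> stem t h"
  shows "tree_mate h \<in> half_edges t" "\<not> stem t (tree_mate h)" "tree_mate (tree_mate h) = h"
    "tree_mate h \<noteq> h"
proof -
  have "tree_mate h \<in> half_edges t \<and> \<not> stem t (tree_mate h) \<and> tree_mate (tree_mate h) = h \<and> tree_mate h \<noteq> h"
  proof (cases h)
    case (ToParent p)
    then obtain q i where "p = q @ [i]" using assms by (cases p rule: rev_cases) auto
    then show ?thesis using ToParent assms by (auto simp: snoc_in_tree_vertices_iff stem_def)
  qed (use assms in auto)
  then show "tree_mate h \<in> half_edges t" "\<not> stem t (tree_mate h)" "tree_mate (tree_mate h) = h"
    "tree_mate h \<noteq> h" by auto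
qed

definition half_edges_at :: "blossoming_tree \<Rightarrow> nat list \<Rightarrow> half_edge list" where
  "half_edges_at t p = (if p = [] then [] else [ToParent p]) @
     map (ToBranch p) [0..<length (branches (subtree t p))]"

lemma set_half_edges_at:
  "p \<in> tree_vertices t \<Longrightarrow> set (half_edges_at t p) = {h \<in> half_edges t. origin h = p}"
proof -
  assume p: "p \<in> tree_vertices t"
  have "h \<in> set (half_edges_at t p) \<longleftrightarrow> h \<in> half_edges t \<and> origin h = p" for h
    using p by (cases h) (auto simp: half_edges_at_def)
  then show ?thesis by blast
qed

lemma half_edges_at_cyclic: "cyclic_list (next_clockwise t) (half_edges_at t p)"
proof (cases "half_edges_at t p = []")
  case False
  show ?thesis
  proof (rule cyclic_listI)
    show "distinct (half_edges_at t p)"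
      by (auto simp: half_edges_at_def distinct_map inj_on_def)
    show "walk (next_clockwise t) (half_edges_at t p @ [hd (half_edges_at t p)])"
    proof (rule walkI)
      fix i
      assume "Suc i < length (half_edges_at t p @ [hd (half_edges_at t p)])"
      then show "(half_edges_at t p @ [hd (half_edges_at t p)]) ! Suc i =
          next_clockwise t ((half_edges_at t p @ [hd (half_edges_at t p)]) ! i)"
        using False
        by (cases "p = []"; cases i)
           (auto simp: half_edges_at_def nth_append nth_Cons' hd_append hd_map less_Suc_eq_le
             le_less_Suc_eq hd_upt)
    qed
  qed
qed (simp add: cyclic_list_def)

lemma finite_half_edges [simp]: "finite (half_edges t)"
proof -
  have "half_edges t = (\<Union>p \<in> tree_vertices t. set (half_edges_at t p))"
    by (auto simp: set_half_edges_at dest: origin_in_tree_vertices)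
  then show ?thesis by simp
qed

interpretation stems: parentheses "opening_stem t" "closing_stem t" for t
  by standard (rule opening_not_closing)

text \<open>The half-edge that follows the contour of the subtree at a vertex.\<close>

definition exit_half_edge :: "nat list \<Rightarrow> half_edge" where
  "exit_half_edge p = (if p = [] then ToBranch [] 0 else ToParent p)"

text \<open>Each piece of the contour is extended by the half-edge read next, so that consecutive
  pieces fit together as walks. The list \<open>bs0\<close> holds the branches already read and
  thereby fixes the index \<open>i\<close>. Heights count an opening stem as \<open>1\<close>,
  charges as \<open>- 1\<close>, hence the sign.\<close>

lemma contour_walk_aux:
  "subtree_at t p = Some s \<Longrightarrow>
     walk (tour t) (contour_from p s @ [exit_half_edge p]) \<and>
     hd (contour_from p s @ [exit_half_edge p]) =
       (if branches s = [] then exit_half_edge p else ToBranch p 0) \<and>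
     set (contour_from p s) \<subseteq> half_edges t \<and>
     stems.height t (contour_from p s) = - charge s"
  "subtree_at t p = Some (Vertex c (bs0 @ bs)) \<Longrightarrow> length bs0 = i \<Longrightarrow>
     walk (tour t) (contour_branches p i bs @ [exit_half_edge p]) \<and>
     hd (contour_branches p i bs @ [exit_half_edge p]) =
       (if bs = [] then exit_half_edge p else ToBranch p i) \<and>
     set (contour_branches p i bs) \<subseteq> half_edges t \<and>
     stems.height t (contour_branches p i bs) = - sum_list (map branch_charge bs)"
proof (induction p s and p i bs arbitrary: and c bs0 rule: contour_from_contour_branches.induct)
  case (1 p c bs)
  then show ?case using 1(1)[of c "[]"] by simp
next
  case (2 p i)
  then show ?case by simp
next
  case (3 p i bs)
  have p: "p \<in> tree_vertices t" "subtree t p = Vertex c (bs0 @ Opening # bs)"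
    using 3(2) by (auto simp: tree_vertices_def)
  have IH: "walk (tour t) (contour_branches p (Suc i) bs @ [exit_half_edge p])"
     "hd (contour_branches p (Suc i) bs @ [exit_half_edge p]) =
       (if bs = [] then exit_half_edge p else ToBranch p (Suc i))"
     "set (contour_branches p (Suc i) bs) \<subseteq> half_edges t"
     "stems.height t (contour_branches p (Suc i) bs) = - sum_list (map branch_charge bs)"
    using 3(1)[of c "bs0 @ [Opening]"] 3(2,3) by simp_all
  have "tour t (ToBranch p i) = hd (contour_branches p (Suc i) bs @ [exit_half_edge p])"
    using p 3(3) IH(2) by (simp add: tour_def stem_def nth_append exit_half_edge_def)
  then show ?case using IH p 3(3)
    by (simp add: successively_Cons nth_append)
next
  case (4 p i bs)
  have p: "p \<in> tree_vertices t" "subtree t p = Vertex c (bs0 @ Closing # bs)"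
    using 4(2) by (auto simp: tree_vertices_def)
  have IH: "walk (tour t) (contour_branches p (Suc i) bs @ [exit_half_edge p])"
     "hd (contour_branches p (Suc i) bs @ [exit_half_edge p]) =
       (if bs = [] then exit_half_edge p else ToBranch p (Suc i))"
     "set (contour_branches p (Suc i) bs) \<subseteq> half_edges t"
     "stems.height t (contour_branches p (Suc i) bs) = - sum_list (map branch_charge bs)"
    using 4(1)[of c "bs0 @ [Closing]"] 4(2,3) by simp_all
  have "tour t (ToBranch p i) = hd (contour_branches p (Suc i) bs @ [exit_half_edge p])"
    using p 4(3) IH(2) by (simp add: tour_def stem_def nth_append exit_half_edge_def)
  then show ?case using IH p 4(3)
    by (simp add: successively_Cons nth_append)
next
  case (5 p i s bs)
  let ?q = "p @ [i]" and ?rest = "contour_branches p (Suc i) bs @ [exit_half_edge p]"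
  have p: "p \<in> tree_vertices t" "subtree t p = Vertex c (bs0 @ Edge s # bs)"
    using 5(3) by (auto simp: tree_vertices_def)
  have q: "subtree_at t ?q = Some s" using 5(3,4) by (auto simp: subtree_at_snoc nth_append)
  then have q': "?q \<in> tree_vertices t" "subtree t ?q = s" by (auto simp: tree_vertices_def)
  have e: "exit_half_edge ?q = ToParent ?q" by (simp add: exit_half_edge_def)
  have IH: "walk (tour t) ?rest"
     "hd ?rest = (if bs = [] then exit_half_edge p else ToBranch p (Suc i))"
     "set (contour_branches p (Suc i) bs) \<subseteq> half_edges t"
     "stems.height t (contour_branches p (Suc i) bs) = - sum_list (map branch_charge bs)"
    using 5(2)[of c "bs0 @ [Edge s]"] 5(3,4) by simp_all
  have IH': "walk (tour t) (contour_from ?q s @ [ToParent ?q])"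
     "hd (contour_from ?q s @ [ToParent ?q]) = (if branches s = [] then ToParent ?q else ToBranch ?q 0)"
     "set (contour_from ?q s) \<subseteq> half_edges t" "stems.height t (contour_from ?q s) = - charge s"
    using 5(1)[OF q] e by simp_all
  have "tour t (ToBranch p i) = hd (contour_from ?q s @ [ToParent ?q])"
    using p 5(4) q' IH'(2) by (simp add: tour_def stem_def nth_append)
  moreover have "tour t (ToParent ?q) = hd ?rest"
    using p 5(4) IH(2) by (simp add: tour_def nth_append exit_half_edge_def)
  ultimately have "walk (tour t) (ToBranch p i # (contour_from ?q s @ [ToParent ?q]) @ ?rest)"
    using walk_Cons[OF walk_append[OF IH'(1) IH(1)], of "ToBranch p i"] by (simp add: hd_append)
  then show ?case using IH(3,4) IH'(3,4) p q' 5(4) by (simp add: nth_append)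
qed

text \<open>Disjointness of the pieces is read off the addresses: all half-edges of the piece of a
  branch carry the index of this branch after the prefix \<open>p\<close>.\<close>

lemma contour_distinct_aux:
  "distinct (contour_from p s) \<and>
   (\<forall>h \<in> set (contour_from p s). \<exists>q i. h = ToBranch (p @ q) i \<or> q \<noteq> [] \<and> h = ToParent (p @ q))"
  "distinct (contour_branches p i bs) \<and>
   (\<forall>h \<in> set (contour_branches p i bs). \<exists>j \<ge> i. h = ToBranch p j \<or>
      (\<exists>q k. h = ToBranch (p @ j # q) k \<or> h = ToParent (p @ j # q)))"
proof (induction p s and p i bs rule: contour_from_contour_branches.induct)
  case (1 p c bs)
  then show ?case by fastforce
next
  case (3 p i bs)
  then show ?case by (force dest: Suc_leD)
next
  case (4 p i bs)
  then show ?case by (force dest: Suc_leD)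
next
  case (5 p i s bs)
  have A: "\<exists>q k. h = ToBranch (p @ i # q) k \<or> q \<noteq> [] \<and> h = ToParent (p @ i # q)"
    if "h \<in> set (contour_from (p @ [i]) s)" for h
    using 5(1) that by fastforce
  have B: "\<exists>j > i. h = ToBranch p j \<or> (\<exists>q k. h = ToBranch (p @ j # q) k \<or> h = ToParent (p @ j # q))"
    if "h \<in> set (contour_branches p (Suc i) bs)" for h
    using 5(2) that by (meson Suc_le_eq)
  have "ToBranch p i \<notin> set (contour_from (p @ [i]) s)" "ToParent (p @ [i]) \<notin> set (contour_from (p @ [i]) s)"
    using A by fastforce+
  moreover have "ToBranch p i \<notin> set (contour_branches p (Suc i) bs)"
    "ToParent (p @ [i]) \<notin> set (contour_branches p (Suc i) bs)"
    using B by fastforce+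
  moreover have "set (contour_from (p @ [i]) s) \<inter> set (contour_branches p (Suc i) bs) = {}"
    using A B by fastforce
  ultimately have "distinct (contour_branches p i (Edge s # bs))" using 5 by auto
  moreover have "\<exists>j \<ge> i. h = ToBranch p j \<or> (\<exists>q k. h = ToBranch (p @ j # q) k \<or> h = ToParent (p @ j # q))"
    if "h \<in> set (contour_branches p i (Edge s # bs))" for h
  proof -
    consider "h = ToBranch p i" | "h \<in> set (contour_from (p @ [i]) s)" | "h = ToParent (p @ [i])"
      | "h \<in> set (contour_branches p (Suc i) bs)"
      using \<open>h \<in> set (contour_branches p i (Edge s # bs))\<close> by auto
    then show ?thesis using A[of h] B[of h] by cases (blast intro: less_imp_le)+
  qed
  ultimately show ?case by blast
qed simp

lemma contour_branches_complete:
  "j < length bs \<Longrightarrow> ToBranch p (i + j) \<in> set (contour_branches p i bs) \<and>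
    (\<forall>s. bs ! j = Edge s \<longrightarrow>
      insert (ToParent (p @ [i + j])) (set (contour_from (p @ [i + j]) s)) \<subseteq> set (contour_branches p i bs))"
proof (induction bs arbitrary: i j)
  case (Cons b bs)
  show ?case
  proof (cases j)
    case 0
    then show ?thesis by (cases b) auto
  next
    case (Suc k)
    then show ?thesis using Cons.IH[of k "Suc i"] Cons.prems by (cases b) auto
  qed
qed simp

lemma contour_from_complete:
  "subtree_at s q = Some s' \<Longrightarrow> set (contour_from (p @ q) s') \<subseteq> set (contour_from p s) \<and>
     (q \<noteq> [] \<longrightarrow> ToParent (p @ q) \<in> set (contour_from p s))"
proof (induction s q arbitrary: p rule: subtree_at.induct)
  case (2 c bs i q)
  then obtain r where r: "i < length bs" "bs ! i = Edge r" "subtree_at r q = Some s'"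
    by (auto split: if_splits branch.splits)
  have "insert (ToParent (p @ [i])) (set (contour_from (p @ [i]) r)) \<subseteq> set (contour_from p (Vertex c bs))"
    using contour_branches_complete[of i bs p 0] r by simp
  moreover have "set (contour_from ((p @ [i]) @ q) s') \<subseteq> set (contour_from (p @ [i]) r) \<and>
     (q \<noteq> [] \<longrightarrow> ToParent ((p @ [i]) @ q) \<in> set (contour_from (p @ [i]) r))"
    using 2(1)[OF r(1,2,3)] .
  ultimately show ?case by (cases q) auto
qed simp

lemma distinct_contour: "distinct (contour t)"
  by (simp add: contour_def contour_distinct_aux)

lemma set_contour: "set (contour t) = half_edges t"
proof
  show "set (contour t) \<subseteq> half_edges t"
    using contour_walk_aux(1)[of t "[]" t] by (simp add: contour_def)
  show "half_edges t \<subseteq> set (contour t)"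
  proof
    fix h assume h: "h \<in> half_edges t"
    show "h \<in> set (contour t)"
    proof (cases h)
      case (ToParent p)
      then show ?thesis using h contour_from_complete[of t p "subtree t p" "[]"] subtree_at_Some[of p t]
        by (auto simp: contour_def)
    next
      case (ToBranch p i)
      then have p: "p \<in> tree_vertices t" "i < length (branches (subtree t p))" using h by auto
      obtain c bs where bs: "subtree t p = Vertex c bs" by (cases "subtree t p")
      have "ToBranch p i \<in> set (contour_from p (subtree t p))"
        using contour_branches_complete[of i bs p 0] bs p by simp
      then show ?thesis using ToBranch contour_from_complete[of t p "subtree t p" "[]"] subtree_at_Some[OF p(1)]
        by (auto simp: contour_def)
    qed
  qed
qed

text \<open>A plane tree has one face: appended to its own start, the contour is still a walk, since
  the contour of the root is followed by its first branch.\<close>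

lemma cyclic_contour: "cyclic_list (tour t) (contour t)"
proof (cases "branches t = []")
  case True
  then show ?thesis by (cases t) (simp add: contour_def cyclic_list_def)
next
  case False
  have "walk (tour t) (contour t @ [ToBranch [] 0])" "hd (contour t @ [ToBranch [] 0]) = ToBranch [] 0"
    using contour_walk_aux(1)[of t "[]" t] False by (simp_all add: contour_def exit_half_edge_def)
  moreover have "contour t \<noteq> []"
    using set_contour[of t] False by (metis Nil_in_tree_vertices empty_iff empty_set half_edges_simps(1)
        length_greater_0_conv option.sel subtree_at.simps(1))
  ultimately show ?thesis using distinct_contour by (intro cyclic_listI) auto
qed

lemma height_contour: "stems.height t (contour t) = - charge t"
  using contour_walk_aux(1)[of t "[]" t] by (simp add: contour_def)

section \<open>Flows and potentials on a combinatorial map\<close>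

text \<open>Faces are orbits of \<open>phi\<close>, so a dual walk is a walk on half-edges that
  moves freely inside a face and changes the face by crossing a half-edge of
  \<open>C\<close>.\<close>

inductive dual_reach :: "('h \<Rightarrow> 'h) \<Rightarrow> ('h \<Rightarrow> 'h) \<Rightarrow> 'h set \<Rightarrow> 'h set \<Rightarrow> 'h \<Rightarrow> bool"
  for phi mt C F where
  dual_reach_base: "h \<in> F \<Longrightarrow> dual_reach phi mt C F h"
| dual_reach_face: "dual_reach phi mt C F h \<Longrightarrow> dual_reach phi mt C F (phi h)"
| dual_reach_cross: "dual_reach phi mt C F h \<Longrightarrow> h \<in> C \<Longrightarrow> dual_reach phi mt C F (mt h)"

text \<open>Length is collected at crossings only. Backward steps inside a face are included so that
  the attainable lengths, and hence their minimum, are visibly the same on a whole face.\<close>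

inductive dual_path :: "('h \<Rightarrow> 'h) \<Rightarrow> ('h \<Rightarrow> 'h) \<Rightarrow> 'h set \<Rightarrow> 'h set \<Rightarrow> ('h \<Rightarrow> nat) \<Rightarrow> 'h set \<Rightarrow> 'h \<Rightarrow> nat \<Rightarrow> bool"
  for phi mt H C l F where
  dual_path_base: "h \<in> F \<Longrightarrow> dual_path phi mt H C l F h 0"
| dual_path_fwd: "dual_path phi mt H C l F h k \<Longrightarrow> dual_path phi mt H C l F (phi h) k"
| dual_path_bwd: "dual_path phi mt H C l F (phi h) k \<Longrightarrow> h \<in> H \<Longrightarrow> dual_path phi mt H C l F h k"
| dual_path_cross: "dual_path phi mt H C l F h k \<Longrightarrow> h \<in> C \<Longrightarrow> dual_path phi mt H C l F (mt h) (k + l h)"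

text \<open>A connected bipartite map of any genus on a carrier \<open>H\<close> of half-edges.
  Colours are signs, black being \<open>1\<close>, so that they can serve as coefficients of flows,
  and connectedness is stated as an induction principle over sets of vertices.\<close>

locale cmap =
  fixes V :: "'v set" and H :: "'h set" and tl :: "'h \<Rightarrow> 'v" and rt mt :: "'h \<Rightarrow> 'h" and sg :: "'v \<Rightarrow> int"
  assumes finite_V: "finite V" and finite_H: "finite H" and V_nonempty: "V \<noteq> {}"
    and tl_in: "h \<in> H \<Longrightarrow> tl h \<in> V"
    and mt_in: "h \<in> H \<Longrightarrow> mt h \<in> H" and mt_mt: "h \<in> H \<Longrightarrow> mt (mt h) = h"
    and rt_bij: "bij_betw rt H H" and tl_rt: "h \<in> H \<Longrightarrow> tl (rt h) = tl h"
    and sg_cases: "v \<in> V \<Longrightarrow> sg v = 1 \<or> sg v = - 1"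
    and sg_mt: "h \<in> H \<Longrightarrow> sg (tl (mt h)) = - sg (tl h)"
    and rt_trans: "h \<in> H \<Longrightarrow> h' \<in> H \<Longrightarrow> tl h = tl h' \<Longrightarrow> \<exists>n. h' = (rt ^^ n) h"
    and conn: "S \<subseteq> V \<Longrightarrow> S \<noteq> {} \<Longrightarrow> (\<And>h. h \<in> H \<Longrightarrow> tl h \<in> S \<Longrightarrow> tl (mt h) \<in> S) \<Longrightarrow> S = V"
begin

definition phi :: "'h \<Rightarrow> 'h" where "phi h = rt (mt h)"

abbreviation black :: "'h \<Rightarrow> bool" where "black h \<equiv> sg (tl h) = 1"

lemma rt_in: "h \<in> H \<Longrightarrow> rt h \<in> H"
  using rt_bij by (auto simp: bij_betw_def)

lemma sg_h: "h \<in> H \<Longrightarrow> sg (tl h) = 1 \<or> sg (tl h) = - 1"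
  using sg_cases tl_in by blast

lemma mt_neq: "h \<in> H \<Longrightarrow> mt h \<noteq> h"
  using sg_mt[of h] sg_h[of h] by auto

lemma mt_bij: "bij_betw mt H H"
  by (rule bij_betwI[where g = mt]) (auto simp: mt_in mt_mt)

lemma phi_in: "h \<in> H \<Longrightarrow> phi h \<in> H"
  by (simp add: phi_def rt_in mt_in)

lemma phi_bij: "bij_betw phi H H"
  using bij_betw_trans[OF mt_bij rt_bij] by (simp add: phi_def[abs_def] comp_def)

lemma phi_mt: "h \<in> H \<Longrightarrow> phi (mt h) = rt h"
  by (simp add: phi_def mt_mt)

lemma sg_phi: "h \<in> H \<Longrightarrow> sg (tl (phi h)) = - sg (tl h)"
  by (simp add: phi_def tl_rt mt_in sg_mt)

lemma tl_image: "H \<noteq> {} \<Longrightarrow> tl ` H = V"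
  by (rule conn) (use tl_in mt_in in auto)

lemma V_singleton: "H = {} \<Longrightarrow> v \<in> V \<Longrightarrow> V = {v}"
  using conn[of "{v}"] by auto

text \<open>Powers of \<open>rt\<close> fill up every vertex that \<open>R\<close> touches, and
  \<open>mt\<close> carries \<open>R\<close> to the neighbouring vertices, so connectedness applies
  to the vertices touched.\<close>

lemma closed_set_eq_H:
  assumes "R \<subseteq> H" "R \<noteq> {}" "\<And>h. h \<in> R \<Longrightarrow> rt h \<in> R" "\<And>h. h \<in> R \<Longrightarrow> mt h \<in> R"
  shows "R = H"
proof -
  have full: "h \<in> R" if "h \<in> H" "tl h \<in> tl ` R" for h
  proof -
    obtain h' where h': "h' \<in> R" "tl h' = tl h" using \<open>tl h \<in> tl ` R\<close> by auto
    then obtain n where "h = (rt ^^ n) h'" using rt_trans[of h' h] assms(1) \<open>h \<in> H\<close> by auto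
    moreover have "(rt ^^ n) h' \<in> R" for n by (induction n) (auto simp: h' assms(3))
    ultimately show ?thesis by simp
  qed
  have "tl ` R = V"
    by (rule conn) (use assms full tl_in in auto)
  then show ?thesis using full tl_in assms(1) by blast
qed

definition divergence :: "('h \<Rightarrow> int) \<Rightarrow> 'v \<Rightarrow> int" where
  "divergence z v = (\<Sum>h | h \<in> H \<and> tl h = v. z h)"

definition antisymmetric :: "('h \<Rightarrow> int) \<Rightarrow> bool" where
  "antisymmetric z \<longleftrightarrow> (\<forall>h \<in> H. z (mt h) = - z h)"

text \<open>One unit is sent from each vertex to the sink \<open>r\<close>, and these flows are
  added up. The vertices from which a unit can be sent include \<open>r\<close> and are closed under
  adjacency.\<close>

lemma unit_supply_flow_exists:
  assumes "r \<in> V"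
  shows "\<exists>y. antisymmetric y \<and> (\<forall>v \<in> V - {r}. divergence y v = 1)"
proof -
  define P where "P v z \<longleftrightarrow> antisymmetric z \<and>
    (\<forall>w \<in> V - {r}. divergence z w = (if w = v then 1 else 0))" for v z
  have "{v \<in> V. \<exists>z. P v z} = V"
  proof (rule conn)
    have "P r (\<lambda>_. 0)" by (auto simp: P_def antisymmetric_def divergence_def)
    then show "{v \<in> V. \<exists>z. P v z} \<noteq> {}" using assms by blast
    fix h assume h: "h \<in> H" "tl h \<in> {v \<in> V. \<exists>z. P v z}"
    then obtain z where z: "P (tl h) z" by blast
    \<comment> \<open>One unit along a single edge, from \<open>tl (mt h)\<close> to
      \<open>tl h\<close>, where the flow \<open>z\<close> takes over.\<close>
    define e where "e k = (if k = mt h then 1 else if k = h then - 1 else (0::int))" for k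
    have e: "divergence e w = (if w = tl (mt h) then 1 else 0) - (if w = tl h then 1 else 0)" for w
    proof -
      have "e k = (if k = mt h then 1 else 0) - (if k = h then 1 else 0)" for k
        using mt_neq[OF h(1)] by (simp add: e_def)
      then show ?thesis using h(1) finite_H mt_in[OF h(1)]
        by (simp add: divergence_def sum_subtractf sum.delta')
    qed
    have "mt k = mt h \<longleftrightarrow> k = h" "mt k = h \<longleftrightarrow> k = mt h" if "k \<in> H" for k
      using that h(1) mt_mt by metis+
    then have "antisymmetric e"
      using h(1) mt_neq[OF h(1)] by (auto simp: antisymmetric_def e_def)
    then have "P (tl (mt h)) (\<lambda>k. z k + e k)"
      using z e by (auto simp: P_def antisymmetric_def divergence_def sum.distrib)
    then show "tl (mt h) \<in> {v \<in> V. \<exists>z. P v z}" using tl_in mt_in h(1) by blast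
  qed auto
  then have "\<forall>v \<in> V. \<exists>z. P v z" by blast
  then obtain z where z: "\<And>v. v \<in> V \<Longrightarrow> P v (z v)" by metis
  have "antisymmetric (\<lambda>h. \<Sum>v \<in> V. z v h)"
    using z by (simp add: P_def antisymmetric_def sum_negf)
  moreover have "divergence (\<lambda>h. \<Sum>v \<in> V. z v h) w = 1" if "w \<in> V - {r}" for w
  proof -
    have "divergence (\<lambda>h. \<Sum>v \<in> V. z v h) w = (\<Sum>v \<in> V. divergence (z v) w)"
      unfolding divergence_def by (rule sum.swap)
    also have "\<dots> = (\<Sum>v \<in> V. if w = v then 1 else 0)"
      using z that by (intro sum.cong) (auto simp: P_def)
    finally show ?thesis using that finite_V by simp
  qed
  ultimately show ?thesis by blast
qed

text \<open>
  Going around a vertex, the potential on the right-hand side of a half-edge is the potential on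
  the left-hand side of the next one.
\<close>

lemma divergence_potential:
  assumes D: "\<And>h. h \<in> H \<Longrightarrow> D (phi h) = D h"
  shows "divergence (\<lambda>h. z h + D h - D (mt h)) v = divergence z v"
proof -
  let ?A = "{h \<in> H. tl h = v}"
  have "bij_betw rt ?A ?A"
  proof -
    have "inj_on rt ?A" using rt_bij by (auto simp: bij_betw_def inj_on_def)
    moreover have "rt ` ?A \<subseteq> ?A" using rt_in tl_rt by auto
    ultimately show ?thesis using finite_H by (simp add: bij_betw_def endo_inj_surj)
  qed
  then have "(\<Sum>h \<in> ?A. D (rt h)) = (\<Sum>h \<in> ?A. D h)" by (rule sum.reindex_bij_betw)
  moreover have "D (rt h) = D (mt h)" if "h \<in> ?A" for h
    using D[OF mt_in, of h] that by (simp add: phi_mt)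
  ultimately have "(\<Sum>h \<in> ?A. D (mt h)) = (\<Sum>h \<in> ?A. D h)" by simp
  then show ?thesis by (simp add: divergence_def sum.distrib sum_subtractf)
qed

text \<open>
  The dual edge of a black half-edge \<open>h\<close> leads from the face of \<open>h\<close> to the face of \<open>mt h\<close> and has
  length \<open>ls h\<close>. The set \<open>X\<close> of half-edges is optimal if the edges outside \<open>X\<close> are those that lie on
  shortest dual paths from the outer face \<open>F\<close>, and if they suffice to reach all faces.
\<close>

definition optimal :: "'h set \<Rightarrow> ('h \<Rightarrow> int) \<Rightarrow> 'h set \<Rightarrow> bool" where
  "optimal F ls X \<longleftrightarrow> X \<subseteq> H \<and> (\<forall>h \<in> X. mt h \<in> X) \<and>
     (\<forall>h \<in> H. dual_reach phi mt {h \<in> H. h \<notin> X \<and> black h} F h) \<and>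
     (\<exists>D. (\<forall>h \<in> H. D (phi h) = D h) \<and> (\<forall>h \<in> F. D h = 0) \<and>
       (\<forall>h \<in> H. black h \<longrightarrow> 0 \<le> ls h + D h - D (mt h) \<and>
         (h \<in> X \<longleftrightarrow> 0 < ls h + D h - D (mt h))))"

text \<open>Along a dual walk that crosses edges outside one optimal set, the potential of this set
  grows by at least the length of every crossing, and any other feasible potential by at most that
  length. Used both ways this identifies the potentials, which decide membership of black
  half-edges; white ones follow by \<open>mt\<close>.\<close>

lemma optimal_unique:
  assumes F: "F \<subseteq> H" and X: "optimal F ls X" and X': "optimal F ls X'"
  shows "X = X'"
proof -
  obtain D where D: "\<And>h. h \<in> H \<Longrightarrow> D (phi h) = D h" "\<And>h. h \<in> F \<Longrightarrow> D h = 0"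
    "\<And>h. h \<in> H \<Longrightarrow> black h \<Longrightarrow> 0 \<le> ls h + D h - D (mt h)"
    "\<And>h. h \<in> H \<Longrightarrow> black h \<Longrightarrow> h \<in> X \<longleftrightarrow> 0 < ls h + D h - D (mt h)"
    using X unfolding optimal_def by blast
  obtain D' where D': "\<And>h. h \<in> H \<Longrightarrow> D' (phi h) = D' h" "\<And>h. h \<in> F \<Longrightarrow> D' h = 0"
    "\<And>h. h \<in> H \<Longrightarrow> black h \<Longrightarrow> 0 \<le> ls h + D' h - D' (mt h)"
    "\<And>h. h \<in> H \<Longrightarrow> black h \<Longrightarrow> h \<in> X' \<longleftrightarrow> 0 < ls h + D' h - D' (mt h)"
    using X' unfolding optimal_def by blast
  have le: "h \<in> H \<and> D1 h \<le> D2 h"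
    if "dual_reach phi mt {h \<in> H. h \<notin> X2 \<and> black h} F h"
      "\<And>h. h \<in> H \<Longrightarrow> D1 (phi h) = D1 h" "\<And>h. h \<in> F \<Longrightarrow> D1 h = 0"
      "\<And>h. h \<in> H \<Longrightarrow> black h \<Longrightarrow> 0 \<le> ls h + D1 h - D1 (mt h)"
      "\<And>h. h \<in> H \<Longrightarrow> D2 (phi h) = D2 h" "\<And>h. h \<in> F \<Longrightarrow> D2 h = 0"
      "\<And>h. h \<in> H \<Longrightarrow> black h \<Longrightarrow> h \<in> X2 \<longleftrightarrow> 0 < ls h + D2 h - D2 (mt h)"
    for h X2 and D1 D2 :: "'h \<Rightarrow> int"
    using that(1)
  proof (induction rule: dual_reach.induct)
    case (dual_reach_base h)
    then show ?case using F that by auto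
  next
    case (dual_reach_face h)
    then show ?case using that(2,5) phi_in by simp
  next
    case (dual_reach_cross h)
    then have "\<not> 0 < ls h + D2 h - D2 (mt h)" "0 \<le> ls h + D1 h - D1 (mt h)"
      using that(4,7) by blast+
    then show ?case using dual_reach_cross mt_in by auto
  qed
  have "D h = D' h" if "h \<in> H" for h
  proof (rule antisym)
    show "D h \<le> D' h"
      using le[of X' h D D'] D D' X' \<open>h \<in> H\<close> unfolding optimal_def by blast
    show "D' h \<le> D h"
      using le[of X h D' D] D D' X \<open>h \<in> H\<close> unfolding optimal_def by blast
  qed
  then have black_eq: "h \<in> X \<longleftrightarrow> h \<in> X'" if "h \<in> H" "black h" for h
    using D(4) D'(4) that mt_in by simp
  have "h \<in> X \<longleftrightarrow> h \<in> X'" if h: "h \<in> H" for h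
  proof (cases "black h")
    case False
    then have "black (mt h)" using sg_mt[OF h] sg_h[OF h] by auto
    then have "mt h \<in> X \<longleftrightarrow> mt h \<in> X'" using black_eq mt_in h by blast
    moreover have "h \<in> Y \<longleftrightarrow> mt h \<in> Y" if "\<forall>k \<in> Y. mt k \<in> Y" for Y
      using that mt_mt[OF h] by metis
    ultimately show ?thesis using X X' unfolding optimal_def by metis
  qed (use black_eq h in blast)
  moreover have "X \<subseteq> H" "X' \<subseteq> H" using X X' by (simp_all add: optimal_def)
  ultimately show ?thesis by blast
qed

text \<open>The witness is the length of a shortest dual path, and the tight half-edge belongs to
  the last crossing of such a path.\<close>

lemma shortest_distance_exists:
  assumes F: "F \<subseteq> H" "F \<noteq> {}" "\<And>h. h \<in> H \<Longrightarrow> phi h \<in> F \<longleftrightarrow> h \<in> F"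
    and ls: "\<And>h. h \<in> H \<Longrightarrow> black h \<Longrightarrow> 0 < ls h"
  shows "\<exists>D :: 'h \<Rightarrow> int. (\<forall>h \<in> H. D (phi h) = D h) \<and> (\<forall>h \<in> F. D h = 0) \<and>
    (\<forall>h \<in> H. black h \<longrightarrow> 0 \<le> ls h + D h - D (mt h)) \<and>
    (\<forall>h \<in> H - F. \<exists>h' \<in> orbit phi h. \<not> black h' \<and> ls (mt h') + D (mt h') - D h' = 0)"
proof -
  define C where "C = {h \<in> H. black h}"
  let ?P = "dual_path phi mt H C (\<lambda>h. nat (ls h)) F"
  have P_in: "?P h k \<Longrightarrow> h \<in> H" for h k
    by (induction rule: dual_path.induct) (use F(1) phi_in mt_in in \<open>auto simp: C_def\<close>)
  define R where "R = {h. \<exists>k. ?P h k}"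
  have R_phi: "phi h \<in> R \<longleftrightarrow> h \<in> R" if "h \<in> H" for h
  proof
    assume "phi h \<in> R"
    then obtain k where "?P (phi h) k" by (auto simp: R_def)
    then have "?P h k" using that by (rule dual_path_bwd)
    then show "h \<in> R" by (auto simp: R_def)
  next
    assume "h \<in> R"
    then obtain k where "?P h k" by (auto simp: R_def)
    then have "?P (phi h) k" by (rule dual_path_fwd)
    then show "phi h \<in> R" by (auto simp: R_def)
  qed
  have R_sub: "R \<subseteq> H" unfolding R_def using P_in by blast
  have R_mt_black: "mt h \<in> R" if "h \<in> R" "black h" for h
  proof -
    obtain k where "?P h k" using \<open>h \<in> R\<close> by (auto simp: R_def)
    moreover have "h \<in> C" using that R_sub by (auto simp: C_def)
    ultimately have "?P (mt h) (k + nat (ls h))" by (rule dual_path_cross)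
    then show ?thesis by (auto simp: R_def)
  qed
  \<comment> \<open>The set of reached half-edges must also be closed under crossing against the
    direction of the dual edges. \<open>phi\<close> maps the white half-edges of \<open>R\<close>
    injectively to black ones, and \<open>mt\<close> maps the black ones injectively to white ones.
    By finiteness the latter map is onto: every white half-edge of \<open>R\<close> is the mate of a
    black one in \<open>R\<close>.\<close>
  have R_mt: "mt h \<in> R" if hR: "h \<in> R" for h
  proof (cases "black h")
    case False
    let ?B = "{h \<in> R. black h}" and ?W = "{h \<in> R. \<not> black h}"
    have fin: "finite R" using R_sub finite_H finite_subset by blast
    have "phi ` ?W \<subseteq> ?B"
      using R_phi R_sub sg_phi sg_h by fastforce
    moreover have "inj_on phi ?W" using phi_bij R_sub by (auto simp: bij_betw_def inj_on_def)
    ultimately have "card ?W \<le> card ?B" using fin by (intro card_inj_on_le[of phi]) auto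
    moreover have "mt ` ?B \<subseteq> ?W" using R_mt_black R_sub sg_mt by fastforce
    moreover have "inj_on mt ?B" using mt_bij R_sub by (auto simp: bij_betw_def inj_on_def)
    ultimately have "mt ` ?B = ?W"
      using fin by (intro card_seteq) (simp_all add: card_image)
    then obtain k where "k \<in> R" "h = mt k" using hR False by auto
    then show ?thesis using mt_mt R_sub by auto
  qed (use that R_mt_black in blast)
  have "R = H"
  proof (rule closed_set_eq_H[OF R_sub])
    obtain h where "h \<in> F" using F(2) by blast
    then have "?P h 0" by (rule dual_path_base)
    then show "R \<noteq> {}" by (auto simp: R_def)
  next
    fix h assume h: "h \<in> R"
    then have "phi (mt h) \<in> R" using R_mt R_phi R_sub mt_in by blast
    then show "rt h \<in> R" using phi_mt h R_sub by auto
  qed (rule R_mt)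
  then have ex: "\<exists>k. ?P h k" if "h \<in> H" for h using that by (auto simp: R_def)
  define d where "d h = (LEAST k. ?P h k)" for h
  have d_path: "?P h (d h)" if "h \<in> H" for h unfolding d_def using ex[OF that] by (rule LeastI_ex)
  have d_le: "?P h k \<Longrightarrow> d h \<le> k" for h k unfolding d_def by (rule Least_le)
  have phi: "d (phi h) = d h" if h: "h \<in> H" for h
    using d_le[OF dual_path_fwd[OF d_path[OF h]]] d_le[OF dual_path_bwd[OF d_path[OF phi_in[OF h]] h]]
    by (rule antisym)
  have cross: "d (mt h) \<le> d h + nat (ls h)" if h: "h \<in> H" "black h" for h
    using d_le[OF dual_path_cross[OF d_path[OF h(1)]]] h by (simp add: C_def)
  \<comment> \<open>Unless the path stays in \<open>F\<close>, its last crossing arrives at some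
    \<open>h'\<close>, and all moves after it remain in the face of \<open>h'\<close>.\<close>
  have tight: "h \<in> F \<or> (\<exists>h' \<in> orbit phi h. \<not> black h' \<and> (\<exists>k'. ?P (mt h') k' \<and> k = k' + nat (ls (mt h'))))"
    if "?P h k" for h k
    using that
  proof (induction rule: dual_path.induct)
    case (dual_path_fwd h k)
    then have "h \<in> H" using P_in by blast
    then show ?case using dual_path_fwd.IH F(3) bij_orbit_step[OF phi_bij finite_H] by simp
  next
    case (dual_path_bwd h k)
    then show ?case using F(3) bij_orbit_step[OF phi_bij finite_H] by simp
  next
    case (dual_path_cross h k)
    then have h: "h \<in> H" "mt h \<in> H" "black h" using mt_in by (auto simp: C_def)
    have "mt h \<in> orbit phi (mt h)" "\<not> black (mt h)" "mt (mt h) = h"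
      using bij_self_in_orbit[OF phi_bij finite_H h(2)] h sg_mt mt_mt by auto
    then show ?case using dual_path_cross.hyps(1) by metis
  qed simp
  show ?thesis
  proof (intro exI[of _ "\<lambda>h. int (d h)"] conjI ballI impI)
    fix h assume "h \<in> H"
    then show "int (d (phi h)) = int (d h)" by (simp add: phi)
  next
    fix h assume "h \<in> F"
    then have "d h \<le> 0" by (intro d_le dual_path_base)
    then show "int (d h) = 0" by simp
  next
    fix h assume "h \<in> H" "black h"
    then show "0 \<le> ls h + int (d h) - int (d (mt h))" using cross[of h] ls[of h] by linarith
  next
    fix h assume h: "h \<in> H - F"
    then obtain h' k' where h': "h' \<in> orbit phi h" "\<not> black h'" "?P (mt h') k'" "d h = k' + nat (ls (mt h'))"
      using tight[OF d_path[of h]] by blast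
    then have inH: "h' \<in> H" using bij_orbit_subset[OF phi_bij finite_H] h by blast
    have b: "black (mt h')" using sg_mt[OF inH] sg_h[OF inH] h'(2) by auto
    have "d h' = d h" using orbit_invariant[OF h'(1), of H d] h phi phi_in by auto
    moreover have "d h' \<le> d (mt h') + nat (ls (mt h'))"
      using cross[OF mt_in[OF inH] b] mt_mt[OF inH] by simp
    moreover have "d (mt h') \<le> k'" using d_le h'(3) .
    ultimately have "ls (mt h') + int (d (mt h')) - int (d h') = 0"
      using h'(4) ls[OF mt_in[OF inH] b] by linarith
    then show "\<exists>h' \<in> orbit phi h. \<not> black h' \<and> ls (mt h') + int (d (mt h')) - int (d h') = 0"
      using h'(1,2) by blast
  qed
qed

end

section \<open>The closure of a tree of charge zero\<close>

text \<open>Each vertex except the root accounts for the two halves of its parent edge.\<close>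

lemma card_neutral_half_edges:
  "card {h \<in> half_edges t. \<not> stem t h} = 2 * (card (tree_vertices t) - 1)"
proof -
  let ?P = "ToParent ` (tree_vertices t - {[]})"
  have "{h \<in> half_edges t. \<not> stem t h} = ?P \<union> tree_mate ` ?P"
  proof
    show "{h \<in> half_edges t. \<not> stem t h} \<subseteq> ?P \<union> tree_mate ` ?P"
    proof
      fix h assume h: "h \<in> {h \<in> half_edges t. \<not> stem t h}"
      show "h \<in> ?P \<union> tree_mate ` ?P"
      proof (cases h)
        case (ToBranch p i)
        then have "ToParent (p @ [i]) \<in> ?P" "h = tree_mate (ToParent (p @ [i]))" using h by auto
        then show ?thesis by blast
      qed (use h in auto)
    qed
    show "?P \<union> tree_mate ` ?P \<subseteq> {h \<in> half_edges t. \<not> stem t h}"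
      using tree_mate_simps(1,2)[of "ToParent _" t] by auto
  qed
  moreover have "?P \<inter> tree_mate ` ?P = {}" by auto
  moreover have "inj_on tree_mate ?P"
    by (rule inj_onI) (auto, metis append_butlast_last_id)
  moreover have "card ?P = card (tree_vertices t) - 1"
    by (simp add: card_image inj_on_def)
  ultimately show ?thesis by (simp add: card_Un_disjoint card_image)
qed

lemma tour_in_half_edges: "h \<in> half_edges t \<Longrightarrow> tour t h \<in> half_edges t"
  using cyclic_list_bij[OF cyclic_contour[of t]] by (auto simp: set_contour bij_betw_def)

lemma tour_inj: "h \<in> half_edges t \<Longrightarrow> h' \<in> half_edges t \<Longrightarrow> tour t h = tour t h' \<Longrightarrow> h = h'"
  using cyclic_list_bij[OF cyclic_contour[of t]] by (auto simp: set_contour bij_betw_def inj_on_def)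

section \<open>Uniqueness of the matching\<close>

lemma closure_edgeD:
  assumes "closure_edge t a u b"
  shows "opening_stem t a" "closing_stem t b" "balanced t u" "walk (tour t) (a # u @ [b])"
    "distinct (a # u @ [b])" "set (a # u @ [b]) \<subseteq> half_edges t"
proof -
  obtain k v where k: "rotate k (contour t) = a # u @ b # v"
    using assms by (auto simp: closure_edge_def)
  show "opening_stem t a" "closing_stem t b" "balanced t u" using assms by (auto simp: closure_edge_def)
  have "walk (tour t) (rotate k (contour t))"
    using cyclic_list_walk cyclic_list_rotate cyclic_contour by blast
  then have "walk (tour t) ((a # u @ [b]) @ v)" by (simp add: k)
  then show "walk (tour t) (a # u @ [b])" by (simp only: successively_append_iff)
  have "distinct (rotate k (contour t))" by (simp add: distinct_contour)
  then show "distinct (a # u @ [b])" unfolding k by auto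
  have "set (rotate k (contour t)) = half_edges t" by (simp add: set_contour)
  then show "set (a # u @ [b]) \<subseteq> half_edges t" unfolding k by auto
qed

text \<open>Matched stems are recognised by a walk along \<open>tour\<close>. In this form the
  matching can be carried over from a map to the tree opened from it.\<close>

lemma closure_edgeI:
  assumes "opening_stem t a" "closing_stem t b" "balanced t u"
    "walk (tour t) (a # u @ [b])" "distinct (a # u @ [b])"
  shows "closure_edge t a u b"
proof -
  obtain k v where "rotate k (contour t) = (a # u @ [b]) @ v"
    using cyclic_list_walk_segment[OF cyclic_contour[of t] assms(4) _ _ assms(5)]
      opening_stem_half_edge[OF assms(1)] by (auto simp: set_contour)
  then show ?thesis using assms by (auto simp: closure_edge_def)
qed

lemma rotate_contour_unique:
  assumes "hd (rotate k (contour t)) = hd (rotate k' (contour t))"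
  shows "rotate k (contour t) = rotate k' (contour t)"
  using assms by (intro walk_unique[of "tour t"]) (simp_all add: cyclic_list_walk cyclic_list_rotate cyclic_contour)

text \<open>Rotations of the contour with the same head coincide, so both matchings read the same
  word after \<open>a\<close>.\<close>

lemma closure_edge_unique_closing:
  assumes "closure_edge t a u b" "closure_edge t a u' b'"
  shows "u = u' \<and> b = b'"
proof -
  obtain k v k' v' where k: "rotate k (contour t) = a # u @ b # v" "rotate k' (contour t) = a # u' @ b' # v'"
    using assms by (auto simp: closure_edge_def)
  then have "u @ b # v = u' @ b' # v'" using rotate_contour_unique[of k t k'] by simp
  moreover from this have "u = u'"
    using stems.closing_unique[of t u u' b b' v v'] assms by (simp add: closure_edge_def balanced_iff_wbal)
  ultimately show ?thesis by simp
qed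

lemma closure_edge_unique_opening:
  assumes "closure_edge t a u b" "closure_edge t a' u' b"
  shows "u = u' \<and> a = a'"
proof -
  \<comment> \<open>The contour is rotated such that \<open>b\<close> comes last. Two such rotations
    both start with \<open>tour t b\<close> and therefore coincide.\<close>
  have ex: "\<exists>k v. rotate k (contour t) = (v @ a # u) @ [b]" if ab: "closure_edge t a u b" for a u
  proof -
    obtain k v where "rotate k (contour t) = (a # u @ [b]) @ v" using ab by (auto simp: closure_edge_def)
    then have "rotate (length (a # u @ [b])) (rotate k (contour t)) = v @ a # u @ [b]"
      by (simp only: rotate_append)
    then have "rotate (length (a # u @ [b]) + k) (contour t) = (v @ a # u) @ [b]"
      by (simp only: rotate_rotate append_assoc append_Cons)
    then show ?thesis by blast
  qed
  obtain k v where k: "rotate k (contour t) = (v @ a # u) @ [b]" using ex[OF assms(1)] by blast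
  obtain k' v' where k': "rotate k' (contour t) = (v' @ a' # u') @ [b]" using ex[OF assms(2)] by blast
  have "hd (rotate k (contour t)) = tour t b" "hd (rotate k' (contour t)) = tour t b"
    using cyclic_list_last[OF cyclic_list_rotate[OF cyclic_contour[of t]], of k]
      cyclic_list_last[OF cyclic_list_rotate[OF cyclic_contour[of t]], of k'] k k' 
    by (metis append_is_Nil_conv last_snoc list.distinct(1) rotate_is_Nil_conv)+
  then have "v @ a # u = v' @ a' # u'" using rotate_contour_unique[of k t k'] k k' by simp
  moreover from this have "u = u'"
    using stems.opening_unique[of t u u' a a' v v'] assms by (simp add: closure_edge_def balanced_iff_wbal)
  ultimately show ?thesis by simp
qed

lemma closure_mate_closure_edge:
  assumes "closure_edge t a u b"
  shows "closure_mate t a = b" "closure_mate t b = a"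
proof -
  note D = closure_edgeD[OF assms]
  have "(THE b. \<exists>u. closure_edge t a u b) = b"
    using assms closure_edge_unique_closing by (intro the_equality) blast+
  then show "closure_mate t a = b" using D by (simp add: closure_mate_def opening_stem_half_edge)
  have "(THE a. \<exists>u. closure_edge t a u b) = a"
    using assms closure_edge_unique_opening by (intro the_equality) blast+
  then show "closure_mate t b = a" using D opening_not_closing[of t b]
    by (auto simp: closure_mate_def closing_stem_half_edge)
qed

lemma closure_mate_neutral:
  assumes "h \<in> half_edges t" "\<not> stem t h"
  shows "closure_mate t h = tree_mate h"
  using assms by (cases h) (simp_all only: closure_mate_def stem_def, simp_all)

lemma closure_mate_outside: "h \<notin> half_edges t \<Longrightarrow> closure_mate t h = h"
  by (simp add: closure_mate_def)

section \<open>Nesting of the new edges\<close>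

definition factor :: "blossoming_tree \<Rightarrow> half_edge list \<Rightarrow> bool" where
  "factor t w \<longleftrightarrow> (\<exists>k v. rotate k (contour t) = w @ v)"

lemma factor_middle: "factor t (u @ w @ v) \<Longrightarrow> factor t w"
proof -
  assume "factor t (u @ w @ v)"
  then obtain k v' where "rotate k (contour t) = u @ (w @ v @ v')" by (auto simp: factor_def)
  then have "rotate (length u) (rotate k (contour t)) = (w @ v @ v') @ u" by (simp only: rotate_append)
  then show ?thesis by (auto simp: factor_def rotate_rotate)
qed

lemma closure_edge_iff_factor:
  "closure_edge t a u b \<longleftrightarrow>
    opening_stem t a \<and> closing_stem t b \<and> balanced t u \<and> factor t (a # u @ [b])"
  by (auto simp: closure_edge_def factor_def)

lemma closure_edge_factor:
  assumes "factor t (v1 @ a # u @ b # v2)" "opening_stem t a" "closing_stem t b" "balanced t u"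
  shows "closure_edge t a u b"
  using assms factor_middle[of t v1 "a # u @ [b]" v2] by (simp add: closure_edge_iff_factor)

lemma closure_edge_nested_opening:
  assumes "closure_edge t a u b" "a' \<in> set u" "opening_stem t a'"
  obtains u' b' where "closure_edge t a' u' b'" "b' \<in> set u" "set u' \<subseteq> set u"
proof -
  obtain v1 u' b' v2 where u: "u = v1 @ a' # u' @ b' # v2" "closing_stem t b'" "balanced t u'"
    using wbal_opening_split[of "opening_stem t" "closing_stem t" u a'] assms opening_not_closing
    by (auto simp: closure_edge_def balanced_iff_wbal)
  have "factor t ((a # v1) @ a' # u' @ b' # v2 @ [b])"
    using assms(1) u(1) by (simp add: closure_edge_iff_factor)
  from closure_edge_factor[OF this assms(3) u(2,3)] show ?thesis using u(1) that[of u' b'] by auto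
qed

lemma closure_edge_nested_closing:
  assumes "closure_edge t a u b" "b' \<in> set u" "closing_stem t b'"
  obtains u' a' where "closure_edge t a' u' b'" "a' \<in> set u"
proof -
  obtain v1 u' a' v2 where u: "u = v1 @ a' # u' @ b' # v2" "opening_stem t a'" "balanced t u'"
    using wbal_closing_split[of "opening_stem t" "closing_stem t" u b'] assms opening_not_closing
    by (auto simp: closure_edge_def balanced_iff_wbal)
  have "factor t ((a # v1) @ a' # u' @ b' # v2 @ [b])"
    using assms(1) u(1) by (simp add: closure_edge_iff_factor)
  from closure_edge_factor[OF this u(2) assms(3) u(3)] show ?thesis using u(1) that[of a' u'] by auto
qed

text \<open>The new edges that separate the corner before \<open>h\<close> from the infinite face,
  named by their opening stems. This set turns out to be constant on faces and to tell faces apart;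
  it consists of the edges crossed by the dual path from the outer face.\<close>

definition enclosing :: "blossoming_tree \<Rightarrow> half_edge \<Rightarrow> half_edge set" where
  "enclosing t h = {a. \<exists>u b. closure_edge t a u b \<and> h \<in> insert b (set u)}"

lemma enclosed_iff: "enclosed t (Before h) \<longleftrightarrow> enclosing t h \<noteq> {}"
  by (auto simp: enclosed_def enclosing_def)

lemma not_enclosed_Isolated: "\<not> enclosed t (Isolated v)"
  by (auto simp: enclosed_def)

lemma enclosing_opening: "a \<in> enclosing t h \<Longrightarrow> opening_stem t a"
  by (auto simp: enclosing_def closure_edge_def)

lemma finite_enclosing: "finite (enclosing t h)"
  by (rule finite_subset[OF _ finite_half_edges[of t]])
     (auto dest: enclosing_opening opening_stem_half_edge)

lemma mem_enclosing_iff: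
  assumes "closure_edge t a u b"
  shows "a \<in> enclosing t h \<longleftrightarrow> h \<in> insert b (set u)"
proof
  assume "a \<in> enclosing t h"
  then obtain u' b' where "closure_edge t a u' b'" "h \<in> insert b' (set u')" by (auto simp: enclosing_def)
  then show "h \<in> insert b (set u)" using closure_edge_unique_closing[OF assms] by blast
next
  assume "h \<in> insert b (set u)"
  then show "a \<in> enclosing t h" using assms by (auto simp: enclosing_def)
qed

text \<open>\<open>tour\<close> shifts the word \<open>a # u @ [b]\<close> by one place, so it maps
  \<open>a # u\<close> onto \<open>u @ [b]\<close>; the converse direction uses its
  injectivity.\<close>

lemma mem_enclosing_tour_iff:
  assumes "closure_edge t a u b" "h \<in> half_edges t"
  shows "a \<in> enclosing t (tour t h) \<longleftrightarrow> h \<in> insert a (set u)"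
proof -
  let ?w = "a # u @ [b]"
  note D = closure_edgeD[OF assms(1)]
  have step: "?w ! Suc i = tour t (?w ! i)" if "Suc i < length ?w" for i
    using walk_nth[OF D(4)] that by blast
  have "tour t h \<in> insert b (set u) \<longleftrightarrow> h \<in> insert a (set u)"
  proof
    assume "tour t h \<in> insert b (set u)"
    then have "tour t h \<in> set (u @ [b])" by auto
    then obtain i where i: "i < length (u @ [b])" "tour t h = (u @ [b]) ! i" by (metis in_set_conv_nth)
    then have "tour t h = tour t (?w ! i)" using step[of i] by simp
    moreover have "?w ! i \<in> half_edges t" using D(6) i(1) nth_mem[of i ?w] by auto
    ultimately have "h = ?w ! i" using tour_inj assms(2) by blast
    then show "h \<in> insert a (set u)" using i(1) by (cases i) (auto simp: nth_append)
  next
    assume "h \<in> insert a (set u)"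
    then have "h \<in> set (a # u)" by simp
    then obtain i where i: "i < length (a # u)" "h = (a # u) ! i" by (metis in_set_conv_nth)
    then have "h = ?w ! i" by (cases i) (auto simp: nth_append)
    then have "tour t h = (u @ [b]) ! i" using step[of i] i(1) by simp
    moreover have "(u @ [b]) ! i \<in> set (u @ [b])" using i(1) by (intro nth_mem) simp
    ultimately show "tour t h \<in> insert b (set u)" by simp
  qed
  then show ?thesis using mem_enclosing_iff[OF assms(1)] by simp
qed

lemma next_clockwise_props:
  assumes "h \<in> half_edges t"
  shows "next_clockwise t h \<in> half_edges t" "origin (next_clockwise t h) = origin h"
proof -
  have "h \<in> set (half_edges_at t (origin h))"
    using assms by (simp add: set_half_edges_at origin_in_tree_vertices)
  then have "next_clockwise t h \<in> set (half_edges_at t (origin h))"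
    using cyclic_list_bij[OF half_edges_at_cyclic] by (auto simp: bij_betw_def)
  then show "next_clockwise t h \<in> half_edges t" "origin (next_clockwise t h) = origin h"
    using set_half_edges_at[OF origin_in_tree_vertices[OF assms]] by auto
qed

lemma next_clockwise_reach:
  assumes "h \<in> half_edges t" "h' \<in> half_edges t" "origin h = origin h'"
  shows "\<exists>n. h' = (next_clockwise t ^^ n) h"
  using assms
  by (intro cyclic_list_reach[OF half_edges_at_cyclic[of t "origin h"]])
     (simp_all add: set_half_edges_at origin_in_tree_vertices)

lemma next_clockwise_bij: "bij_betw (next_clockwise t) (half_edges t) (half_edges t)"
proof -
  have "inj_on (next_clockwise t) (half_edges t)"
  proof (rule inj_onI)
    fix h h' assume h: "h \<in> half_edges t" "h' \<in> half_edges t" "next_clockwise t h = next_clockwise t h'"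
    then have "origin h = origin h'" using next_clockwise_props(2) by metis
    then have "{h, h'} \<subseteq> set (half_edges_at t (origin h))"
      using h by (simp add: set_half_edges_at origin_in_tree_vertices)
    then show "h = h'" using cyclic_list_bij[OF half_edges_at_cyclic[of t "origin h"]] h(3)
      by (auto simp: bij_betw_def inj_on_def)
  qed
  moreover have "next_clockwise t ` half_edges t \<subseteq> half_edges t" using next_clockwise_props by auto
  ultimately show ?thesis by (simp add: bij_betw_def endo_inj_surj)
qed

locale charge_zero_tree =
  fixes t :: blossoming_tree
  assumes charge_0: "charge t = 0"
begin

lemma balanced_rotation: obtains k where "balanced t (rotate k (contour t))"
  using stems.wbal_rotate[of t "contour t"] height_contour[of t] charge_0 by (auto simp: balanced_iff_wbal)

lemma closure_edge_of_opening:
  assumes "opening_stem t a"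
  obtains u b where "closure_edge t a u b"
proof -
  obtain k where k: "balanced t (rotate k (contour t))" using balanced_rotation .
  have "a \<in> set (rotate k (contour t))" using assms opening_stem_half_edge by (simp add: set_contour)
  then obtain v1 u b v2 where w: "rotate k (contour t) = v1 @ a # u @ b # v2" "closing_stem t b" "balanced t u"
    using wbal_opening_split[of "opening_stem t" "closing_stem t" _ a] k assms opening_not_closing
    by (metis balanced_iff_wbal)
  then have "factor t (v1 @ a # u @ b # v2)" unfolding factor_def by (metis append_Nil2)
  then show ?thesis using closure_edge_factor w assms that by blast
qed

lemma closure_edge_of_closing:
  assumes "closing_stem t b"
  obtains u a where "closure_edge t a u b"
proof -
  obtain k where k: "balanced t (rotate k (contour t))" using balanced_rotation .
  have "b \<in> set (rotate k (contour t))" using assms closing_stem_half_edge by (simp add: set_contour)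
  then obtain v1 u a v2 where w: "rotate k (contour t) = v1 @ a # u @ b # v2" "opening_stem t a" "balanced t u"
    using wbal_closing_split[of "opening_stem t" "closing_stem t" _ b] k assms opening_not_closing
    by (metis balanced_iff_wbal)
  then have "factor t (v1 @ a # u @ b # v2)" unfolding factor_def by (metis append_Nil2)
  then show ?thesis using closure_edge_factor w assms that by blast
qed

lemma enclosing_tour_neutral:
  assumes "h \<in> half_edges t" "\<not> stem t h"
  shows "enclosing t (tour t h) = enclosing t h"
proof -
  have "a \<in> enclosing t (tour t h) \<longleftrightarrow> a \<in> enclosing t h" if a: "opening_stem t a" for a
  proof -
    obtain u b where ab: "closure_edge t a u b" using closure_edge_of_opening[OF a] .
    have "h \<noteq> a" "h \<noteq> b" using closure_edgeD(1,2)[OF ab] assms(2) by (auto simp: stem_def)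
    then show ?thesis using mem_enclosing_iff[OF ab] mem_enclosing_tour_iff[OF ab assms(1)] by simp
  qed
  then show ?thesis using enclosing_opening by blast
qed

text \<open>The corners before \<open>a\<close> and after \<open>b\<close> lie outside the new edge,
  those after \<open>a\<close> and before \<open>b\<close> inside. Any other new edge encloses
  either all four or none of them, since matched pairs are nested.\<close>

lemma enclosing_closure_edge:
  assumes "closure_edge t a u b"
  shows "enclosing t (tour t a) = insert a (enclosing t a)" "enclosing t b = insert a (enclosing t a)"
    "enclosing t (tour t b) = enclosing t a" "a \<notin> enclosing t a"
proof -
  note D = closure_edgeD[OF assms]
  have in_H: "a \<in> half_edges t" "b \<in> half_edges t" using D(6) by auto
  show na: "a \<notin> enclosing t a" using D(5) mem_enclosing_iff[OF assms] by auto
  have *: "a' \<in> enclosing t (tour t a) \<longleftrightarrow> a' \<in> insert a (enclosing t a)"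
    "a' \<in> enclosing t b \<longleftrightarrow> a' \<in> insert a (enclosing t a)"
    "a' \<in> enclosing t (tour t b) \<longleftrightarrow> a' \<in> enclosing t a" if a': "opening_stem t a'" for a'
  proof -
    obtain u' b' where ab': "closure_edge t a' u' b'" using closure_edge_of_opening[OF a'] .
    note m = mem_enclosing_iff[OF ab'] and mt = mem_enclosing_tour_iff[OF ab' in_H(1)]
      mem_enclosing_tour_iff[OF ab' in_H(2)]
    have "a \<noteq> b'" using D(1) closure_edgeD(2)[OF ab'] opening_not_closing by blast
    moreover have "a' \<noteq> b" using D(2) a' opening_not_closing by blast
    moreover have "a' = a \<longleftrightarrow> b' = b"
      using closure_edge_unique_closing closure_edge_unique_opening assms ab' by blast
    moreover have "a \<in> set u' \<longleftrightarrow> b \<in> set u'"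
    proof
      assume "a \<in> set u'"
      then show "b \<in> set u'"
        using closure_edge_nested_opening[OF ab' _ D(1)] closure_edge_unique_closing[OF assms] by metis
    next
      assume "b \<in> set u'"
      then show "a \<in> set u'"
        using closure_edge_nested_closing[OF ab' _ D(2)] closure_edge_unique_opening[OF assms] by metis
    qed
    ultimately show "a' \<in> enclosing t (tour t a) \<longleftrightarrow> a' \<in> insert a (enclosing t a)"
      "a' \<in> enclosing t b \<longleftrightarrow> a' \<in> insert a (enclosing t a)"
      "a' \<in> enclosing t (tour t b) \<longleftrightarrow> a' \<in> enclosing t a"
      using m mt by auto
  qed
  have eqI: "A = B" if "A \<subseteq> Collect (opening_stem t)" "B \<subseteq> Collect (opening_stem t)"
    "\<And>a'. opening_stem t a' \<Longrightarrow> a' \<in> A \<longleftrightarrow> a' \<in> B" for A B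
    using that by blast
  have sub: "enclosing t x \<subseteq> Collect (opening_stem t)" for x using enclosing_opening by blast
  show "enclosing t (tour t a) = insert a (enclosing t a)"
    by (rule eqI) (use sub D(1) *(1) in simp_all)
  show "enclosing t b = insert a (enclosing t a)"
    by (rule eqI) (use sub D(1) *(2) in simp_all)
  show "enclosing t (tour t b) = enclosing t a"
    by (rule eqI) (use sub *(3) in simp_all)
qed

text \<open>By nesting, whatever encloses \<open>a'\<close> also encloses \<open>a\<close>; the
  inclusion is strict because the corner before \<open>a'\<close> is not enclosed by
  \<open>a'\<close> itself.\<close>

lemma enclosing_psubset:
  assumes "a' \<in> enclosing t a" "opening_stem t a"
  shows "enclosing t a' \<subset> enclosing t a"
proof -
  have a': "opening_stem t a'" using assms(1) enclosing_opening by blast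
  obtain u b where ab': "closure_edge t a' u b" using closure_edge_of_opening[OF a'] .
  have "b \<noteq> a" using closure_edgeD(2)[OF ab'] assms(2) opening_not_closing by blast
  then have au: "a \<in> set u" using assms(1) mem_enclosing_iff[OF ab'] by auto
  have "a'' \<in> enclosing t a" if a'': "a'' \<in> enclosing t a'" for a''
  proof -
    obtain u2 b2 where ab2: "closure_edge t a'' u2 b2"
      using closure_edge_of_opening[OF enclosing_opening[OF a'']] .
    have "b2 \<noteq> a'" using closure_edgeD(2)[OF ab2] a' opening_not_closing by blast
    then have "a' \<in> set u2" using a'' mem_enclosing_iff[OF ab2] by auto
    then have "set u \<subseteq> set u2"
      using closure_edge_nested_opening[OF ab2 _ a'] closure_edge_unique_closing[OF ab'] by metis
    then show ?thesis using au mem_enclosing_iff[OF ab2] by auto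
  qed
  then show ?thesis using assms(1) enclosing_closure_edge(4)[OF ab'] by blast
qed

lemma closure_mate_in: "h \<in> half_edges t \<Longrightarrow> closure_mate t h \<in> half_edges t"
  and closure_mate_mate: "h \<in> half_edges t \<Longrightarrow> closure_mate t (closure_mate t h) = h"
  and closure_mate_stem: "h \<in> half_edges t \<Longrightarrow> stem t (closure_mate t h) \<longleftrightarrow> stem t h"
proof -
  assume h: "h \<in> half_edges t"
  have "closure_mate t h \<in> half_edges t \<and> closure_mate t (closure_mate t h) = h \<and>
    (stem t (closure_mate t h) \<longleftrightarrow> stem t h)"
  proof (cases "stem t h")
    case False
    then show ?thesis using tree_mate_simps[OF h False] closure_mate_neutral h by simp
  next
    case True
    then obtain a u b where ab: "closure_edge t a u b" "h = a \<or> h = b"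
      using closure_edge_of_opening closure_edge_of_closing unfolding stem_def by metis
    then show ?thesis
      using closure_mate_closure_edge[OF ab(1)] closure_edgeD[OF ab(1)] by (auto simp: stem_def)
  qed
  then show "closure_mate t h \<in> half_edges t" "closure_mate t (closure_mate t h) = h"
    "stem t (closure_mate t h) \<longleftrightarrow> stem t h" by auto
qed


section \<open>The faces of the closure\<close>

definition face_step :: "half_edge \<Rightarrow> half_edge" where
  "face_step h = next_clockwise t (closure_mate t h)"

lemma closure_mate_bij: "bij_betw (closure_mate t) (half_edges t) (half_edges t)"
  by (rule bij_betwI[where g = "closure_mate t"]) (auto simp: closure_mate_in closure_mate_mate)

lemma face_step_bij: "bij_betw face_step (half_edges t) (half_edges t)"
  using bij_betw_trans[OF closure_mate_bij next_clockwise_bij] by (simp add: face_step_def[abs_def] comp_def)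

lemma face_step_in: "h \<in> half_edges t \<Longrightarrow> face_step h \<in> half_edges t"
  using face_step_bij by (auto simp: bij_betw_def)

lemmas orbit_step = bij_orbit_step[OF face_step_bij finite_half_edges]

lemma face_step_neutral: "h \<in> half_edges t \<Longrightarrow> \<not> stem t h \<Longrightarrow> face_step h = tour t h"
  by (simp add: face_step_def tour_def closure_mate_neutral)

lemma face_step_closure_edge:
  assumes "closure_edge t a u b"
  shows "face_step a = tour t b" "face_step b = tour t a"
  using closure_mate_closure_edge[OF assms] closure_edgeD(1,2)[OF assms]
  by (simp_all add: face_step_def tour_def stem_def)

lemma enclosing_face_step:
  assumes "h \<in> half_edges t"
  shows "enclosing t (face_step h) = enclosing t h"
proof (cases "stem t h")
  case True
  then obtain a u b where ab: "closure_edge t a u b" "h = a \<or> h = b"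
    using closure_edge_of_opening closure_edge_of_closing unfolding stem_def by metis
  then show ?thesis using face_step_closure_edge[OF ab(1)] enclosing_closure_edge[OF ab(1)] by auto
qed (use assms in \<open>simp add: face_step_neutral enclosing_tour_neutral\<close>)

lemma enclosing_orbit: "h' \<in> orbit face_step h \<Longrightarrow> h \<in> half_edges t \<Longrightarrow> enclosing t h' = enclosing t h"
  by (rule orbit_invariant[where A = "half_edges t" and f = face_step and D = "enclosing t"])
     (simp_all add: face_step_in enclosing_face_step)

text \<open>The face permutation follows the contour at tree edges and jumps over matched pairs,
  from \<open>a\<close> to the letter after \<open>b\<close>. So the outermost letters of a balanced
  word lie in the face of the next letter \<open>z\<close>; the others, among them each
  \<open>b\<close>, belong to a matched pair around a shorter word, which prepares an induction on
  length.\<close>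

lemma balanced_orbit:
  "balanced t w \<Longrightarrow> factor t w \<Longrightarrow> walk (tour t) (w @ [z]) \<Longrightarrow> insert z (set w) \<subseteq> half_edges t \<Longrightarrow>
    orbit face_step (hd (w @ [z])) = orbit face_step z \<and>
    (\<forall>h \<in> set w. orbit face_step h = orbit face_step z \<or>
       (\<exists>a u b. closure_edge t a u b \<and> length u < length w \<and> h \<in> insert b (set u)))"
proof (induction rule: balanced.induct)
  case (balanced_skip h u)
  have u: "walk (tour t) (u @ [z])" "hd (u @ [z]) = tour t h"
    using balanced_skip.prems(2) by (cases u; auto)+
  have "factor t u" using factor_middle[of t "[h]" u "[]"] balanced_skip.prems(1) by simp
  then have IH: "orbit face_step (hd (u @ [z])) = orbit face_step z"
    "\<And>h. h \<in> set u \<Longrightarrow> orbit face_step h = orbit face_step z \<or>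
       (\<exists>a u' b. closure_edge t a u' b \<and> length u' < length u \<and> h \<in> insert b (set u'))"
    using balanced_skip.IH u(1) balanced_skip.prems(3) by auto
  have h: "h \<in> half_edges t" "\<not> stem t h" using balanced_skip.hyps balanced_skip.prems by (auto simp: stem_def)
  have "orbit face_step h = orbit face_step (hd (u @ [z]))"
    using orbit_step[OF h(1)] face_step_neutral[OF h] u(2) by simp
  then have oh: "orbit face_step h = orbit face_step z" using IH(1) by simp
  have "orbit face_step x = orbit face_step z \<or>
     (\<exists>a u' b. closure_edge t a u' b \<and> length u' < length (h # u) \<and> x \<in> insert b (set u'))"
    if x: "x \<in> set (h # u)" for x
  proof (cases "x = h")
    case False
    have "length u' < length (h # u)" if "length u' < length u" for u' :: "half_edge list"
      using that by simp
    moreover have "x \<in> set u" using x False by simp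
    ultimately show ?thesis using IH(2)[of x] by blast
  qed (use oh in simp)
  then show ?case using oh by simp
next
  case (balanced_pair a b u v)
  have "walk (tour t) ((a # u) @ (b # v @ [z]))" using balanced_pair.prems(2) by simp
  then have "walk (tour t) (b # v @ [z])" by (simp only: successively_append_iff)
  then have v: "walk (tour t) (v @ [z])" "hd (v @ [z]) = tour t b" by (cases v; auto)+
  have "factor t v" using factor_middle[of t "a # u @ [b]" v "[]"] balanced_pair.prems(1) by simp
  then have IH: "orbit face_step (hd (v @ [z])) = orbit face_step z"
    "\<And>h. h \<in> set v \<Longrightarrow> orbit face_step h = orbit face_step z \<or>
       (\<exists>a u b. closure_edge t a u b \<and> length u < length v \<and> h \<in> insert b (set u))"
    using balanced_pair.IH(2) v(1) balanced_pair.prems(3) by auto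
  have ab: "closure_edge t a u b"
    using closure_edge_factor[of t "[]" a u b v] balanced_pair by simp
  have "orbit face_step a = orbit face_step (hd (v @ [z]))"
    using orbit_step[of a] face_step_closure_edge(1)[OF ab] v(2) balanced_pair.prems(3) by simp
  then have oa: "orbit face_step a = orbit face_step z" using IH(1) by simp
  have "orbit face_step h = orbit face_step z \<or>
     (\<exists>a' u' b'. closure_edge t a' u' b' \<and> length u' < length (a # u @ b # v) \<and> h \<in> insert b' (set u'))"
    if "h \<in> set (a # u @ b # v)" for h
  proof -
    consider "h = a" | "h \<in> insert b (set u)" | "h \<in> set v" using \<open>h \<in> set (a # u @ b # v)\<close> by auto
    then show ?thesis
    proof cases
      case 2
      moreover have "length u < length (a # u @ b # v)" by simp
      ultimately show ?thesis using ab by blast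
    next
      case 3
      have "length u' < length (a # u @ b # v)" if "length u' < length v" for u' :: "half_edge list"
        using that by simp
      then show ?thesis using IH(2)[OF 3] by blast
    qed (use oa in simp)
  qed
  then show ?case using oa by simp
qed simp

text \<open>Descend through the matched pairs around \<open>h\<close> until none inside is left that
  encloses it; then \<open>h\<close> lies in the face before the closing stem of the last
  pair.\<close>

lemma orbit_of_enclosed:
  assumes "closure_edge t a u b" "h \<in> insert b (set u)"
  shows "\<exists>b'. closing_stem t b' \<and> orbit face_step h = orbit face_step b'"
  using assms
proof (induction "length u" arbitrary: a u b rule: less_induct)
  case less
  note D = closure_edgeD[OF less.prems(1)]
  have "factor t u"
    using less.prems(1) factor_middle[of t "[a]" u "[b]"] by (simp add: closure_edge_iff_factor)
  moreover have "walk (tour t) (u @ [b])" using D(4) by (cases u) auto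
  ultimately have "\<forall>h \<in> set u. orbit face_step h = orbit face_step b \<or>
       (\<exists>a' u' b'. closure_edge t a' u' b' \<and> length u' < length u \<and> h \<in> insert b' (set u'))"
    using balanced_orbit[of u b] D(3,6) by auto
  then show ?case using less.prems(2) less.hyps D(2) by blast
qed

text \<open>The same reading, applied to a balanced rotation of the whole contour and closed up by
  its own first letter.\<close>

lemma orbit_of_unenclosed:
  assumes "h \<in> half_edges t" "enclosing t h = {}" "h' \<in> half_edges t" "enclosing t h' = {}"
  shows "orbit face_step h = orbit face_step h'"
proof -
  obtain k where k: "balanced t (rotate k (contour t))" using balanced_rotation .
  let ?w = "rotate k (contour t)"
  have set_w: "set ?w = half_edges t" by (simp add: set_contour)
  then have ne: "?w \<noteq> []" using assms(1) by (metis empty_iff empty_set)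
  have cyc: "cyclic_list (tour t) ?w" by (rule cyclic_list_rotate[OF cyclic_contour])
  have "walk (tour t) (?w @ [hd ?w])"
    using cyclic_list_walk[OF cyc] cyclic_list_last[OF cyc ne] ne by (intro walk_append) simp_all
  moreover have "factor t ?w" unfolding factor_def by (metis append_Nil2)
  moreover have "insert (hd ?w) (set ?w) \<subseteq> half_edges t" using ne set_w hd_in_set by blast
  ultimately have *: "\<forall>h \<in> half_edges t. orbit face_step h = orbit face_step (hd ?w) \<or>
       (\<exists>a u b. closure_edge t a u b \<and> length u < length ?w \<and> h \<in> insert b (set u))"
    using balanced_orbit[OF k, of "hd ?w"] set_w by blast
  have "orbit face_step x = orbit face_step (hd ?w)" if "x \<in> half_edges t" "enclosing t x = {}" for x
    using * that by (auto simp: enclosing_def)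
  then show ?thesis using assms by simp
qed

text \<open>An opening stem enclosed by the fewest new edges is enclosed by none, because an edge
  around it would be enclosed by even fewer.\<close>

lemma unenclosed_exists:
  assumes "half_edges t \<noteq> {}"
  shows "\<exists>h \<in> half_edges t. enclosing t h = {}"
proof (cases "\<exists>a. opening_stem t a")
  case True
  then obtain a where a: "opening_stem t a" "\<And>a'. opening_stem t a' \<Longrightarrow>
      card (enclosing t a) \<le> card (enclosing t a')"
    using ex_has_least_nat[of "opening_stem t" _ "\<lambda>a. card (enclosing t a)"] by blast
  have "enclosing t a = {}"
  proof (rule ccontr)
    assume "enclosing t a \<noteq> {}"
    then obtain a' where a': "a' \<in> enclosing t a" by blast
    have "card (enclosing t a') < card (enclosing t a)"
      by (rule psubset_card_mono[OF finite_enclosing enclosing_psubset[OF a' a(1)]])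
    then show False using a(2)[OF enclosing_opening[OF a']] by simp
  qed
  then show ?thesis using a(1) opening_stem_half_edge by blast
next
  case False
  then show ?thesis using assms enclosing_opening by blast
qed

lemma orbit_of_unenclosed_eq:
  assumes "h \<in> half_edges t" "enclosing t h = {}"
  shows "orbit face_step h = {h \<in> half_edges t. enclosing t h = {}}"
proof
  show "orbit face_step h \<subseteq> {h \<in> half_edges t. enclosing t h = {}}"
    using bij_orbit_subset[OF face_step_bij _ assms(1)] enclosing_orbit[of _ h] assms by auto
  show "{h \<in> half_edges t. enclosing t h = {}} \<subseteq> orbit face_step h"
    using orbit_of_unenclosed[OF assms] bij_self_in_orbit[OF face_step_bij finite_half_edges] by auto
qed

text \<open>Besides the outer face there is one face for each new edge, the one that contains the
  corner before its closing stem.\<close>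

lemma card_orbits:
  assumes "half_edges t \<noteq> {}"
  shows "card (orbit face_step ` half_edges t) = Suc (card {b. closing_stem t b})"
proof -
  let ?C = "{b. closing_stem t b}"
  obtain h0 where h0: "h0 \<in> half_edges t" "enclosing t h0 = {}" using unenclosed_exists[OF assms] by blast
  have CH: "?C \<subseteq> half_edges t" using closing_stem_half_edge by blast
  then have fin: "finite ?C" using finite_subset finite_half_edges by blast
  have self: "x \<in> orbit face_step x" if "x \<in> half_edges t" for x
    using bij_self_in_orbit[OF face_step_bij finite_half_edges that] .
  have "orbit face_step ` half_edges t = insert (orbit face_step h0) (orbit face_step ` ?C)"
  proof
    show "orbit face_step ` half_edges t \<subseteq> insert (orbit face_step h0) (orbit face_step ` ?C)"
    proof
      fix f assume "f \<in> orbit face_step ` half_edges t"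
      then obtain h where h: "h \<in> half_edges t" "f = orbit face_step h" by blast
      show "f \<in> insert (orbit face_step h0) (orbit face_step ` ?C)"
      proof (cases "enclosing t h = {}")
        case True
        then show ?thesis using orbit_of_unenclosed h h0 by blast
      next
        case False
        then obtain a u b where "closure_edge t a u b" "h \<in> insert b (set u)"
          by (auto simp: enclosing_def)
        then show ?thesis using orbit_of_enclosed h(2) by blast
      qed
    qed
    show "insert (orbit face_step h0) (orbit face_step ` ?C) \<subseteq> orbit face_step ` half_edges t"
      using h0 CH by blast
  qed
  moreover have "orbit face_step h0 \<notin> orbit face_step ` ?C"
  proof
    assume "orbit face_step h0 \<in> orbit face_step ` ?C"
    then obtain b where b: "closing_stem t b" "orbit face_step h0 = orbit face_step b" by blast
    obtain u a where ab: "closure_edge t a u b" using closure_edge_of_closing[OF b(1)] .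
    have "enclosing t h0 = enclosing t b"
      using enclosing_orbit[of h0 b] self[OF h0(1)] b closing_stem_half_edge by simp
    then show False using h0(2) enclosing_closure_edge(2)[OF ab] by simp
  qed
  moreover have "inj_on (orbit face_step) ?C"
  proof (rule inj_onI)
    fix b b' assume b: "b \<in> ?C" "b' \<in> ?C" "orbit face_step b = orbit face_step b'"
    obtain u a where ab: "closure_edge t a u b" using closure_edge_of_closing b by blast
    obtain u' a' where ab': "closure_edge t a' u' b'" using closure_edge_of_closing b by blast
    have "enclosing t b = enclosing t b'"
      using enclosing_orbit[of b b'] self[of b] b CH by auto
    then have *: "insert a (enclosing t a) = insert a' (enclosing t a')"
      using enclosing_closure_edge(2)[OF ab] enclosing_closure_edge(2)[OF ab'] by simp
    \<comment> \<open>Otherwise each of the two new edges would enclose the other.\<close>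
    have "a = a'"
    proof (rule ccontr)
      assume "a \<noteq> a'"
      moreover have "a \<in> insert a' (enclosing t a')" by (simp only: *[symmetric] insertI1)
      moreover have "a' \<in> insert a (enclosing t a)" by (simp only: * insertI1)
      ultimately have "a \<in> enclosing t a'" "a' \<in> enclosing t a" by simp_all
      then have "enclosing t a \<subset> enclosing t a'" "enclosing t a' \<subset> enclosing t a"
        using enclosing_psubset closure_edgeD(1)[OF ab] closure_edgeD(1)[OF ab'] by simp_all
      then show False by (rule less_asym)
    qed
    then show "b = b'" using closure_edge_unique_closing ab ab' by blast
  qed
  ultimately show ?thesis using fin by (simp add: card_image)
qed

lemma card_half_edges:
  "card (half_edges t) = 2 * (card (tree_vertices t) - 1) + 2 * card {b. closing_stem t b}"
proof -
  let ?N = "{h \<in> half_edges t. \<not> stem t h}" and ?O = "{a. opening_stem t a}" and ?C = "{b. closing_stem t b}"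
  have fin: "finite ?O" "finite ?C"
    by (rule finite_subset[OF _ finite_half_edges[of t]];
        auto intro: opening_stem_half_edge closing_stem_half_edge)+
  have "half_edges t = ?N \<union> (?O \<union> ?C)"
    using opening_stem_half_edge closing_stem_half_edge by (auto simp: stem_def)
  moreover have "?N \<inter> (?O \<union> ?C) = {}" "?O \<inter> ?C = {}" by (auto simp: stem_def opening_not_closing)
  ultimately have "card (half_edges t) = card ?N + (card ?O + card ?C)"
    using fin by (metis card_Un_disjoint finite_Un finite_half_edges)
  moreover have "card ?O = card ?C"
  proof (rule bij_betw_same_card[of "closure_mate t"], rule bij_betwI[where g = "closure_mate t"])
    show "closure_mate t \<in> ?O \<rightarrow> ?C"
    proof
      fix a assume "a \<in> ?O"
      then obtain u b where "closure_edge t a u b" using closure_edge_of_opening by blast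
      then show "closure_mate t a \<in> ?C" using closure_mate_closure_edge closure_edgeD(2) by simp
    qed
    show "closure_mate t \<in> ?C \<rightarrow> ?O"
    proof
      fix b assume "b \<in> ?C"
      then obtain u a where "closure_edge t a u b" using closure_edge_of_closing by blast
      then show "closure_mate t b \<in> ?O" using closure_mate_closure_edge closure_edgeD(1) by simp
    qed
  qed (use closure_mate_mate opening_stem_half_edge closing_stem_half_edge in blast)+
  ultimately show ?thesis using card_neutral_half_edges[of t] by simp
qed

end

section \<open>Charges as flows\<close>

definition vertex_sign :: "blossoming_tree \<Rightarrow> nat list \<Rightarrow> int" where
  "vertex_sign t p = (if vertex_colour (subtree t p) = Black then 1 else - 1)"

text \<open>\<open>well_charged\<close> without the bounds on charges. For a tree opened from a map
  the colours are known first, and the flow that yields the bounds already relies on them.\<close>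

definition properly_coloured :: "blossoming_tree \<Rightarrow> bool" where
  "properly_coloured t \<longleftrightarrow>
     (\<forall>p \<in> tree_vertices t. p \<noteq> [] \<longrightarrow>
        vertex_colour (subtree t p) \<noteq> vertex_colour (subtree t (butlast p))) \<and>
     (\<forall>p \<in> tree_vertices t. vertex_colour (subtree t p) = Black \<longrightarrow> Closing \<notin> set (branches (subtree t p))) \<and>
     (\<forall>p \<in> tree_vertices t. vertex_colour (subtree t p) = White \<longrightarrow> Opening \<notin> set (branches (subtree t p)))"

lemma well_charged_properly_coloured: "well_charged t \<Longrightarrow> properly_coloured t"
  by (auto simp: well_charged_def properly_coloured_def)

lemma vertex_sign_child:
  assumes "properly_coloured t" "p @ [i] \<in> tree_vertices t"
  shows "vertex_sign t (p @ [i]) = - vertex_sign t p"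
proof -
  have "vertex_colour (subtree t (p @ [i])) \<noteq> vertex_colour (subtree t p)"
    using assms unfolding properly_coloured_def by (metis butlast_snoc snoc_eq_iff_butlast)
  then show ?thesis
    by (cases "vertex_colour (subtree t (p @ [i]))"; cases "vertex_colour (subtree t p)")
       (auto simp: vertex_sign_def)
qed

lemma vertex_sign_stem:
  assumes "properly_coloured t" "h \<in> half_edges t"
  shows "opening_stem t h \<Longrightarrow> vertex_sign t (origin h) = 1"
    "closing_stem t h \<Longrightarrow> vertex_sign t (origin h) = - 1"
proof -
  show "vertex_sign t (origin h) = 1" if "opening_stem t h"
  proof (cases h)
    case (ToBranch p i)
    then have "p \<in> tree_vertices t" "Opening \<in> set (branches (subtree t p))"
      using that by (auto simp: in_set_conv_nth)
    then have "vertex_colour (subtree t p) \<noteq> White" using assms(1) by (auto simp: properly_coloured_def)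
    then show ?thesis using ToBranch by (cases "vertex_colour (subtree t p)") (auto simp: vertex_sign_def)
  qed (use that in simp)
  show "vertex_sign t (origin h) = - 1" if "closing_stem t h"
  proof (cases h)
    case (ToBranch p i)
    then have "p \<in> tree_vertices t" "Closing \<in> set (branches (subtree t p))"
      using that by (auto simp: in_set_conv_nth)
    then have "vertex_colour (subtree t p) \<noteq> Black" using assms(1) by (auto simp: properly_coloured_def)
    then show ?thesis using ToBranch by (auto simp: vertex_sign_def)
  qed (use that in simp)
qed

text \<open>Only the parent edge connects the subtree at \<open>p\<close> to the rest, so it carries
  the whole supply of the subtree. In the sum of \<open>N * sign * degree + 1\<close> over its
  vertices, the two ends of an inner edge cancel, the stems contribute \<open>- charge\<close> times
  \<open>N\<close>, the upper end of the subtree contributes its own sign, and the ones add up to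
  the size.\<close>

lemma tree_flow:
  fixes xs :: "half_edge \<Rightarrow> int" and N :: int
  assumes col: "properly_coloured t"
    and anti: "\<And>h. h \<in> half_edges t \<Longrightarrow> \<not> stem t h \<Longrightarrow> xs (tree_mate h) = - xs h"
    and zero: "\<And>h. h \<in> half_edges t \<Longrightarrow> stem t h \<Longrightarrow> xs h = 0"
    and div: "\<And>p. p \<in> tree_vertices t \<Longrightarrow> p \<noteq> [] \<Longrightarrow>
      (\<Sum>h | h \<in> half_edges t \<and> origin h = p. xs h) =
        N * vertex_sign t p * int (card {h \<in> half_edges t. origin h = p}) + 1"
    and p: "p \<in> tree_vertices t" "p \<noteq> []"
  shows "xs (ToParent p) = N * (vertex_sign t p - charge (subtree t p)) + int (tree_size (subtree t p))"
  using p
proof (induction "subtree t p" arbitrary: p rule: tree_induct)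
  case (Vertex c bs)
  let ?n = "length bs" and ?s = "vertex_sign t p"
  note bs = Vertex.hyps(2)[symmetric]
  \<comment> \<open>A stem carries no flow and fits the formula because its charge is opposite to
    the sign of its vertex.\<close>
  have branch: "xs (ToBranch p i) = N * (?s + branch_charge (bs ! i)) - int (branch_size (bs ! i))"
    if i: "i < ?n" for i
  proof -
    have h: "ToBranch p i \<in> half_edges t" using i bs Vertex.prems by simp
    show ?thesis
    proof (cases "bs ! i")
      case Opening
      then have "opening_stem t (ToBranch p i)" using i bs Vertex.prems by simp
      then show ?thesis using zero[OF h] vertex_sign_stem(1)[OF col h] Opening
        by (simp add: stem_def branch_size_def)
    next
      case Closing
      then have "closing_stem t (ToBranch p i)" using i bs Vertex.prems by simp
      then show ?thesis using zero[OF h] vertex_sign_stem(2)[OF col h] Closing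
        by (simp add: stem_def branch_size_def)
    next
      case (Edge s)
      then have q: "p @ [i] \<in> tree_vertices t" "subtree t (p @ [i]) = s"
        using i bs Vertex.prems by (auto simp: snoc_in_tree_vertices_iff subtree_snoc)
      have "Edge s \<in> set bs" using Edge i by (metis nth_mem)
      then have "xs (ToParent (p @ [i])) = N * (vertex_sign t (p @ [i]) - charge s) + int (tree_size s)"
        using Vertex.hyps(1)[of "p @ [i]"] q by simp
      moreover have "xs (ToBranch p i) = - xs (ToParent (p @ [i]))"
        using anti[of "ToParent (p @ [i])"] q by simp
      ultimately show ?thesis
        using vertex_sign_child[OF col q(1)] Edge by (simp add: branch_size_def algebra_simps)
    qed
  qed
  have at: "{h \<in> half_edges t. origin h = p} = insert (ToParent p) (ToBranch p ` {..<?n})"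
    unfolding set_half_edges_at[OF Vertex.prems(1), symmetric]
    using Vertex.prems(2) by (simp add: half_edges_at_def bs atLeast0LessThan)
  have inj: "inj_on (ToBranch p) {..<?n}" by (simp add: inj_on_def)
  have "card {h \<in> half_edges t. origin h = p} = Suc ?n"
    unfolding at by (subst card_insert_disjoint) (auto simp: card_image[OF inj])
  moreover have "(\<Sum>h | h \<in> half_edges t \<and> origin h = p. xs h) =
      xs (ToParent p) + (\<Sum>i < ?n. xs (ToBranch p i))"
    unfolding at by (subst sum.insert) (auto simp: sum.reindex[OF inj])
  moreover have "(\<Sum>i < ?n. xs (ToBranch p i)) =
      (\<Sum>i < ?n. N * (?s + branch_charge (bs ! i)) - int (branch_size (bs ! i)))"
    by (rule sum.cong) (simp_all add: branch)
  moreover have "\<dots> =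
      N * (int ?n * ?s + (\<Sum>i < ?n. branch_charge (bs ! i))) - (\<Sum>i < ?n. int (branch_size (bs ! i)))"
    by (simp add: sum_subtractf sum.distrib sum_distrib_left algebra_simps)
  moreover have "charge (subtree t p) = (\<Sum>i < ?n. branch_charge (bs ! i))"
    by (simp add: bs sum_list_sum_nth atLeast0LessThan)
  moreover have "int (tree_size (subtree t p)) = 1 + (\<Sum>i < ?n. int (branch_size (bs ! i)))"
    by (simp add: bs tree_size_Vertex)
  ultimately show ?case using div[OF Vertex.prems] by (simp add: algebra_simps)
qed

locale well_charged_tree = charge_zero_tree +
  assumes wc: "well_charged t"
begin

lemma coloured: "properly_coloured t"
  using wc by (rule well_charged_properly_coloured)

lemma origin_closure_mate_sign:
  assumes "h \<in> half_edges t"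
  shows "vertex_sign t (origin (closure_mate t h)) = - vertex_sign t (origin h)"
proof (cases "stem t h")
  case True
  then obtain a u b where ab: "closure_edge t a u b" "h = a \<or> h = b"
    using closure_edge_of_opening closure_edge_of_closing unfolding stem_def by metis
  then show ?thesis
    using closure_mate_closure_edge[OF ab(1)] closure_edgeD[OF ab(1)] vertex_sign_stem[OF coloured] by auto
next
  case False
  show ?thesis
  proof (cases h)
    case (ToParent p)
    then have "p = butlast p @ [last p]" "p \<in> tree_vertices t" using assms by auto
    then have "vertex_sign t p = - vertex_sign t (butlast p)"
      using vertex_sign_child[OF coloured, of "butlast p" "last p"] by simp
    then show ?thesis using ToParent closure_mate_neutral[OF assms False] by simp
  next
    case (ToBranch p i)
    then have "p @ [i] \<in> tree_vertices t" using assms False by simp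
    then show ?thesis
      using ToBranch closure_mate_neutral[OF assms False] vertex_sign_child[OF coloured] by simp
  qed
qed

text \<open>Climbing along parent edges shows that the set contains the root; descending from there
  reaches all vertices.\<close>

lemma tree_vertices_connected:
  assumes "S \<subseteq> tree_vertices t" "S \<noteq> {}"
    and closed: "\<And>h. h \<in> half_edges t \<Longrightarrow> origin h \<in> S \<Longrightarrow> origin (closure_mate t h) \<in> S"
  shows "S = tree_vertices t"
proof -
  have up: "[] \<in> S" if "p \<in> S" for p
    using that
  proof (induction p rule: rev_induct)
    case (snoc i p)
    then have "ToParent (p @ [i]) \<in> half_edges t" using assms(1) by auto
    then have "p \<in> S" using closed[of "ToParent (p @ [i])"] snoc.prems closure_mate_neutral by simp
    then show ?case by (rule snoc.IH)
  qed
  have "p \<in> S" if "p \<in> tree_vertices t" for p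
    using that
  proof (induction p rule: rev_induct)
    case Nil
    then show ?case using assms(2) up by blast
  next
    case (snoc i p)
    then have h: "ToBranch p i \<in> half_edges t" "\<not> stem t (ToBranch p i)" "p \<in> S"
      using tree_vertices_prefix by (auto simp: snoc_in_tree_vertices_iff stem_def)
    then show ?case using closed[of "ToBranch p i"] closure_mate_neutral[of "ToBranch p i"] by simp
  qed
  then show ?thesis using assms(1) by blast
qed

sublocale cmap "tree_vertices t" "half_edges t" origin "next_clockwise t" "closure_mate t" "vertex_sign t"
proof
  show "tree_vertices t \<noteq> {}" using Nil_in_tree_vertices by blast
qed (simp_all add: origin_in_tree_vertices closure_mate_in closure_mate_mate next_clockwise_bij
    next_clockwise_props next_clockwise_reach origin_closure_mate_sign tree_vertices_connected,
    simp add: vertex_sign_def)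

lemma phi_eq_face_step: "phi = face_step"
  by (simp add: fun_eq_iff phi_def face_step_def)

text \<open>Induction on the number of enclosing edges. The face of \<open>h\<close> contains a
  closing stem and is entered across its new edge, from the opening stem, which has one enclosing
  edge less.\<close>

lemma dual_reach_all:
  assumes "h \<in> half_edges t"
  shows "dual_reach phi (closure_mate t) {h \<in> half_edges t. h \<notin> {h \<in> half_edges t. \<not> stem t h} \<and> black h}
    {h \<in> half_edges t. enclosing t h = {}} h" (is "?R h")
  using assms
proof (induction "card (enclosing t h)" arbitrary: h rule: less_induct)
  case less
  show ?case
  proof (cases "enclosing t h = {}")
    case True
    then show ?thesis using less.prems by (intro dual_reach_base) simp
  next
    case False
    then obtain a' u' b' where "closure_edge t a' u' b'" "h \<in> insert b' (set u')"
      by (auto simp: enclosing_def)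
    then obtain b where b: "closing_stem t b" "orbit face_step h = orbit face_step b"
      using orbit_of_enclosed by blast
    obtain u a where ab: "closure_edge t a u b" using closure_edge_of_closing[OF b(1)] .
    note D = closure_edgeD[OF ab]
    have h: "h \<in> orbit face_step b"
      using bij_self_in_orbit[OF face_step_bij finite_half_edges less.prems] b(2) by simp
    have a: "a \<in> half_edges t" "b \<in> half_edges t" using D(6) by auto
    have "enclosing t h = insert a (enclosing t a)"
      using enclosing_orbit[OF h a(2)] enclosing_closure_edge(2)[OF ab] by simp
    then have "card (enclosing t a) < card (enclosing t h)"
      using enclosing_closure_edge(4)[OF ab] finite_enclosing by simp
    then have "?R a" using less.hyps a by simp
    moreover have "black a" using vertex_sign_stem(1)[OF coloured a(1) D(1)] .
    ultimately have "?R (closure_mate t a)"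
      using a D(1) by (intro dual_reach_cross) (auto simp: stem_def)
    then have "?R b" by (simp only: closure_mate_closure_edge(1)[OF ab])
    moreover obtain n where "h = (phi ^^ n) b"
      using h bij_orbit_iff[OF face_step_bij finite_half_edges a(2)] by (auto simp: phi_eq_face_step)
    moreover have "?R ((phi ^^ n) b)" if "?R b" for n
    proof (induction n)
      case (Suc n)
      then show ?case unfolding funpow.simps comp_apply by (rule dual_reach_face)
    qed (use that in \<open>simp only: funpow_0\<close>)
    ultimately show ?thesis by (simp only:)
  qed
qed

lemma tree_edges_optimal:
  assumes N: "int (tree_size t) < N" and y: "antisymmetric y"
    "\<And>p. p \<in> tree_vertices t \<Longrightarrow> p \<noteq> [] \<Longrightarrow> divergence y p = 1"
  shows "optimal {h \<in> half_edges t. enclosing t h = {}} (\<lambda>h. N * vertex_sign t (origin h) + y h)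
    {h \<in> half_edges t. \<not> stem t h}"
proof -
  define ls where "ls h = N * vertex_sign t (origin h) + y h" for h
  \<comment> \<open>The length of the dual path from the outer face that crosses exactly the
    enclosing edges.\<close>
  define D where "D h = (\<Sum>a \<in> enclosing t h. ls a)" for h
  \<comment> \<open>The rerouted flow: a difference of potentials has no divergence, so the supplies
    are those of \<open>ls\<close>, and \<open>D\<close> is chosen such that nothing is left on the
    new edges.\<close>
  define xs where "xs h = ls h + D h - D (closure_mate t h)" for h
  have D_phi: "D (phi h) = D h" if "h \<in> half_edges t" for h
    using enclosing_face_step[OF that] by (simp add: D_def phi_eq_face_step)
  have anti: "xs (closure_mate t h) = - xs h" if "h \<in> half_edges t" for h
    using that y(1) sg_mt[OF that] mt_mt[OF that] by (simp add: xs_def ls_def antisymmetric_def)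
  have zero: "xs h = 0" if h: "h \<in> half_edges t" "stem t h" for h
  proof -
    obtain a u b where ab: "closure_edge t a u b" "h = a \<or> h = b"
      using closure_edge_of_opening closure_edge_of_closing h(2) unfolding stem_def by metis
    have "D b = ls a + D a"
      using enclosing_closure_edge(2,4)[OF ab(1)] finite_enclosing by (simp add: D_def)
    then have "xs a = 0" using closure_mate_closure_edge[OF ab(1)] by (simp add: xs_def)
    moreover have "xs b = - xs a"
      using anti[of a] closure_mate_closure_edge[OF ab(1)] closure_edgeD(6)[OF ab(1)] by simp
    ultimately show ?thesis using ab(2) by auto
  qed
  have div: "(\<Sum>h | h \<in> half_edges t \<and> origin h = p. xs h) =
      N * vertex_sign t p * int (card {h \<in> half_edges t. origin h = p}) + 1"
    if p: "p \<in> tree_vertices t" "p \<noteq> []" for p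
  proof -
    have "(\<Sum>h | h \<in> half_edges t \<and> origin h = p. xs h) = divergence xs p"
      by (simp add: divergence_def)
    also have "\<dots> = divergence ls p"
      unfolding xs_def by (rule divergence_potential) (rule D_phi)
    also have "\<dots> = N * vertex_sign t p * int (card {h \<in> half_edges t. origin h = p}) + divergence y p"
      by (simp add: divergence_def ls_def sum.distrib)
    finally show ?thesis using y(2)[OF p] by simp
  qed
  have anti': "xs (tree_mate h) = - xs h" if "h \<in> half_edges t" "\<not> stem t h" for h
    using anti[OF that(1)] closure_mate_neutral[OF that] by simp
  have par: "0 < vertex_sign t p * xs (ToParent p)" if p: "p \<in> tree_vertices t" "p \<noteq> []" for p
  proof -
    let ?s = "subtree t p"
    have x: "xs (ToParent p) = N * (vertex_sign t p - charge ?s) + int (tree_size ?s)"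
      by (rule tree_flow[OF coloured]) (use anti' zero div p in auto)
    have size: "0 < tree_size ?s" "int (tree_size ?s) < N"
      using tree_size_pos tree_size_subtree[OF subtree_at_Some[OF p(1)]] N by auto
    \<comment> \<open>At a black vertex \<open>N * (1 - charge)\<close> may vanish and the size
      makes the flow positive. At a white vertex \<open>N * (1 + charge)\<close> is at least
      \<open>N\<close>, which outweighs the size.\<close>
    show ?thesis
    proof (cases "vertex_colour ?s")
      case Black
      then have "charge ?s \<le> 1" using wc p by (auto simp: well_charged_def)
      then have "0 \<le> N * (1 - charge ?s)" using size by (intro mult_nonneg_nonneg) auto
      then show ?thesis using x size Black by (simp add: vertex_sign_def)
    next
      case White
      then have "0 \<le> charge ?s" using wc p by (auto simp: well_charged_def)
      then have "N * 1 \<le> N * (1 + charge ?s)" using size by (intro mult_left_mono) auto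
      then show ?thesis using x size White by (simp add: vertex_sign_def algebra_simps)
    qed
  qed
  have pos: "0 < vertex_sign t (origin h) * xs h" if h: "h \<in> half_edges t" "\<not> stem t h" for h
  proof (cases h)
    case (ToParent p)
    then show ?thesis using par h by simp
  next
    case (ToBranch p i)
    then have q: "p @ [i] \<in> tree_vertices t" using h by simp
    have "xs h = - xs (ToParent (p @ [i]))" using anti'[OF h] ToBranch by simp
    then show ?thesis using par[OF q] vertex_sign_child[OF coloured q] ToBranch by simp
  qed
  have "0 \<le> ls h + D h - D (closure_mate t h) \<and>
      (h \<in> {h \<in> half_edges t. \<not> stem t h} \<longleftrightarrow> 0 < ls h + D h - D (closure_mate t h))"
    if "h \<in> half_edges t" "black h" for h
    using that pos[of h] zero[of h] by (cases "stem t h") (auto simp: xs_def)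
  moreover have "D h = 0" if "enclosing t h = {}" for h using that by (simp add: D_def)
  ultimately show ?thesis
    unfolding optimal_def ls_def[symmetric]
    using D_phi dual_reach_all closure_mate_in closure_mate_stem by (intro conjI exI[of _ D]) auto
qed

end

section \<open>A spanning tree from shortest dual paths\<close>

lemma walk_same_orbit:
  assumes "walk f w" "set w \<subseteq> A" "bij_betw f A A" "finite A" "x \<in> set w" "y \<in> set w"
  shows "orbit f x = orbit f y"
proof -
  have "orbit f x = orbit f (hd w)" if "x \<in> set w" for x
    using assms(1,2) that
  proof (induction w rule: induct_list012)
    case (3 a b w)
    have "orbit f b = orbit f a" using 3 bij_orbit_step[OF assms(3,4), of a] by simp
    then show ?case using 3 by auto
  qed auto
  then show ?thesis using assms(5,6) by metis
qed

text \<open>What the construction takes from the distance: \<open>D\<close> is constant on faces,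
  and every face but \<open>F\<close> contains the white half of an edge across which a shortest
  path arrives from a face with smaller \<open>D\<close>. The genus is arbitrary.\<close>

locale shortest_dual_paths = cmap +
  fixes F :: "'b set" and ls D :: "'b \<Rightarrow> int"
  assumes F_face: "F \<in> orbit phi ` H"
    and ls_pos: "h \<in> H \<Longrightarrow> sg (tl h) = 1 \<Longrightarrow> 0 < ls h"
    and D_phi: "h \<in> H \<Longrightarrow> D (phi h) = D h"
    and D_tight: "h \<in> H - F \<Longrightarrow> \<exists>h' \<in> orbit phi h. sg (tl h') \<noteq> 1 \<and> ls (mt h') + D (mt h') - D h' = 0"
begin

abbreviation face_set :: "'b set set" where "face_set \<equiv> orbit phi ` H"

text \<open>The last half-edge of a shortest dual path to the face \<open>g\<close>, seen from \<open>g\<close>.\<close>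

definition closer :: "'b set \<Rightarrow> 'b" where
  "closer g = (SOME h. h \<in> g \<and> \<not> black h \<and> ls (mt h) + D (mt h) - D h = 0)"

definition closers :: "'b set" where "closers = closer ` (face_set - {F})"
definition openers :: "'b set" where "openers = mt ` closers"
definition tree_part :: "'b set" where "tree_part = H - closers - openers"
text \<open>The contour step of the future tree, described inside the map: half-edges off
  \<open>tree_part\<close> are treated as stems. It is the counterpart of
  \<open>tour\<close>.\<close>

definition tau :: "'b \<Rightarrow> 'b" where "tau h = (if h \<in> tree_part then phi h else rt h)"

lemmas phi_self = bij_self_in_orbit[OF phi_bij finite_H]
lemmas phi_orbit_subset = bij_orbit_subset[OF phi_bij finite_H]
lemmas phi_orbit_eq = bij_orbit_eq[OF phi_bij finite_H]

lemma face_set_eq: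
  assumes "g \<in> face_set" "h \<in> g"
  shows "h \<in> H" "orbit phi h = g"
proof -
  obtain k where k: "k \<in> H" "g = orbit phi k" using assms(1) by blast
  show "h \<in> H" using assms(2) k phi_orbit_subset by blast
  show "orbit phi h = g" using phi_orbit_eq[OF k(1)] assms(2) k(2) by simp
qed

lemma F_subset: "F \<subseteq> H" and F_nonempty: "F \<noteq> {}"
proof -
  obtain k where k: "k \<in> H" "F = orbit phi k" using F_face by blast
  show "F \<subseteq> H" using k phi_orbit_subset by blast
  show "F \<noteq> {}" using k phi_self by blast
qed

lemma closer_props:
  assumes "g \<in> face_set - {F}"
  shows "closer g \<in> g" "closer g \<in> H" "\<not> black (closer g)" "black (mt (closer g))"
    "D (closer g) = D (mt (closer g)) + ls (mt (closer g))" "orbit phi (closer g) = g" "g \<inter> F = {}"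
proof -
  obtain k where k: "k \<in> H" "g = orbit phi k" using assms by blast
  show disj: "g \<inter> F = {}"
  proof (rule ccontr)
    assume "g \<inter> F \<noteq> {}"
    then obtain x where "x \<in> g" "x \<in> F" by blast
    then have "g = F" using face_set_eq(2)[of g x] face_set_eq(2)[OF F_face, of x] assms by simp
    then show False using assms by simp
  qed
  have "k \<in> H - F" using k disj phi_self by blast
  then have "\<exists>h. h \<in> g \<and> \<not> black h \<and> ls (mt h) + D (mt h) - D h = 0"
    using D_tight[of k] k(2) by blast
  from someI_ex[OF this]
  have c: "closer g \<in> g \<and> \<not> black (closer g) \<and> ls (mt (closer g)) + D (mt (closer g)) - D (closer g) = 0"
    unfolding closer_def .
  then show "closer g \<in> g" "\<not> black (closer g)"
    "D (closer g) = D (mt (closer g)) + ls (mt (closer g))" by auto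
  show "closer g \<in> H" "orbit phi (closer g) = g" using face_set_eq[of g "closer g"] c assms by auto
  then show "black (mt (closer g))" using sg_mt[of "closer g"] sg_h[of "closer g"] c by auto
qed

lemma closersE:
  assumes "h \<in> closers"
  obtains g where "g \<in> face_set - {F}" "h = closer g"
  using assms by (auto simp: closers_def)

lemma closer_unique:
  assumes "h \<in> closers" "g \<in> face_set" "h \<in> g"
  shows "g \<noteq> F \<and> h = closer g"
proof -
  obtain g' where g': "g' \<in> face_set - {F}" "h = closer g'" using closersE[OF assms(1)] .
  then have "g' = g" using closer_props(6)[OF g'(1)] face_set_eq(2)[OF assms(2,3)] by simp
  then show ?thesis using g' by simp
qed

lemma closers_props:
  assumes "h \<in> closers"
  shows "h \<in> H" "\<not> black h" "h \<notin> F"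
proof -
  obtain g where g: "g \<in> face_set - {F}" "h = closer g" using closersE[OF assms] .
  note c = closer_props[OF g(1)]
  show "h \<in> H" "\<not> black h" using c(2,3) g(2) by simp_all
  show "h \<notin> F" using c(1,7) g(2) by auto
qed

lemma openers_props:
  assumes "h \<in> openers"
  shows "h \<in> H" "black h"
proof -
  obtain k where k: "k \<in> closers" "h = mt k" using assms by (auto simp: openers_def)
  obtain g where g: "g \<in> face_set - {F}" "k = closer g" using closersE[OF k(1)] .
  show "h \<in> H" using closers_props(1)[OF k(1)] mt_in k(2) by simp
  show "black h" using closer_props(4)[OF g(1)] g(2) k(2) by simp
qed

lemma mt_openers: "h \<in> openers \<Longrightarrow> mt h \<in> closers"
  using closers_props mt_mt by (auto simp: openers_def)

lemma mt_closers: "h \<in> closers \<Longrightarrow> mt h \<in> openers"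
  by (auto simp: openers_def)

lemma tree_part_subset: "tree_part \<subseteq> H"
  by (auto simp: tree_part_def)

lemma mt_tree_part: "h \<in> tree_part \<Longrightarrow> mt h \<in> tree_part"
  using mt_in mt_mt mt_openers mt_closers by (metis Diff_iff tree_part_def)

lemma tau_openers: "h \<in> openers \<Longrightarrow> tau h = phi (mt h)"
  using openers_props by (auto simp: tau_def tree_part_def phi_mt)

lemma tau_closers: "h \<in> closers \<Longrightarrow> tau h = phi (mt h)"
  using closers_props by (auto simp: tau_def tree_part_def phi_mt)

lemma tau_bij: "bij_betw tau H H"
proof -
  \<comment> \<open>\<open>tau\<close> is \<open>rt\<close> after the involution that acts as
    \<open>mt\<close> on the tree part only.\<close>
  define m where "m h = (if h \<in> tree_part then mt h else h)" for h
  have "bij_betw m H H"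
    by (rule bij_betwI[where g = m]) (auto simp: m_def mt_in mt_mt mt_tree_part dest: mt_tree_part)
  from bij_betw_trans[OF this rt_bij] show ?thesis
    by (rule bij_betw_cong[THEN iffD1, rotated]) (simp add: tau_def m_def phi_def)
qed

section \<open>The contour of the complement of the dual tree\<close>

abbreviation nested :: "'b list \<Rightarrow> bool" where
  "nested \<equiv> wbal (\<lambda>h. h \<in> openers) (\<lambda>h. h \<in> closers)"

text \<open>After the opener that leads into \<open>g\<close>, the contour runs along the boundary
  of \<open>g\<close> up to its closer. At every other opener on the way it makes an excursion into
  the face behind, which is farther from \<open>F\<close>, and returns to the next half-edge of
  \<open>g\<close>. So the excursions nest like parentheses, and none of them meets
  \<open>F\<close>.\<close>

lemma closer_walk:
  assumes "g \<in> face_set - {F}"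
  shows "\<exists>u. nested u \<and> walk tau (mt (closer g) # u @ [closer g]) \<and>
    g \<subseteq> set (u @ [closer g]) \<and> set (u @ [closer g]) \<subseteq> H - F"
  using assms
\<comment> \<open>Induction starting with the farthest faces; the sum of absolute values merely
  bounds \<open>D\<close> from above.\<close>
proof (induction "nat ((\<Sum>h \<in> H. \<bar>D h\<bar>) - D (closer g))" arbitrary: g rule: less_induct)
  case less
  note c = closer_props[OF less.prems]
  let ?b = "closer g"
  have bound: "D h \<le> (\<Sum>h \<in> H. \<bar>D h\<bar>)" if "h \<in> H" for h
    using member_le_sum[of h H "\<lambda>h. \<bar>D h\<bar>"] finite_H that by simp
  \<comment> \<open>The length of the boundary of \<open>g\<close>.\<close>
  define n where "n = (LEAST n. 0 < n \<and> (phi ^^ n) ?b = ?b)"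
  have "\<exists>n. 0 < n \<and> (phi ^^ n) ?b = ?b"
    using phi_self[OF c(2)] by (auto simp: orbit_altdef)
  then have n: "0 < n" "(phi ^^ n) ?b = ?b" unfolding n_def by (metis (mono_tags, lifting) LeastI_ex)+
  have min: "(phi ^^ k) ?b \<noteq> ?b" if "0 < k" "k < n" for k
    using not_less_Least[of k "\<lambda>n. 0 < n \<and> (phi ^^ n) ?b = ?b"] that by (auto simp: n_def)
  have g_eq: "g = {(phi ^^ m) ?b | m. m < n}"
    using orbit_altdef_bounded[OF n(2,1)] c(6) by simp
  have in_g: "(phi ^^ k) ?b \<in> g" for k
    using bij_orbit_iff[OF phi_bij finite_H c(2)] c(6) by auto
  \<comment> \<open>The boundary is read backwards from index \<open>n\<close>, where it has closed
    up. The last index is 1, since index 0 is the closer itself, which ends the word.\<close>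
  have "\<exists>w. nested w \<and> walk tau (w @ [?b]) \<and> hd (w @ [?b]) = (phi ^^ i) ?b \<and>
      {(phi ^^ j) ?b | j. i \<le> j \<and> j \<le> n} \<subseteq> set (w @ [?b]) \<and> set (w @ [?b]) \<subseteq> H - F"
    if "i \<le> n" "1 \<le> i" for i
    using that
  proof (induction i rule: inc_induct)
    case base
    have "{(phi ^^ j) ?b | j. n \<le> j \<and> j \<le> n} = {?b}" using n(2) by (auto intro!: exI[of _ n])
    then show ?case using c(1,2,7) n(2) by (intro exI[of _ "[]"]) (auto intro: wbal_Nil)
  next
    case (step k)
    then obtain w where w: "nested w" "walk tau (w @ [?b])" "hd (w @ [?b]) = (phi ^^ Suc k) ?b"
      "{(phi ^^ j) ?b | j. Suc k \<le> j \<and> j \<le> n} \<subseteq> set (w @ [?b])" "set (w @ [?b]) \<subseteq> H - F"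
      by auto
    let ?h = "(phi ^^ k) ?b"
    have h: "?h \<in> g" "?h \<noteq> ?b" "?h \<in> H" "?h \<in> H - F"
      using in_g[of k] min[of k] step c(7) face_set_eq(1)[of g ?h] less.prems by auto
    have next_h: "hd (w @ [?b]) = phi ?h" using w(3) by simp
    have range: "{(phi ^^ j) ?b | j. k \<le> j \<and> j \<le> n} \<subseteq> insert ?h {(phi ^^ j) ?b | j. Suc k \<le> j \<and> j \<le> n}"
      by (auto simp: Suc_le_eq) (metis le_neq_implies_less)
    have cov: "{(phi ^^ j) ?b | j. k \<le> j \<and> j \<le> n} \<subseteq> insert ?h (set (w @ [?b]))"
      by (rule subset_trans[OF range insert_mono[OF w(4)]])
    have nc: "?h \<notin> closers" using closer_unique[of ?h g] h less.prems by auto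
    show ?case
    proof (cases "?h \<in> openers")
      case False
      then have "?h \<in> tree_part" using nc h(3) by (simp add: tree_part_def)
      then have "walk tau (?h # (w @ [?b]))" using w(2) next_h by (intro walk_Cons) (auto simp: tau_def)
      moreover have "nested (?h # w)" using w(1) nc False by (intro wbal_skip) auto
      moreover have "{(phi ^^ j) ?b | j. k \<le> j \<and> j \<le> n} \<subseteq> set ((?h # w) @ [?b])"
        by (rule subset_trans[OF cov]) auto
      moreover have "set ((?h # w) @ [?b]) \<subseteq> H - F" using w(5) h(4) by auto
      ultimately show ?thesis by (intro exI[of _ "?h # w"] conjI) simp_all
    next
      case True
      then obtain g' where g': "g' \<in> face_set - {F}" "mt ?h = closer g'" using mt_openers closersE by metis
      note c' = closer_props[OF g'(1)]
      have mt: "mt (closer g') = ?h" using mt_mt[OF h(3)] g'(2) by simp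
      have "D ?h = D ?b" using orbit_invariant[of ?h phi ?b H D] h(1) c phi_in D_phi by simp
      \<comment> \<open>The crossing into \<open>g'\<close> is tight and has positive length, so
        \<open>g'\<close> is farther and covered by the induction hypothesis.\<close>
      then have "D ?b < D (closer g')"
        using c'(5) ls_pos[of ?h] c'(4) mt h(3) by simp
      then obtain u where u: "nested u" "walk tau (?h # u @ [closer g'])" "set (u @ [closer g']) \<subseteq> H - F"
        using less.hyps[of g'] bound[OF c'(2)] g'(1) mt by auto
      have cl: "closer g' \<in> closers" using g'(1) by (auto simp: closers_def)
      have "tau (closer g') = phi ?h" using tau_closers[OF cl] mt by simp
      then have "walk tau ((?h # u @ [closer g']) @ (w @ [?b]))"
        using next_h by (intro walk_append[OF u(2) w(2)]) simp_all
      moreover have "nested (?h # u @ closer g' # w)" using True cl u(1) w(1) by (intro wbal_pair) auto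
      moreover have "{(phi ^^ j) ?b | j. k \<le> j \<and> j \<le> n} \<subseteq> set ((?h # u @ closer g' # w) @ [?b])"
        by (rule subset_trans[OF cov]) auto
      moreover have "set ((?h # u @ closer g' # w) @ [?b]) \<subseteq> H - F" using w(5) u(3) h(4) by auto
      ultimately show ?thesis by (intro exI[of _ "?h # u @ closer g' # w"] conjI) simp_all
    qed
  qed
  from this[of 1] n(1) obtain w where w: "nested w" "walk tau (w @ [?b])" "hd (w @ [?b]) = phi ?b"
    "{(phi ^^ j) ?b | j. 1 \<le> j \<and> j \<le> n} \<subseteq> set (w @ [?b])" "set (w @ [?b]) \<subseteq> H - F" by auto
  have "closer g \<in> closers" using less.prems by (auto simp: closers_def)
  then have "tau (mt ?b) = phi ?b" using tau_openers mt_closers mt_mt c(2) by simp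
  then have "walk tau (mt ?b # (w @ [?b]))" using w(2,3) by (intro walk_Cons) auto
  moreover have "g \<subseteq> set (w @ [?b])"
  proof
    fix x assume "x \<in> g"
    then obtain m where m: "m < n" "x = (phi ^^ m) ?b" using g_eq by blast
    show "x \<in> set (w @ [?b])"
    proof (cases m)
      case (Suc l)
      then have "x \<in> {(phi ^^ j) ?b | j. 1 \<le> j \<and> j \<le> n}" using m by fastforce
      then show ?thesis using w(4) by blast
    qed (use m in simp)
  qed
  ultimately show ?case using w(1,5) by auto
qed

text \<open>The tree part has a single contour. By \<open>closer_walk\<close>, a face other than
  \<open>F\<close> lies in the orbit of the opener leading into it, and that opener is in a face
  nearer to \<open>F\<close>. Within \<open>F\<close>, a step of \<open>phi\<close> is a step of
  \<open>tau\<close> or, at an opener, the net effect of an excursion.\<close>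

lemma tau_transitive:
  assumes "h \<in> H"
  shows "orbit tau h = H"
proof -
  note eq = walk_same_orbit[OF _ _ tau_bij finite_H] and step = bij_orbit_step[OF tau_bij finite_H]
  obtain h1 where h1: "h1 \<in> H" "F = orbit phi h1" using F_face by blast
  have jump: "orbit tau (mt (closer g)) = orbit tau x"
    if g: "g \<in> face_set - {F}" and x: "x \<in> insert (closer g) g" for g x
  proof -
    obtain u where u: "walk tau (mt (closer g) # u @ [closer g])" "g \<subseteq> set (u @ [closer g])"
      "set (u @ [closer g]) \<subseteq> H - F" using closer_walk[OF g] by blast
    show ?thesis by (rule eq[OF u(1)]) (use u x closer_props(2)[OF g] mt_in in auto)
  qed
  have F: "orbit tau h = orbit tau h1" if "h \<in> F" for h
  proof (rule orbit_invariant[of h phi h1 F "orbit tau"])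
    show "h \<in> orbit phi h1" using that h1 by simp
    show "h1 \<in> F" using phi_self h1 by simp
    show "phi x \<in> F" if "x \<in> F" for x using that h1 orbit.step by simp
    show "orbit tau (phi x) = orbit tau x" if x: "x \<in> F" for x
    proof -
      have xH: "x \<in> H" using x F_subset by blast
      have nc: "x \<notin> closers" using x closers_props by blast
      show ?thesis
      proof (cases "x \<in> openers")
        case True
        then obtain g where g: "g \<in> face_set - {F}" "mt x = closer g" using mt_openers closersE by metis
        then have m: "mt (closer g) = x" using mt_mt[OF xH] by simp
        have "closer g \<in> closers" using g by (auto simp: closers_def)
        then have "tau (closer g) = phi x" using tau_closers m by simp
        then have "orbit tau (phi x) = orbit tau (closer g)" using step closer_props(2)[OF g(1)] by metis
        also have "\<dots> = orbit tau x" using jump[OF g(1), of "closer g"] m by simp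
        finally show ?thesis .
      next
        case False
        then have "tau x = phi x" using nc xH by (simp add: tau_def tree_part_def)
        then show ?thesis using step[OF xH] by simp
      qed
    qed
  qed
  have "h \<in> H \<Longrightarrow> orbit tau h = orbit tau h1" for h
  proof (induction "nat (D h + (\<Sum>h \<in> H. \<bar>D h\<bar>))" arbitrary: h rule: less_induct)
    case less
    show ?case
    proof (cases "h \<in> F")
      case False
      let ?g = "orbit phi h"
      have g: "?g \<in> face_set - {F}" "h \<in> ?g" using False less.prems phi_self by auto
      note c = closer_props[OF g(1)]
      have m: "mt (closer ?g) \<in> H" using c(2) mt_in by blast
      have "D (closer ?g) = D h" using orbit_invariant[of "closer ?g" phi h H D] c(1) less.prems phi_in D_phi by simp
      then have lt: "D (mt (closer ?g)) < D h" using c(5) ls_pos[OF m c(4)] by simp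
      have "\<bar>D k\<bar> \<le> (\<Sum>h \<in> H. \<bar>D h\<bar>)" if "k \<in> H" for k
        using member_le_sum[of k H "\<lambda>h. \<bar>D h\<bar>"] finite_H that by simp
      from this[OF m] have "orbit tau (mt (closer ?g)) = orbit tau h1"
        using lt by (intro less.hyps m) linarith
      then show ?thesis using jump[OF g(1), of h] g(2) by simp
    qed (rule F)
  qed
  then have "orbit tau h = orbit tau k" if "h \<in> H" "k \<in> H" for h k using that by metis
  then show ?thesis
    using assms bij_self_in_orbit[OF tau_bij finite_H] bij_orbit_subset[OF tau_bij finite_H assms] by blast
qed

text \<open>A repeated half-edge would close a cycle of \<open>tau\<close> within \<open>u\<close>.
  By transitivity this cycle is all of \<open>H\<close> and would meet \<open>F\<close>.\<close>

lemma closer_walk_distinct: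
  assumes "walk tau (a # u)" "a \<in> H" "set u \<subseteq> H - F"
  shows "distinct (a # u)"
proof (rule ccontr)
  let ?w = "a # u"
  assume "\<not> distinct ?w"
  then obtain i j where ij: "i < j" "j < length ?w" "?w ! i = ?w ! j"
    unfolding distinct_conv_nth by (metis linorder_neqE_nat)
  let ?x = "?w ! i"
  have pow: "(tau ^^ m) ?x = ?w ! (i + m)" if "i + m < length ?w" for m
    using walk_funpow[OF assms(1)] ij that by (simp add: funpow_add add.commute[of i])
  have "?x \<in> set ?w" by (rule nth_mem) (use ij in simp)
  then have x: "?x \<in> H" using assms(2,3) by auto
  have "(tau ^^ (j - i)) ?x = ?x" "0 < j - i" using pow[of "j - i"] ij by simp_all
  then have "orbit tau ?x = {(tau ^^ m) ?x | m. m < j - i}" by (rule orbit_altdef_bounded)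
  then have H: "H = {(tau ^^ m) ?x | m. m < j - i}" using tau_transitive[OF x] by simp
  have "(tau ^^ m) ?x \<in> set u" if "m < j - i" for m
  proof (cases "i + m")
    case 0
    then have "(tau ^^ m) ?x = ?w ! j" using ij by simp
    then show ?thesis using ij by (cases j) auto
  next
    case (Suc k)
    have "i + m < length ?w" using that ij by simp
    then show ?thesis using pow[of m] Suc by simp
  qed
  moreover have "\<exists>m. m < j - i \<and> y = (tau ^^ m) ?x" if "y \<in> H" for y
    using that by (subst (asm) H) blast
  ultimately have "H \<subseteq> set u" by blast
  then show False using assms(3) F_subset F_nonempty by blast
qed

text \<open>\<open>tau\<close> leaves a vertex only across a half-edge of \<open>tree_part\<close>,
  and its single orbit visits all vertices.\<close>

lemma tree_part_connected:
  assumes "S \<subseteq> V" "S \<noteq> {}" "\<And>h. h \<in> tree_part \<Longrightarrow> tl h \<in> S \<Longrightarrow> tl (mt h) \<in> S"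
  shows "S = V"
proof -
  have "H \<noteq> {}" using F_face by blast
  then have "tl ` H = V" by (rule tl_image)
  then obtain h where h: "h \<in> H" "tl h \<in> S" using assms(1,2) by blast
  have "k \<in> H \<and> tl k \<in> S" if "k \<in> orbit tau h" for k
    using that
  proof induction
    case base
    then show ?case using h assms(3) tree_part_subset by (auto simp: tau_def phi_def rt_in mt_in tl_rt)
  next
    case (step k)
    then show ?case using assms(3) tree_part_subset by (auto simp: tau_def phi_def rt_in mt_in tl_rt)
  qed
  then have "tl ` H \<subseteq> S" using tau_transitive[OF h(1)] by blast
  then show ?thesis using \<open>tl ` H = V\<close> assms(1) by blast
qed

text \<open>Each face other than \<open>F\<close> has one closer and one opener leading into it;
  Euler's relation turns the number of faces into the number of vertices.\<close>

lemma card_tree_part: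
  assumes "2 * (card V + card face_set) = card H + 4"
  shows "card tree_part = 2 * (card V - 1)"
proof -
  have fin: "finite face_set" using finite_H by simp
  have "inj_on closer (face_set - {F})"
    by (rule inj_onI) (metis closer_props(6))
  then have C: "card closers = card face_set - 1" "finite closers"
    using fin F_face by (simp_all add: closers_def card_image)
  have "inj_on mt closers" using mt_bij closers_props by (auto simp: bij_betw_def inj_on_def)
  then have O: "card openers = card closers" "finite openers"
    using C(2) by (simp_all add: openers_def card_image)
  have "closers \<inter> openers = {}" using closers_props openers_props by blast
  then have "card (closers \<union> openers) = 2 * (card face_set - 1)" using C O by (simp add: card_Un_disjoint)
  moreover have "closers \<union> openers \<subseteq> H" using closers_props openers_props by blast
  moreover have "tree_part = H - (closers \<union> openers)" by (auto simp: tree_part_def)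
  ultimately have "card tree_part = card H - 2 * (card face_set - 1)"
    using C O by (simp add: card_Diff_subset)
  moreover have "card face_set \<noteq> 0" using fin F_face by auto
  ultimately show ?thesis using assms by simp
qed

end

section \<open>The blossoming tree of a spanning tree\<close>

lemma cyclic_list_of_orbit:
  assumes "bij_betw f A A" "finite A" "x \<in> A"
  shows "\<exists>L. cyclic_list f L \<and> L \<noteq> [] \<and> hd L = x \<and> set L = orbit f x"
proof -
  let ?n = "funpow_dist1 f x x" and ?L = "map (\<lambda>i. (f ^^ i) x) [0..<funpow_dist1 f x x]"
  have self: "x \<in> orbit f x" using bij_self_in_orbit[OF assms] .
  have "distinct ?L" using inj_on_funpow_dist1[OF self] by (simp add: distinct_map del: upt_Suc)
  moreover have "walk f (?L @ [hd ?L])"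
  proof (rule walkI)
    fix i assume "Suc i < length (?L @ [hd ?L])"
    then consider "Suc i < ?n" | "Suc i = ?n" by fastforce
    then show "(?L @ [hd ?L]) ! Suc i = f ((?L @ [hd ?L]) ! i)"
    proof cases
      case 2
      then have "(f ^^ Suc i) x = x" using funpow_dist1_prop[OF self] by simp
      then show ?thesis using 2 by (simp add: nth_append hd_map del: upt_Suc)
    qed (simp add: nth_append del: upt_Suc)
  qed
  ultimately have "cyclic_list f ?L" by (rule cyclic_listI)
  moreover have "set ?L = orbit f x" using orbit_conv_funpow_dist1[OF self] by (simp del: upt_Suc)
  moreover have "hd ?L = x" by (simp add: hd_map del: upt_Suc)
  ultimately show ?thesis by (intro exI[of _ ?L]) simp
qed

text \<open>A spanning tree is given by connectedness and its number of half-edges; acyclicity is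
  recovered by counting in \<open>X_eq\<close>.\<close>

locale spanning_tree = cmap +
  fixes X :: "'b set" and h0 :: 'b
  assumes X_subset: "X \<subseteq> H" and mt_X: "h \<in> X \<Longrightarrow> mt h \<in> X"
    and X_connected: "S \<subseteq> V \<Longrightarrow> S \<noteq> {} \<Longrightarrow> (\<And>h. h \<in> X \<Longrightarrow> tl h \<in> S \<Longrightarrow> tl (mt h) \<in> S) \<Longrightarrow> S = V"
    and card_X: "card X = 2 * (card V - 1)"
    and h0: "h0 \<in> H"
begin

definition root :: 'a where "root = tl h0"

lemma root_in: "root \<in> V" using h0 tl_in by (simp add: root_def)

definition adj :: "('a \<times> 'a) set" where "adj = {(tl h, tl (mt h)) | h. h \<in> X}"

definition depth :: "'a \<Rightarrow> nat" where "depth v = (LEAST n. (root, v) \<in> adj ^^ n)"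

lemma depth_path:
  assumes "v \<in> V"
  shows "(root, v) \<in> adj ^^ depth v"
proof -
  have "{v \<in> V. \<exists>n. (root, v) \<in> adj ^^ n} = V"
  proof (rule X_connected)
    have "(root, root) \<in> adj ^^ 0" by simp
    then show "{v \<in> V. \<exists>n. (root, v) \<in> adj ^^ n} \<noteq> {}" using root_in by blast
    fix h assume h: "h \<in> X" "tl h \<in> {v \<in> V. \<exists>n. (root, v) \<in> adj ^^ n}"
    then obtain n where "(root, tl h) \<in> adj ^^ n" by blast
    moreover have "(tl h, tl (mt h)) \<in> adj" using h(1) by (auto simp: adj_def)
    ultimately have "(root, tl (mt h)) \<in> adj ^^ Suc n" by auto
    then show "tl (mt h) \<in> {v \<in> V. \<exists>n. (root, v) \<in> adj ^^ n}"
      using h(1) X_subset mt_in tl_in by blast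
  qed auto
  then have "\<exists>n. (root, v) \<in> adj ^^ n" using assms by blast
  then show ?thesis unfolding depth_def by (rule LeastI_ex)
qed

lemma depth_le: "(root, v) \<in> adj ^^ n \<Longrightarrow> depth v \<le> n"
  unfolding depth_def by (rule Least_le)

lemma depth_adj: "h \<in> X \<Longrightarrow> depth (tl (mt h)) \<le> Suc (depth (tl h))"
proof -
  assume h: "h \<in> X"
  then have "(root, tl h) \<in> adj ^^ depth (tl h)" using depth_path X_subset tl_in by blast
  moreover have "(tl h, tl (mt h)) \<in> adj" using h by (auto simp: adj_def)
  ultimately show ?thesis by (intro depth_le) auto
qed

text \<open>Chosen among the half-edges towards the root, as their uniqueness is not yet
  known.\<close>

definition parent :: "'a \<Rightarrow> 'b" where
  "parent v = (SOME k. k \<in> X \<and> tl k = v \<and> depth (tl (mt k)) < depth v)"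

lemma parent_props:
  assumes "v \<in> V" "v \<noteq> root"
  shows "parent v \<in> X" "tl (parent v) = v" "depth v = Suc (depth (tl (mt (parent v))))"
proof -
  have "depth v \<noteq> 0" using depth_path[OF assms(1)] assms(2) by (metis relpow_0_E)
  then obtain n where n: "depth v = Suc n" by (cases "depth v") auto
  then have "(root, v) \<in> adj ^^ Suc n" using depth_path[OF assms(1)] by metis
  then obtain u where u: "(root, u) \<in> adj ^^ n" "(u, v) \<in> adj" by auto
  then obtain h where h: "h \<in> X" "tl h = u" "tl (mt h) = v" by (auto simp: adj_def)
  have "mt h \<in> X \<and> tl (mt h) = v \<and> depth (tl (mt (mt h))) < depth v"
    using h mt_X mt_mt X_subset depth_le[OF u(1)] n by auto
  from someI[of "\<lambda>k. k \<in> X \<and> tl k = v \<and> depth (tl (mt k)) < depth v", OF this]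
  have p: "parent v \<in> X \<and> tl (parent v) = v \<and> depth (tl (mt (parent v))) < depth v"
    unfolding parent_def .
  then show "parent v \<in> X" "tl (parent v) = v" by auto
  have "depth v \<le> Suc (depth (tl (mt (parent v))))"
    using depth_adj[OF mt_X, of "parent v"] p mt_mt X_subset by auto
  then show "depth v = Suc (depth (tl (mt (parent v))))" using p by simp
qed

definition child_edges :: "'b set" where "child_edges = mt ` parent ` (V - {root})"

lemma parent_not_child_edge:
  assumes "v \<in> V" "v \<noteq> root"
  shows "parent v \<notin> child_edges"
proof
  assume "parent v \<in> child_edges"
  then obtain w where w: "w \<in> V" "w \<noteq> root" "parent v = mt (parent w)" by (auto simp: child_edges_def)
  note pv = parent_props[OF assms] and pw = parent_props[OF w(1,2)]
  have "mt (parent v) = parent w" using w(3) mt_mt pw(1) X_subset by auto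
  then show False using w(3) pv pw by simp
qed

lemma child_edgesD:
  assumes "h \<in> child_edges"
  shows "h \<in> X" "tl (mt h) \<in> V" "tl (mt h) \<noteq> root" "parent (tl (mt h)) = mt h"
    "depth (tl (mt h)) = Suc (depth (tl h))"
proof -
  obtain w where w: "w \<in> V" "w \<noteq> root" "h = mt (parent w)" using assms by (auto simp: child_edges_def)
  note p = parent_props[OF w(1,2)]
  have m: "mt h = parent w" using w(3) mt_mt p(1) X_subset by auto
  show "h \<in> X" using w(3) p(1) mt_X by simp
  show "tl (mt h) \<in> V" "tl (mt h) \<noteq> root" "parent (tl (mt h)) = mt h" using m p w by simp_all
  show "depth (tl (mt h)) = Suc (depth (tl h))" using m p w(3) by simp
qed

text \<open>The half-edges to parents and their mates already number
  \<open>2 * (card V - 1)\<close>, so \<open>X\<close> contains nothing else. This replaces an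
  argument about cycles.\<close>

lemma X_eq: "X = parent ` (V - {root}) \<union> child_edges"
proof -
  let ?P = "parent ` (V - {root})"
  have inj: "inj_on parent (V - {root})" by (rule inj_onI) (metis DiffE insertI1 parent_props(2))
  have P: "?P \<subseteq> X" using parent_props(1) by auto
  have "inj_on mt H" using mt_bij by (simp add: bij_betw_def)
  then have "inj_on mt ?P" by (rule inj_on_subset) (use P X_subset in blast)
  then have "card child_edges = card V - 1"
    using inj root_in finite_V by (simp add: child_edges_def card_image)
  moreover have "card ?P = card V - 1" using inj root_in finite_V by (simp add: card_image)
  moreover have "?P \<inter> child_edges = {}" using parent_not_child_edge by auto
  ultimately have "card (?P \<union> child_edges) = card X"
    using finite_V card_X by (subst card_Un_disjoint) (auto simp: child_edges_def)
  moreover have "?P \<union> child_edges \<subseteq> X" using P child_edgesD(1) by blast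
  moreover have "finite X" using X_subset finite_H finite_subset by blast
  ultimately show ?thesis using card_subset_eq by metis
qed

section \<open>Unfolding the spanning tree into a blossoming tree\<close>

definition start :: "'a \<Rightarrow> 'b" where "start v = (if v = root then h0 else parent v)"

text \<open>This order suits both conventions for branch lists: it starts at the root corner for the
  root, and at the parent edge, which \<open>outgoing\<close> removes, for any other vertex.\<close>

definition around :: "'a \<Rightarrow> 'b list" where
  "around v = (SOME L. cyclic_list rt L \<and> L \<noteq> [] \<and> hd L = start v \<and> set L = {h \<in> H. tl h = v})"

lemma around_props:
  assumes "v \<in> V"
  shows "cyclic_list rt (around v)" "around v \<noteq> []" "hd (around v) = start v"
    "set (around v) = {h \<in> H. tl h = v}"
proof -
  have s: "start v \<in> H" "tl (start v) = v"
    using parent_props assms h0 X_subset by (auto simp: start_def root_def)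
  have "orbit rt (start v) = {h \<in> H. tl h = v}"
  proof
    have "h \<in> H \<and> tl h = v" if "h \<in> orbit rt (start v)" for h
      using that by induction (auto simp: s rt_in tl_rt)
    then show "orbit rt (start v) \<subseteq> {h \<in> H. tl h = v}" by blast
    show "{h \<in> H. tl h = v} \<subseteq> orbit rt (start v)"
      using bij_orbit_iff[OF rt_bij finite_H s(1)] rt_trans[OF s(1)] s(2) by auto
  qed
  then have "\<exists>L. cyclic_list rt L \<and> L \<noteq> [] \<and> hd L = start v \<and> set L = {h \<in> H. tl h = v}"
    using cyclic_list_of_orbit[OF rt_bij finite_H s(1)] by simp
  from someI_ex[OF this] show "cyclic_list rt (around v)" "around v \<noteq> []" "hd (around v) = start v"
    "set (around v) = {h \<in> H. tl h = v}" unfolding around_def by blast+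
qed

definition outgoing :: "'a \<Rightarrow> 'b list" where
  "outgoing v = (if v = root then around v else drop 1 (around v))"

lemma around_outgoing: "v \<in> V \<Longrightarrow> around v = (if v = root then [] else [parent v]) @ outgoing v"
  using around_props(2,3)[of v] by (cases "around v") (auto simp: outgoing_def start_def)

lemma outgoing_props:
  assumes "v \<in> V"
  shows "distinct (outgoing v)" "set (outgoing v) \<subseteq> {h \<in> H. tl h = v}"
    "{h \<in> H. tl h = v} \<subseteq> set (outgoing v) \<union> (if v = root then {} else {parent v})"
    "v \<noteq> root \<Longrightarrow> parent v \<notin> set (outgoing v)"
  using around_props(1,4)[OF assms] around_outgoing[OF assms]
  by (auto simp: cyclic_list_def split: if_splits)

definition colour_at :: "'a \<Rightarrow> colour" where "colour_at v = (if sg v = 1 then Black else White)"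

primrec unfold_tree :: "nat \<Rightarrow> 'a \<Rightarrow> blossoming_tree" where
  "unfold_tree 0 v = Vertex (colour_at v) []"
| "unfold_tree (Suc k) v = Vertex (colour_at v) (map (\<lambda>h. if h \<in> child_edges then Edge (unfold_tree k (tl (mt h)))
     else if black h then Opening else Closing) (outgoing v))"

text \<open>The fuel counts the levels from \<open>v\<close> down to the deepest one. What is left
  for a child is then exactly its own fuel, so \<open>tree_from_eq\<close> can do without
  it.\<close>

definition tree_from :: "'a \<Rightarrow> blossoming_tree" where
  "tree_from v = unfold_tree (Suc (Max (depth ` V)) - depth v) v"

lemma tree_from_eq:
  assumes "v \<in> V"
  shows "tree_from v = Vertex (colour_at v) (map (\<lambda>h. if h \<in> child_edges then Edge (tree_from (tl (mt h)))
     else if black h then Opening else Closing) (outgoing v))"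
proof -
  let ?m = "Max (depth ` V)"
  have "depth v \<le> ?m" using assms finite_V by simp
  then have "Suc ?m - depth v = Suc (?m - depth v)" by simp
  moreover have "unfold_tree (?m - depth v) (tl (mt h)) = tree_from (tl (mt h))"
    if "h \<in> child_edges" "h \<in> set (outgoing v)" for h
    using child_edgesD(5)[OF that(1)] outgoing_props(2)[OF assms] that(2) by (auto simp: tree_from_def)
  ultimately show ?thesis by (simp add: tree_from_def[of v])
qed

definition tree :: blossoming_tree where "tree = tree_from root"

definition vertex_at :: "nat list \<Rightarrow> 'a" where
  "vertex_at p = foldl (\<lambda>v i. tl (mt (outgoing v ! i))) root p"

lemma subtree_at_tree_from:
  "v \<in> V \<Longrightarrow> subtree_at (tree_from v) p = Some s \<Longrightarrow>
    foldl (\<lambda>v i. tl (mt (outgoing v ! i))) v p \<in> V \<and>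
    s = tree_from (foldl (\<lambda>v i. tl (mt (outgoing v ! i))) v p)"
proof (induction p arbitrary: v)
  case (Cons i p)
  let ?h = "outgoing v ! i"
  have i: "i < length (outgoing v)" "?h \<in> child_edges" "subtree_at (tree_from (tl (mt ?h))) p = Some s"
    using Cons.prems(2) unfolding tree_from_eq[OF Cons.prems(1)]
    by (auto split: if_splits branch.splits)
  then show ?case using Cons.IH[OF child_edgesD(2)[OF i(2)] i(3)] by simp
qed simp

lemma vertex_at_props:
  assumes "p \<in> tree_vertices tree"
  shows "vertex_at p \<in> V" "subtree tree p = tree_from (vertex_at p)"
    "vertex_colour (subtree tree p) = colour_at (vertex_at p)"
    "length (branches (subtree tree p)) = length (outgoing (vertex_at p))"
    "i < length (outgoing (vertex_at p)) \<Longrightarrow> branches (subtree tree p) ! i =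
      (let h = outgoing (vertex_at p) ! i in if h \<in> child_edges then Edge (tree_from (tl (mt h)))
       else if black h then Opening else Closing)"
proof -
  show V: "vertex_at p \<in> V" and s: "subtree tree p = tree_from (vertex_at p)"
    using subtree_at_tree_from[OF root_in, of p "subtree tree p"] subtree_at_Some[OF assms]
    by (simp_all add: tree_def vertex_at_def)
  show "vertex_colour (subtree tree p) = colour_at (vertex_at p)"
    "length (branches (subtree tree p)) = length (outgoing (vertex_at p))"
    "i < length (outgoing (vertex_at p)) \<Longrightarrow> branches (subtree tree p) ! i =
      (let h = outgoing (vertex_at p) ! i in if h \<in> child_edges then Edge (tree_from (tl (mt h)))
       else if black h then Opening else Closing)"
    unfolding s tree_from_eq[OF V] by (simp_all add: Let_def)
qed

lemma vertex_at_Nil: "vertex_at [] = root"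
  by (simp add: vertex_at_def)

lemma vertex_at_snoc: "vertex_at (p @ [i]) = tl (mt (outgoing (vertex_at p) ! i))"
  by (simp add: vertex_at_def)

lemma snoc_in_tree_iff:
  assumes "p \<in> tree_vertices tree"
  shows "p @ [i] \<in> tree_vertices tree \<longleftrightarrow>
    i < length (outgoing (vertex_at p)) \<and> outgoing (vertex_at p) ! i \<in> child_edges"
  using vertex_at_props(4)[OF assms] vertex_at_props(5)[OF assms, of i] assms
  by (auto simp: snoc_in_tree_vertices_iff Let_def split: if_splits)

lemma vertex_at_child:
  assumes "p @ [i] \<in> tree_vertices tree"
  shows "vertex_at (p @ [i]) \<noteq> root" "parent (vertex_at (p @ [i])) = mt (outgoing (vertex_at p) ! i)"
    "mt (parent (vertex_at (p @ [i]))) = outgoing (vertex_at p) ! i"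
    "outgoing (vertex_at p) ! i \<in> child_edges" "i < length (outgoing (vertex_at p))"
proof -
  have p: "p \<in> tree_vertices tree" using assms tree_vertices_prefix by blast
  show i: "outgoing (vertex_at p) ! i \<in> child_edges" "i < length (outgoing (vertex_at p))"
    using snoc_in_tree_iff[OF p] assms by auto
  note c = child_edgesD[OF i(1)]
  show "vertex_at (p @ [i]) \<noteq> root" and *: "parent (vertex_at (p @ [i])) = mt (outgoing (vertex_at p) ! i)"
    using c by (simp_all add: vertex_at_snoc)
  show "mt (parent (vertex_at (p @ [i]))) = outgoing (vertex_at p) ! i"
    unfolding * using mt_mt c(1) X_subset by blast
qed

lemma vertex_at_eq_root: "p \<in> tree_vertices tree \<Longrightarrow> vertex_at p = root \<longleftrightarrow> p = []"
  using vertex_at_child(1) vertex_at_Nil by (cases p rule: rev_cases) auto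

lemma vertex_at_surj: "v \<in> V \<Longrightarrow> \<exists>p \<in> tree_vertices tree. vertex_at p = v"
proof (induction "depth v" arbitrary: v rule: less_induct)
  case less
  show ?case
  proof (cases "v = root")
    case False
    let ?h = "mt (parent v)"
    note p = parent_props[OF less.prems False]
    have h: "?h \<in> child_edges" using less.prems False by (auto simp: child_edges_def)
    have u: "tl ?h \<in> V" using p(1) X_subset mt_in tl_in by blast
    then obtain q where q: "q \<in> tree_vertices tree" "vertex_at q = tl ?h" using less.hyps p(3) by auto
    have "?h \<in> set (outgoing (tl ?h))"
      using outgoing_props(3)[OF u] h child_edgesD(1)[OF h] X_subset parent_not_child_edge[OF u]
      by (auto split: if_splits)
    then obtain i where i: "i < length (outgoing (tl ?h))" "outgoing (tl ?h) ! i = ?h"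
      by (auto simp: in_set_conv_nth)
    then have "q @ [i] \<in> tree_vertices tree" using snoc_in_tree_iff[OF q(1)] q(2) h by simp
    moreover have "vertex_at (q @ [i]) = v"
      using q(2) i(2) p(2) mt_mt[of "parent v"] p(1) X_subset by (auto simp: vertex_at_snoc)
    ultimately show ?thesis by blast
  qed (use vertex_at_Nil in auto)
qed

text \<open>The parent edge of the common vertex determines both the vertex before it and the
  position in the branch list of that vertex.\<close>

lemma vertex_at_inj:
  "p \<in> tree_vertices tree \<Longrightarrow> q \<in> tree_vertices tree \<Longrightarrow> vertex_at p = vertex_at q \<Longrightarrow> p = q"
proof (induction p arbitrary: q rule: rev_induct)
  case Nil
  then show ?case using vertex_at_eq_root vertex_at_Nil by metis
next
  case (snoc i p)
  have "vertex_at q \<noteq> root" using vertex_at_child(1)[OF snoc.prems(1)] snoc.prems(3) by simp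
  then obtain j q' where q: "q = q' @ [j]" using vertex_at_Nil by (cases q rule: rev_cases) auto
  note a = vertex_at_child[OF snoc.prems(1)] and b = vertex_at_child[OF snoc.prems(2)[unfolded q]]
  have V: "p \<in> tree_vertices tree" "q' \<in> tree_vertices tree"
    using snoc.prems q tree_vertices_prefix by blast+
  have eq: "outgoing (vertex_at p) ! i = outgoing (vertex_at q') ! j"
    using a(3) b(3) snoc.prems(3) q by simp
  have "tl (outgoing (vertex_at p) ! i) = vertex_at p" "tl (outgoing (vertex_at q') ! j) = vertex_at q'"
    using outgoing_props(2)[OF vertex_at_props(1)[OF V(1)]] outgoing_props(2)[OF vertex_at_props(1)[OF V(2)]]
      nth_mem[OF a(5)] nth_mem[OF b(5)] by auto
  then have "vertex_at p = vertex_at q'" using eq by simp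
  then have "p = q'" using snoc.IH V by blast
  moreover have "i = j"
    using eq outgoing_props(1)[OF vertex_at_props(1)[OF V(1)]] a(5) b(5) \<open>p = q'\<close>
    by (simp add: nth_eq_iff_index_eq)
  ultimately show ?case using q by simp
qed

lemma vertex_at_bij: "bij_betw vertex_at (tree_vertices tree) V"
proof -
  have "V \<subseteq> vertex_at ` tree_vertices tree" using vertex_at_surj by blast
  then show ?thesis using vertex_at_inj vertex_at_props(1) by (auto simp: bij_betw_def inj_on_def)
qed

section \<open>Half-edges of the tree and half-edges of the map\<close>

primrec half_edge_at :: "half_edge \<Rightarrow> 'b" where
  "half_edge_at (ToParent p) = parent (vertex_at p)"
| "half_edge_at (ToBranch p i) = outgoing (vertex_at p) ! i"

text \<open>The rotation is compared list by list; both the commutation with \<open>rt\<close> and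
  the bijectivity of \<open>half_edge_at\<close> rest on this.\<close>

lemma map_half_edges_at:
  assumes "p \<in> tree_vertices tree"
  shows "map half_edge_at (half_edges_at tree p) = around (vertex_at p)"
  using vertex_at_props(1,4)[OF assms] vertex_at_eq_root[OF assms]
  by (simp add: half_edges_at_def around_outgoing comp_def map_nth)

lemma half_edge_in_list: "h \<in> half_edges tree \<Longrightarrow> h \<in> set (half_edges_at tree (origin h))"
  by (simp add: set_half_edges_at origin_in_tree_vertices)

lemma half_edge_at_props:
  assumes "h \<in> half_edges tree"
  shows "half_edge_at h \<in> H" "tl (half_edge_at h) = vertex_at (origin h)"
    "half_edge_at (next_clockwise tree h) = rt (half_edge_at h)"
proof -
  let ?p = "origin h" and ?L = "half_edges_at tree (origin h)"
  have p: "?p \<in> tree_vertices tree" using assms origin_in_tree_vertices by blast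
  note m = map_half_edges_at[OF p] and a = around_props[OF vertex_at_props(1)[OF p]]
  have "half_edge_at h \<in> set (around (vertex_at ?p))"
    using half_edge_in_list[OF assms] m by (metis image_eqI list.set_map)
  then show "half_edge_at h \<in> H" "tl (half_edge_at h) = vertex_at (origin h)" using a(4) by auto
  obtain i where i: "i < length ?L" "h = ?L ! i"
    using half_edge_in_list[OF assms] by (auto simp: in_set_conv_nth)
  have len: "length (around (vertex_at ?p)) = length ?L" using m by (metis length_map)
  have "next_clockwise tree (?L ! i) = ?L ! (Suc i mod length ?L)"
    using half_edges_at_cyclic[of tree ?p] i(1) unfolding cyclic_list_def by blast
  then have "next_clockwise tree h = ?L ! (Suc i mod length ?L)" unfolding i(2)[symmetric] .
  moreover have "half_edge_at (?L ! j) = around (vertex_at ?p) ! j" if "j < length ?L" for j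
    using that by (simp add: m[symmetric])
  moreover have "Suc i mod length ?L < length ?L" using i(1) by (intro mod_less_divisor) auto
  moreover have "half_edge_at h = around (vertex_at ?p) ! i"
    using arg_cong[OF i(2), of half_edge_at] i(1) by (simp add: m[symmetric])
  ultimately show "half_edge_at (next_clockwise tree h) = rt (half_edge_at h)"
    using a(1) i(1) len by (simp add: cyclic_list_def)
qed

lemma half_edge_at_bij: "bij_betw half_edge_at (half_edges tree) H"
proof -
  have "inj_on half_edge_at (half_edges tree)"
  proof (rule inj_onI)
    fix h h' assume h: "h \<in> half_edges tree" "h' \<in> half_edges tree" "half_edge_at h = half_edge_at h'"
    then have o: "origin h = origin h'"
      using vertex_at_inj half_edge_at_props(2) origin_in_tree_vertices by metis
    let ?p = "origin h"
    have p: "?p \<in> tree_vertices tree" using h origin_in_tree_vertices by blast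
    have "distinct (map half_edge_at (half_edges_at tree ?p))"
      using map_half_edges_at[OF p] around_props(1)[OF vertex_at_props(1)[OF p]] by (simp add: cyclic_list_def)
    then have "inj_on half_edge_at (set (half_edges_at tree ?p))" by (simp add: distinct_map)
    then show "h = h'" using h half_edge_in_list[of h] half_edge_in_list[of h'] o by (auto simp: inj_on_def)
  qed
  moreover have "h \<in> half_edge_at ` half_edges tree" if h: "h \<in> H" for h
  proof -
    obtain p where p: "p \<in> tree_vertices tree" "vertex_at p = tl h" using vertex_at_surj tl_in[OF h] by blast
    then have "h \<in> set (around (vertex_at p))" using around_props(4)[OF vertex_at_props(1)[OF p(1)]] h by simp
    then have "h \<in> half_edge_at ` set (half_edges_at tree p)"
      by (simp only: map_half_edges_at[OF p(1), symmetric] set_map)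
    then show ?thesis using set_half_edges_at[OF p(1)] by auto
  qed
  ultimately show ?thesis using half_edge_at_props(1) by (auto simp: bij_betw_def)
qed

lemma stem_tree_iff:
  assumes "h \<in> half_edges tree"
  shows "stem tree h \<longleftrightarrow> half_edge_at h \<notin> X"
proof (cases h)
  case (ToParent p)
  then have p: "p \<in> tree_vertices tree" "p \<noteq> []" using assms by auto
  then show ?thesis
    using ToParent parent_props(1)[OF vertex_at_props(1)[OF p(1)]] vertex_at_eq_root[OF p(1)] by simp
next
  case (ToBranch p i)
  then have p: "p \<in> tree_vertices tree" "i < length (outgoing (vertex_at p))"
    using assms vertex_at_props(4)[of p] by auto
  let ?v = "vertex_at p" and ?h = "outgoing (vertex_at p) ! i"
  have V: "?v \<in> V" using vertex_at_props(1)[OF p(1)] .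
  have tlh: "tl ?h = ?v" using outgoing_props(2)[OF V] nth_mem[OF p(2)] by auto
  have "?h \<in> X \<longleftrightarrow> ?h \<in> child_edges"
  proof
    assume "?h \<in> X"
    moreover have "?h \<notin> parent ` (V - {root})"
    proof
      assume "?h \<in> parent ` (V - {root})"
      then obtain w where w: "w \<in> V" "w \<noteq> root" "?h = parent w" by blast
      then have "w = ?v" using parent_props(2)[OF w(1,2)] tlh by simp
      then show False using outgoing_props(4)[OF V] w nth_mem[OF p(2)] by simp
    qed
    ultimately show "?h \<in> child_edges" using X_eq by blast
  qed (rule child_edgesD(1))
  then show ?thesis using ToBranch snoc_in_tree_iff[OF p(1), of i] p assms by simp
qed

lemma half_edge_at_tree_mate:
  assumes "h \<in> half_edges tree" "\<not> stem tree h"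
  shows "half_edge_at (tree_mate h) = mt (half_edge_at h)"
proof (cases h)
  case (ToParent p)
  then obtain q i where "p = q @ [i]" using assms by (cases p rule: rev_cases) auto
  then show ?thesis using ToParent assms vertex_at_child(3)[of q i] by simp
next
  case (ToBranch p i)
  then have "p @ [i] \<in> tree_vertices tree" using assms by simp
  then show ?thesis using ToBranch vertex_at_child(2) by simp
qed

lemma opening_stem_tree_iff:
  assumes "h \<in> half_edges tree"
  shows "opening_stem tree h \<longleftrightarrow> half_edge_at h \<notin> X \<and> black (half_edge_at h)"
    "closing_stem tree h \<longleftrightarrow> half_edge_at h \<notin> X \<and> \<not> black (half_edge_at h)"
proof -
  have "(opening_stem tree h \<longrightarrow> black (half_edge_at h)) \<and> (closing_stem tree h \<longrightarrow> \<not> black (half_edge_at h))"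
  proof (cases h)
    case (ToBranch p i)
    then have p: "p \<in> tree_vertices tree" "i < length (outgoing (vertex_at p))"
      using assms vertex_at_props(4)[of p] by auto
    show ?thesis using ToBranch vertex_at_props(5)[OF p] by (auto simp: Let_def split: if_splits)
  qed simp
  then show "opening_stem tree h \<longleftrightarrow> half_edge_at h \<notin> X \<and> black (half_edge_at h)"
    "closing_stem tree h \<longleftrightarrow> half_edge_at h \<notin> X \<and> \<not> black (half_edge_at h)"
    using stem_tree_iff[OF assms] opening_not_closing[of tree h] by (auto simp: stem_def)
qed

lemma root_half_edge: "branches tree \<noteq> []" "half_edge_at (ToBranch [] 0) = h0"
proof -
  have o: "outgoing root \<noteq> []" "outgoing root ! 0 = h0"
    using around_props(2,3)[OF root_in] by (auto simp: outgoing_def start_def hd_conv_nth)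
  show "branches tree \<noteq> []"
    using vertex_at_props(4)[of "[]"] o(1) by (auto simp: vertex_at_Nil)
  show "half_edge_at (ToBranch [] 0) = h0" using o(2) by (simp add: vertex_at_Nil)
qed

lemma properly_coloured_tree: "properly_coloured tree"
  unfolding properly_coloured_def
proof (intro conjI ballI impI)
  fix p assume p: "p \<in> tree_vertices tree"
  note V = vertex_at_props[OF p]
  have stem_colour: "b = Opening \<Longrightarrow> colour_at (vertex_at p) = Black"
    "b = Closing \<Longrightarrow> colour_at (vertex_at p) = White"
    if b: "b \<in> set (branches (subtree tree p))" for b
  proof -
    obtain i where i: "i < length (outgoing (vertex_at p))" "b = branches (subtree tree p) ! i"
      using b V(4) by (auto simp: in_set_conv_nth)
    have "tl (outgoing (vertex_at p) ! i) = vertex_at p"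
      using outgoing_props(2)[OF V(1)] nth_mem[OF i(1)] by auto
    then show "b = Opening \<Longrightarrow> colour_at (vertex_at p) = Black"
      "b = Closing \<Longrightarrow> colour_at (vertex_at p) = White"
      using V(5)[OF i(1)] i(2) by (auto simp: Let_def colour_at_def split: if_splits)
  qed
  show "Closing \<notin> set (branches (subtree tree p))" if "vertex_colour (subtree tree p) = Black"
    using stem_colour(2) that V(3) by fastforce
  show "Opening \<notin> set (branches (subtree tree p))" if "vertex_colour (subtree tree p) = White"
    using stem_colour(1) that V(3) by fastforce
  assume "p \<noteq> []"
  then obtain q i where q: "p = q @ [i]" by (cases p rule: rev_cases) auto
  then have qV: "q \<in> tree_vertices tree" using p tree_vertices_prefix by blast
  note c = vertex_at_child[OF p[unfolded q]]
  let ?h = "outgoing (vertex_at q) ! i"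
  have "?h \<in> H" "tl ?h = vertex_at q"
    using outgoing_props(2)[OF vertex_at_props(1)[OF qV]] nth_mem[OF c(5)] by auto
  moreover have "tl (mt ?h) = vertex_at p" using q by (simp add: vertex_at_snoc)
  ultimately have "colour_at (vertex_at p) \<noteq> colour_at (vertex_at q)"
    using sg_mt[of ?h] sg_h[of ?h] by (auto simp: colour_at_def)
  then show "vertex_colour (subtree tree p) \<noteq> vertex_colour (subtree tree (butlast p))"
    using V(3) vertex_at_props(3)[OF qV] q by simp
qed

end

section \<open>Maps and their isomorphisms\<close>

definition map_sign :: "('v, 'h) rooted_map \<Rightarrow> 'v \<Rightarrow> int" where
  "map_sign M v = (if colour_of M v = Black then 1 else - 1)"

lemma map_sign_neq_iff: "colour_of M v \<noteq> colour_of M w \<longleftrightarrow> map_sign M w = - map_sign M v"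
  by (cases "colour_of M v"; cases "colour_of M w") (simp_all add: map_sign_def)

text \<open>Exchanges the vocabulary of digraphs for \<open>cmap\<close>, which knows nothing about
  the outside of its carrier. Hence the clauses that \<open>rot\<close> and \<open>mate\<close> are
  the identity there and that \<open>head\<close> is determined by \<open>mate\<close>.\<close>

lemma rooted_bipartite_plane_map_iff:
  "rooted_bipartite_plane_map M \<longleftrightarrow>
     cmap (verts (skeleton M)) (arcs (skeleton M)) (tail (skeleton M)) (rot M) (mate M) (map_sign M) \<and>
     (\<forall>h. h \<notin> arcs (skeleton M) \<longrightarrow> rot M h = h \<and> mate M h = h) \<and>
     (\<forall>h \<in> arcs (skeleton M). head (skeleton M) h = tail (skeleton M) (mate M h)) \<and>
     card (verts (skeleton M)) + card (faces M) = card (edges M) + 2 \<and>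
     root_corner M \<in> corners M \<and> outer_face M \<in> faces M" (is "?L \<longleftrightarrow> ?R")
proof
  let ?G = "skeleton M" and ?V = "verts (skeleton M)" and ?H = "arcs (skeleton M)"
  {
    assume M: ?L
    then have fin: "fin_digraph ?G" and bi: "bidirected_digraph ?G (mate M)"
      and conn: "Digraph_Component.connected ?G" and perm: "rot M permutes ?H"
      and cyc: "\<And>v. v \<in> ?V \<Longrightarrow> out_arcs ?G v \<noteq> {} \<Longrightarrow> cyclic_on (rot M) (out_arcs ?G v)"
      and col: "\<And>h. h \<in> ?H \<Longrightarrow> colour_of M (tail ?G h) \<noteq> colour_of M (head ?G h)"
      and rest: "card ?V + card (faces M) = card (edges M) + 2" "root_corner M \<in> corners M" "outer_face M \<in> faces M"
      unfolding rooted_bipartite_plane_map_def Let_def by blast+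
    interpret fin_digraph ?G by (rule fin)
    interpret bidirected_digraph ?G "mate M" by (rule bi)
    have orb: "h' \<in> orbit (rot M) h \<longleftrightarrow> h' \<in> ?H \<and> tail ?G h' = tail ?G h" if "h \<in> ?H" for h h'
    proof -
      have h: "h \<in> out_arcs ?G (tail ?G h)" using that by (simp add: out_arcs_def)
      then have "cyclic_on (rot M) (out_arcs ?G (tail ?G h))"
        using cyc[OF tail_in_verts[OF that]] by blast
      with h have "out_arcs ?G (tail ?G h) = orbit (rot M) h" by (simp add: cyclic_on_alldef)
      then show ?thesis by (auto simp: out_arcs_def)
    qed
    have "cmap ?V ?H (tail ?G) (rot M) (mate M) (map_sign M)"
    proof
      show "?V \<noteq> {}" using conn by (simp add: connected_conv)
      show "bij_betw (rot M) ?H ?H" using perm by (rule permutes_imp_bij)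
      show "tail ?G (rot M h) = tail ?G h" if "h \<in> ?H" for h
        using orb[OF that, of "rot M h"] orbit.base by metis
      show "map_sign M v = 1 \<or> map_sign M v = - 1" for v by (simp add: map_sign_def)
      show "map_sign M (tail ?G (mate M h)) = - map_sign M (tail ?G h)" if "h \<in> ?H" for h
        using col[OF that] tail_arev[OF that] by (simp add: map_sign_neq_iff)
      show "\<exists>n. h' = (rot M ^^ n) h" if "h \<in> ?H" "h' \<in> ?H" "tail ?G h = tail ?G h'" for h h'
        using orb[OF that(1), of h'] that(2,3) by (auto simp: orbit_altdef)
      show "S = ?V" if S: "S \<subseteq> ?V" "S \<noteq> {}" "\<And>h. h \<in> ?H \<Longrightarrow> tail ?G h \<in> S \<Longrightarrow> tail ?G (mate M h) \<in> S" for S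
      proof -
        \<comment> \<open>An arc that is traversed backwards is handled through its mate.\<close>
        have step: "w \<in> S" if vw: "v \<in> S" "(v, w) \<in> (arcs_ends ?G)\<^sup>s" for v w
        proof -
          obtain h where h: "h \<in> ?H" "v = tail ?G h \<and> w = head ?G h \<or> w = tail ?G h \<and> v = head ?G h"
            using vw(2) by (auto simp: symcl_def arcs_ends_conv)
          then show ?thesis using S(3)[of h] S(3)[of "mate M h"] vw(1) by auto
        qed
        obtain v where v: "v \<in> S" "v \<in> ?V" using S(1,2) by blast
        have "w \<in> S" if "w \<in> ?V" for w
        proof -
          have "(v, w) \<in> rtrancl_on ?V ((arcs_ends ?G)\<^sup>s)" using conn v(2) that by (simp add: connected_conv)
          then show ?thesis by (induction rule: rtrancl_on_induct) (use v step in auto)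
        qed
        then show ?thesis using S(1) by blast
      qed
    qed simp_all
    moreover have "rot M h = h \<and> mate M h = h" if "h \<notin> ?H" for h
      using permutes_not_in[OF perm that] arev_eq[OF that] by simp
    ultimately show ?R using rest by simp
  }
  assume R: ?R
  then interpret cmap ?V ?H "tail ?G" "rot M" "mate M" "map_sign M" by blast
  have head: "head ?G h = tail ?G (mate M h)" if "h \<in> ?H" for h using R that by blast
  have wf: "wf_digraph ?G" by standard (auto simp: tl_in mt_in head)
  then have fin: "fin_digraph ?G" using finite_V finite_H by (simp add: fin_digraph_def fin_digraph_axioms_def)
  have bi: "bidirected_digraph ?G (mate M)"
    using R mt_neq mt_mt head wf by (intro wf_digraph.bidirected_digraphI) auto
  have perm: "rot M permutes ?H" using R rt_bij by (intro bij_imp_permutes) auto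
  have "Digraph_Component.connected ?G"
    unfolding connected_conv
  proof (intro conjI ballI)
    show "?V \<noteq> {}" by (rule V_nonempty)
    fix u v assume u: "u \<in> ?V" "v \<in> ?V"
    let ?S = "{w \<in> ?V. (u, w) \<in> rtrancl_on ?V ((arcs_ends ?G)\<^sup>s)}"
    have "?S = ?V"
    proof (rule conn)
      show "?S \<noteq> {}" using u(1) by auto
      fix h assume h: "h \<in> ?H" "tail ?G h \<in> ?S"
      have "(tail ?G h, tail ?G (mate M h)) \<in> (arcs_ends ?G)\<^sup>s"
        using h(1) head[OF h(1)] by (auto simp: symcl_def arcs_ends_conv)
      then show "tail ?G (mate M h) \<in> ?S"
        using h tl_in[OF mt_in[OF h(1)]] rtrancl_on_into_rtrancl_on by fastforce
    qed auto
    then show "(u, v) \<in> rtrancl_on ?V ((arcs_ends ?G)\<^sup>s)" using u(2) by blast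
  qed
  moreover have "cyclic_on (rot M) (out_arcs ?G v)" if ne: "out_arcs ?G v \<noteq> {}" for v
  proof -
    obtain h where h: "h \<in> out_arcs ?G v" using ne by blast
    then have hH: "h \<in> ?H" "tail ?G h = v" by (simp_all add: out_arcs_def)
    have "out_arcs ?G v = orbit (rot M) h"
    proof
      show "out_arcs ?G v \<subseteq> orbit (rot M) h"
        using bij_orbit_iff[OF rt_bij finite_H hH(1)] rt_trans[OF hH(1)] hH(2) by (auto simp: out_arcs_def)
      show "orbit (rot M) h \<subseteq> out_arcs ?G v"
      proof
        fix k assume "k \<in> orbit (rot M) h"
        then show "k \<in> out_arcs ?G v" by induction (auto simp: hH rt_in tl_rt out_arcs_def)
      qed
    qed
    then show ?thesis using h by (auto simp: cyclic_on_def)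
  qed
  moreover have "colour_of M (tail ?G h) \<noteq> colour_of M (head ?G h)" if "h \<in> ?H" for h
    using sg_mt[OF that] head[OF that] by (simp add: map_sign_neq_iff)
  ultimately show ?L
    unfolding rooted_bipartite_plane_map_def Let_def using fin bi perm R by blast
qed

lemma rooted_bipartite_plane_map_cmap:
  "rooted_bipartite_plane_map M \<Longrightarrow>
    cmap (verts (skeleton M)) (arcs (skeleton M)) (tail (skeleton M)) (rot M) (mate M) (map_sign M)"
  by (simp add: rooted_bipartite_plane_map_iff)

lemma next_corner_in_corners:
  assumes "rooted_bipartite_plane_map M" "c \<in> corners M"
  shows "next_corner M c \<in> corners M"
proof -
  interpret cmap "verts (skeleton M)" "arcs (skeleton M)" "tail (skeleton M)" "rot M" "mate M" "map_sign M"
    using assms(1) by (rule rooted_bipartite_plane_map_cmap)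
  show ?thesis using assms(2) by (auto simp: corners_def rt_in mt_in)
qed

lemma orbit_in_closed: "y \<in> orbit f x \<Longrightarrow> x \<in> A \<Longrightarrow> (\<And>x. x \<in> A \<Longrightarrow> f x \<in> A) \<Longrightarrow> y \<in> A"
  by (induction rule: orbit.induct) auto

lemma orbit_conjugate:
  assumes "x \<in> A" "\<And>x. x \<in> A \<Longrightarrow> f x \<in> A" "\<And>x. x \<in> A \<Longrightarrow> f' (m x) = m (f x)"
  shows "orbit f' (m x) = m ` orbit f x"
proof
  show "orbit f' (m x) \<subseteq> m ` orbit f x"
  proof
    fix y assume "y \<in> orbit f' (m x)"
    then show "y \<in> m ` orbit f x"
    proof induction
      case base
      then show ?case using assms(1,3) orbit.base by (metis image_eqI)
    next
      case (step y)
      then obtain z where z: "z \<in> orbit f x" "y = m z" by blast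
      then have "f' y = m (f z)" using orbit_in_closed assms by metis
      then show ?case using z(1) orbit.step by (metis image_eqI)
    qed
  qed
  show "m ` orbit f x \<subseteq> orbit f' (m x)"
  proof
    fix y assume "y \<in> m ` orbit f x"
    then obtain z where "z \<in> orbit f x" "y = m z" by blast
    moreover have "m z \<in> orbit f' (m x) \<and> z \<in> A" if "z \<in> orbit f x" for z
      using that
    proof induction
      case base
      then show ?case using assms orbit.base[of f' "m x"] by simp
    next
      case (step z)
      then show ?case using assms orbit.step[of "m z" f' "m x"] by simp
    qed
    ultimately show "y \<in> orbit f' (m x)" by blast
  qed
qed

lemma outer_face_subset: "rooted_bipartite_plane_map M \<Longrightarrow> outer_face M \<subseteq> corners M"
proof -
  assume M: "rooted_bipartite_plane_map M"
  then have "outer_face M \<in> faces M" by (simp add: rooted_bipartite_plane_map_def Let_def)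
  then obtain c where "c \<in> corners M" "outer_face M = orbit (next_corner M) c" by (auto simp: faces_def)
  then show ?thesis using next_corner_in_corners[OF M] orbit_in_closed[of _ "next_corner M" c "corners M"] by blast
qed

text \<open>Each edge has exactly one black and one white half.\<close>

lemma (in cmap) card_edges: "2 * card ((\<lambda>h. {h, mt h}) ` H) = card H"
proof -
  let ?e = "\<lambda>h. {h, mt h}" and ?B = "{h \<in> H. black h}" and ?W = "{h \<in> H. \<not> black h}"
  have sw: "black (mt h) \<longleftrightarrow> \<not> black h" if "h \<in> H" for h using sg_mt[OF that] sg_h[OF that] by auto
  have "?e ` H \<subseteq> ?e ` ?B"
  proof
    fix x assume "x \<in> ?e ` H"
    then obtain h where h: "h \<in> H" "x = {h, mt h}" by blast
    have "\<exists>k \<in> ?B. x = ?e k"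
    proof (cases "black h")
      case False
      then have "mt h \<in> ?B" using sw h(1) mt_in by simp
      moreover have "x = ?e (mt h)" using mt_mt[OF h(1)] h(2) by auto
      ultimately show ?thesis by blast
    qed (use h in blast)
    then show "x \<in> ?e ` ?B" by blast
  qed
  then have "?e ` H = ?e ` ?B" by blast
  moreover have "inj_on ?e ?B"
  proof (rule inj_onI)
    fix x y assume xy: "x \<in> ?B" "y \<in> ?B" "?e x = ?e y"
    then have "\<not> black (mt y)" using sw by simp
    then have "x \<noteq> mt y" using xy(1) by auto
    then show "x = y" using xy(3) by (auto simp: doubleton_eq_iff)
  qed
  ultimately have "card (?e ` H) = card ?B" by (simp add: card_image)
  moreover have "bij_betw mt ?B ?W"
    by (rule bij_betwI[where g = mt]) (auto simp: mt_in mt_mt sw)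
  then have "card ?B = card ?W" by (rule bij_betw_same_card)
  moreover have "card H = card ?B + card ?W"
  proof -
    have "H = ?B \<union> ?W" by blast
    moreover have "card (?B \<union> ?W) = card ?B + card ?W" using finite_H by (intro card_Un_disjoint) auto
    ultimately show ?thesis by simp
  qed
  ultimately show ?thesis by simp
qed

text \<open>As soon as there is an arc, connectedness leaves no vertex without half-edges, so all
  corners are of the form \<open>Before h\<close>.\<close>

lemma corners_eq:
  assumes "cmap (verts (skeleton M)) (arcs (skeleton M)) (tail (skeleton M)) (rot M) (mate M) (map_sign M)"
    and "arcs (skeleton M) \<noteq> {}"
  shows "corners M = Before ` arcs (skeleton M)"
    "faces M = (`) Before ` orbit (\<lambda>h. rot M (mate M h)) ` arcs (skeleton M)"
proof -
  interpret cmap "verts (skeleton M)" "arcs (skeleton M)" "tail (skeleton M)" "rot M" "mate M" "map_sign M"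
    by (rule assms(1))
  have "out_arcs (skeleton M) v \<noteq> {}" if "v \<in> verts (skeleton M)" for v
  proof -
    have "v \<in> tail (skeleton M) ` arcs (skeleton M)" using that tl_image[OF assms(2)] by simp
    then show ?thesis by (auto simp: out_arcs_def)
  qed
  then show corners: "corners M = Before ` arcs (skeleton M)" by (auto simp: corners_def)
  have "orbit (next_corner M) (Before h) = Before ` orbit (\<lambda>h. rot M (mate M h)) h"
    if "h \<in> arcs (skeleton M)" for h
    by (rule orbit_conjugate[OF that]) (simp_all add: rt_in mt_in)
  then show "faces M = (`) Before ` orbit (\<lambda>h. rot M (mate M h)) ` arcs (skeleton M)"
    unfolding faces_def corners image_image by (intro image_cong) simp_all
qed

text \<open>Doubling the relation avoids dividing the number of half-edges by two.\<close>

lemma euler_iff: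
  assumes "cmap (verts (skeleton M)) (arcs (skeleton M)) (tail (skeleton M)) (rot M) (mate M) (map_sign M)"
    and "arcs (skeleton M) \<noteq> {}"
  shows "card (verts (skeleton M)) + card (faces M) = card (edges M) + 2 \<longleftrightarrow>
    2 * (card (verts (skeleton M)) + card (orbit (\<lambda>h. rot M (mate M h)) ` arcs (skeleton M))) =
      card (arcs (skeleton M)) + 4"
proof -
  interpret cmap "verts (skeleton M)" "arcs (skeleton M)" "tail (skeleton M)" "rot M" "mate M" "map_sign M"
    by (rule assms(1))
  have inj: "inj ((`) (Before :: _ \<Rightarrow> (_, _) corner))" 
    by (rule injI) (simp add: inj_image_eq_iff inj_def)
  have "card (faces M) = card (orbit (\<lambda>h. rot M (mate M h)) ` arcs (skeleton M))"
    unfolding corners_eq(2)[OF assms] by (rule card_image) (rule inj_on_subset[OF inj subset_UNIV])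
  moreover have "2 * card (edges M) = card (arcs (skeleton M))"
    using card_edges by (simp add: edges_def)
  ultimately show ?thesis by presburger
qed

section \<open>Isomorphisms and relabelling of maps\<close>

lemma isomorphic_mapsE:
  assumes "isomorphic_maps M N"
  obtains f g where "bij_betw f (verts (skeleton M)) (verts (skeleton N))"
    "bij_betw g (arcs (skeleton M)) (arcs (skeleton N))"
    "\<forall>h \<in> arcs (skeleton M). tail (skeleton N) (g h) = f (tail (skeleton M) h)"
    "\<forall>h \<in> arcs (skeleton M). head (skeleton N) (g h) = f (head (skeleton M) h)"
    "\<forall>h \<in> arcs (skeleton M). mate N (g h) = g (mate M h)"
    "\<forall>h \<in> arcs (skeleton M). rot N (g h) = g (rot M h)"
    "\<forall>v \<in> verts (skeleton M). colour_of N (f v) = colour_of M v"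
    "root_corner N = map_corner f g (root_corner M)" "outer_face N = map_corner f g ` outer_face M"
proof -
  obtain f g where fg: "bij_betw f (verts (skeleton M)) (verts (skeleton N))"
    "bij_betw g (arcs (skeleton M)) (arcs (skeleton N))"
    "\<forall>h \<in> arcs (skeleton M). tail (skeleton N) (g h) = f (tail (skeleton M) h) \<and>
       head (skeleton N) (g h) = f (head (skeleton M) h) \<and>
       mate N (g h) = g (mate M h) \<and> rot N (g h) = g (rot M h)"
    "\<forall>v \<in> verts (skeleton M). colour_of N (f v) = colour_of M v"
    "root_corner N = map_corner f g (root_corner M)" "outer_face N = map_corner f g ` outer_face M"
    using assms unfolding isomorphic_maps_def by blast
  show ?thesis by (rule that[OF fg(1,2) _ _ _ _ fg(4-6)]) (use fg(3) in blast)+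
qed

lemma isomorphic_maps_trans:
  assumes "isomorphic_maps M N" "isomorphic_maps N P"
  shows "isomorphic_maps M P"
proof -
  obtain f g where M0: "bij_betw f (verts (skeleton M)) (verts (skeleton N))"
    "bij_betw g (arcs (skeleton M)) (arcs (skeleton N))"
    "\<forall>h \<in> arcs (skeleton M). tail (skeleton N) (g h) = f (tail (skeleton M) h)"
    "\<forall>h \<in> arcs (skeleton M). head (skeleton N) (g h) = f (head (skeleton M) h)"
    "\<forall>h \<in> arcs (skeleton M). mate N (g h) = g (mate M h)"
    "\<forall>h \<in> arcs (skeleton M). rot N (g h) = g (rot M h)"
    "\<forall>v \<in> verts (skeleton M). colour_of N (f v) = colour_of M v"
    "root_corner N = map_corner f g (root_corner M)" "outer_face N = map_corner f g ` outer_face M"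
    using isomorphic_mapsE[OF assms(1)] .
  note M = M0(1,2) M0(3-7)[THEN bspec] M0(8,9)
  obtain f' g' where N0: "bij_betw f' (verts (skeleton N)) (verts (skeleton P))"
    "bij_betw g' (arcs (skeleton N)) (arcs (skeleton P))"
    "\<forall>h \<in> arcs (skeleton N). tail (skeleton P) (g' h) = f' (tail (skeleton N) h)"
    "\<forall>h \<in> arcs (skeleton N). head (skeleton P) (g' h) = f' (head (skeleton N) h)"
    "\<forall>h \<in> arcs (skeleton N). mate P (g' h) = g' (mate N h)"
    "\<forall>h \<in> arcs (skeleton N). rot P (g' h) = g' (rot N h)"
    "\<forall>v \<in> verts (skeleton N). colour_of P (f' v) = colour_of N v"
    "root_corner P = map_corner f' g' (root_corner N)" "outer_face P = map_corner f' g' ` outer_face N"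
    using isomorphic_mapsE[OF assms(2)] .
  note N = N0(1,2) N0(3-7)[THEN bspec] N0(8,9)
  have "g h \<in> arcs (skeleton N)" if "h \<in> arcs (skeleton M)" for h using M(2) that by (rule bij_betwE[THEN bspec])
  moreover have "f v \<in> verts (skeleton N)" if "v \<in> verts (skeleton M)" for v
    using M(1) that by (rule bij_betwE[THEN bspec])
  ultimately show ?thesis
    unfolding isomorphic_maps_def
    using bij_betw_trans[OF M(1) N(1)] bij_betw_trans[OF M(2) N(2)] M(3-9) N(3-9)
    by (intro exI[of _ "f' \<circ> f"] exI[of _ "g' \<circ> g"])
       (simp add: corner.map_comp image_image)
qed

lemma map_corner_inverse:
  assumes "c \<in> corners M" "\<And>v. v \<in> verts (skeleton M) \<Longrightarrow> f' (f v) = v"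
    "\<And>h. h \<in> arcs (skeleton M) \<Longrightarrow> g' (g h) = h"
  shows "map_corner f' g' (map_corner f g c) = c"
  using assms by (auto simp: corners_def)

lemma isomorphic_maps_sym:
  assumes M: "rooted_bipartite_plane_map M" and iso: "isomorphic_maps M N"
  shows "isomorphic_maps N M"
proof -
  let ?V = "verts (skeleton M)" and ?H = "arcs (skeleton M)"
  obtain f g where fg0: "bij_betw f ?V (verts (skeleton N))" "bij_betw g ?H (arcs (skeleton N))"
    "\<forall>h \<in> ?H. tail (skeleton N) (g h) = f (tail (skeleton M) h)"
    "\<forall>h \<in> ?H. head (skeleton N) (g h) = f (head (skeleton M) h)"
    "\<forall>h \<in> ?H. mate N (g h) = g (mate M h)"
    "\<forall>h \<in> ?H. rot N (g h) = g (rot M h)"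
    "\<forall>v \<in> ?V. colour_of N (f v) = colour_of M v"
    "root_corner N = map_corner f g (root_corner M)" "outer_face N = map_corner f g ` outer_face M"
    using isomorphic_mapsE[OF iso] .
  note fg = fg0(1,2) fg0(3-7)[THEN bspec] fg0(8,9)
  interpret cmap ?V ?H "tail (skeleton M)" "rot M" "mate M" "map_sign M"
    using M by (rule rooted_bipartite_plane_map_cmap)
  let ?f = "inv_into ?V f" and ?g = "inv_into ?H g"
  have f: "?f (f v) = v" if "v \<in> ?V" for v using fg(1) that by (simp add: bij_betw_def)
  have g: "?g (g h) = h" if "h \<in> ?H" for h using fg(2) that by (simp add: bij_betw_def)
  have head: "head (skeleton M) h = tail (skeleton M) (mate M h)" if "h \<in> ?H" for h
    using M that by (simp add: rooted_bipartite_plane_map_iff)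
  have inv: "map_corner ?f ?g (map_corner f g c) = c" if "c \<in> corners M" for c
    using that f g by (rule map_corner_inverse)
  have root: "root_corner M \<in> corners M" using M by (simp add: rooted_bipartite_plane_map_iff)
  have arcs: "tail (skeleton M) (?g k) = ?f (tail (skeleton N) k) \<and>
       head (skeleton M) (?g k) = ?f (head (skeleton N) k) \<and>
       mate M (?g k) = ?g (mate N k) \<and> rot M (?g k) = ?g (rot N k)" if k: "k \<in> arcs (skeleton N)" for k
  proof -
    have "k \<in> g ` ?H" using fg(2) k by (simp add: bij_betw_def)
    then obtain h where h: "h \<in> ?H" "k = g h" by blast
    then show ?thesis using fg(3-6)[OF h(1)] g f tl_in mt_in rt_in head h(1) by simp
  qed
  have cols: "colour_of M (?f w) = colour_of N w" if w: "w \<in> verts (skeleton N)" for w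
  proof -
    have "w \<in> f ` ?V" using fg(1) w by (simp add: bij_betw_def)
    then show ?thesis using fg(7) f by auto
  qed
  have "map_corner ?f ?g ` outer_face N = outer_face M"
    using inv outer_face_subset[OF M] by (force simp: fg(9) image_image)
  then show ?thesis
    unfolding isomorphic_maps_def
    using bij_betw_inv_into[OF fg(1)] bij_betw_inv_into[OF fg(2)] arcs cols inv[OF root] fg(8)
    by (intro exI[of _ ?f] exI[of _ ?g]) simp
qed

text \<open>Besides renaming, this permits changing the functions outside the carrier: with
  identical labels it leads from \<open>next_clockwise\<close> to the \<open>rot\<close> of
  \<open>closure_map\<close>.\<close>

lemma cmap_transport:
  assumes "cmap V H tai rt mt sg" "inj_on f V" "inj_on g H"
    "\<And>h. h \<in> H \<Longrightarrow> tai' (g h) = f (tai h)" "\<And>h. h \<in> H \<Longrightarrow> rt' (g h) = g (rt h)"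
    "\<And>h. h \<in> H \<Longrightarrow> mt' (g h) = g (mt h)" "\<And>v. v \<in> V \<Longrightarrow> sg' (f v) = sg v"
  shows "cmap (f ` V) (g ` H) tai' rt' mt' sg'"
proof -
  interpret cmap V H tai rt mt sg by (rule assms(1))
  note eq = assms(4-7)
  have pow: "(rt' ^^ n) (g h) = g ((rt ^^ n) h) \<and> (rt ^^ n) h \<in> H" if "h \<in> H" for n h
    by (induction n) (auto simp: that eq rt_in)
  show ?thesis
  proof
    show "bij_betw rt' (g ` H) (g ` H)"
    proof -
      have "rt' ` g ` H = g ` rt ` H" using eq(2) by (auto simp: image_image)
      then have "rt' ` g ` H = g ` H" using rt_bij by (simp add: bij_betw_def)
      then show ?thesis using finite_H by (simp add: bij_betw_def eq_card_imp_inj_on)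
    qed
    show "\<exists>n. h' = (rt' ^^ n) h" if h: "h \<in> g ` H" "h' \<in> g ` H" "tai' h = tai' h'" for h h'
    proof -
      obtain k k' where k: "k \<in> H" "h = g k" "k' \<in> H" "h' = g k'" using h(1,2) by blast
      then have "tai k = tai k'" using h(3) eq(1) assms(2) tl_in by (auto simp: inj_on_def)
      then obtain n where "k' = (rt ^^ n) k" using rt_trans k by blast
      then show ?thesis using pow[OF k(1), of n] k by (intro exI[of _ n]) simp
    qed
    show "S = f ` V" if S: "S \<subseteq> f ` V" "S \<noteq> {}" "\<And>h. h \<in> g ` H \<Longrightarrow> tai' h \<in> S \<Longrightarrow> tai' (mt' h) \<in> S" for S
    proof -
      have "{v \<in> V. f v \<in> S} = V"
      proof (rule conn)
        show "{v \<in> V. f v \<in> S} \<noteq> {}" using S(1,2) by blast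
        fix h assume h: "h \<in> H" "tai h \<in> {v \<in> V. f v \<in> S}"
        then show "tai (mt h) \<in> {v \<in> V. f v \<in> S}" using S(3)[of "g h"] eq tl_in mt_in by simp
      qed auto
      then show ?thesis using S(1) by blast
    qed
    show "sg' w = 1 \<or> sg' w = - 1" if "w \<in> f ` V" for w
      using that sg_cases by (metis eq(4) imageE)
  qed (use eq finite_V finite_H V_nonempty tl_in mt_in mt_mt rt_in tl_rt sg_mt in auto)
qed

text \<open>Provides the representatives labelled by natural numbers. Outside the image
  \<open>mate\<close> and \<open>rot\<close> must be the identity for the result to be a
  map.\<close>

definition relabel :: "('v \<Rightarrow> 'w) \<Rightarrow> ('h \<Rightarrow> 'k) \<Rightarrow> ('v, 'h) rooted_map \<Rightarrow> ('w, 'k) rooted_map" where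
  "relabel f g M = (let V = verts (skeleton M); H = arcs (skeleton M); g' = inv_into H g in
     \<lparr> skeleton = \<lparr> verts = f ` V, arcs = g ` H, tail = (\<lambda>k. f (tail (skeleton M) (g' k))),
         head = (\<lambda>k. f (head (skeleton M) (g' k))) \<rparr>,
       mate = (\<lambda>k. if k \<in> g ` H then g (mate M (g' k)) else k),
       rot = (\<lambda>k. if k \<in> g ` H then g (rot M (g' k)) else k),
       colour_of = (\<lambda>w. colour_of M (inv_into V f w)),
       root_corner = map_corner f g (root_corner M),
       outer_face = map_corner f g ` outer_face M \<rparr>)"

lemma relabel:
  assumes M: "rooted_bipartite_plane_map M"
    and f: "inj_on f (verts (skeleton M))" and g: "inj_on g (arcs (skeleton M))"
  shows "rooted_bipartite_plane_map (relabel f g M)" "isomorphic_maps M (relabel f g M)"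
proof -
  let ?N = "relabel f g M" and ?V = "verts (skeleton M)" and ?H = "arcs (skeleton M)"
  interpret cmap ?V ?H "tail (skeleton M)" "rot M" "mate M" "map_sign M"
    using M by (rule rooted_bipartite_plane_map_cmap)
  have sel: "verts (skeleton ?N) = f ` ?V" "arcs (skeleton ?N) = g ` ?H"
    "root_corner ?N = map_corner f g (root_corner M)" "outer_face ?N = map_corner f g ` outer_face M"
    by (simp_all add: relabel_def Let_def)
  have arc: "tail (skeleton ?N) (g h) = f (tail (skeleton M) h)" "head (skeleton ?N) (g h) = f (head (skeleton M) h)"
    "mate ?N (g h) = g (mate M h)" "rot ?N (g h) = g (rot M h)" if "h \<in> ?H" for h
    using that g by (simp_all add: relabel_def Let_def)
  have col: "colour_of ?N (f v) = colour_of M v" if "v \<in> ?V" for v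
    using that f by (simp add: relabel_def Let_def)
  have out: "rot ?N k = k \<and> mate ?N k = k" if "k \<notin> g ` ?H" for k
    using that by (simp add: relabel_def Let_def)
  show "isomorphic_maps M ?N"
    unfolding isomorphic_maps_def using f g arc col sel
    by (intro exI[of _ f] exI[of _ g]) (simp add: bij_betw_def)
  have cm: "cmap (verts (skeleton ?N)) (arcs (skeleton ?N)) (tail (skeleton ?N)) (rot ?N) (mate ?N) (map_sign ?N)"
    unfolding sel using f g arc col
    by (intro cmap_transport[OF cmap_axioms f g]) (simp_all add: map_sign_def)
  have Mp: "card ?V + card (faces M) = card (edges M) + 2" "root_corner M \<in> corners M" "outer_face M \<in> faces M"
    "\<And>h. h \<in> ?H \<Longrightarrow> head (skeleton M) h = tail (skeleton M) (mate M h)"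
    using M by (simp_all add: rooted_bipartite_plane_map_iff)
  have out_arcs: "out_arcs (skeleton ?N) (f v) = g ` out_arcs (skeleton M) v" if "v \<in> ?V" for v
    using arc(1) tl_in f that by (auto simp: out_arcs_def sel inj_on_def)
  have corners: "corners ?N = map_corner f g ` corners M"
  proof -
    have "{v \<in> f ` ?V. out_arcs (skeleton ?N) v = {}} = f ` {v \<in> ?V. out_arcs (skeleton M) v = {}}"
      using out_arcs by auto
    then show ?thesis unfolding corners_def sel by (simp add: image_Un image_image)
  qed
  have "orbit (next_corner ?N) (map_corner f g c) = map_corner f g ` orbit (next_corner M) c"
    if "c \<in> corners M" for c
  proof (rule orbit_conjugate[OF that next_corner_in_corners[OF M]])
    fix c assume "c \<in> corners M"
    then show "next_corner ?N (map_corner f g c) = map_corner f g (next_corner M c)"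
      by (auto simp: corners_def arc mt_in)
  qed
  then have faces: "faces ?N = (`) (map_corner f g) ` faces M"
    unfolding faces_def corners image_image by (intro image_cong) simp_all
  have sub: "x \<subseteq> corners M" if "x \<in> faces M" for x
    using that orbit_in_closed[OF _ _ next_corner_in_corners[OF M]] by (force simp: faces_def)
  have fi: "inv_into ?V f (f v) = v" if "v \<in> ?V" for v using f that by (rule inv_into_f_f)
  have gi: "inv_into ?H g (g h) = h" if "h \<in> ?H" for h using g that by (rule inv_into_f_f)
  have "inj_on (map_corner f g) (corners M)"
  proof (rule inj_on_inverseI)
    fix c assume "c \<in> corners M"
    then show "map_corner (inv_into ?V f) (inv_into ?H g) (map_corner f g c) = c"
      using fi gi by (rule map_corner_inverse)
  qed
  then have "inj_on ((`) (map_corner f g)) (faces M)"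
    using sub by (intro inj_on_subset[OF inj_on_image_Pow]) auto
  then have card_faces: "card (faces ?N) = card (faces M)" by (simp add: faces card_image)
  have "2 * card (edges ?N) = 2 * card (edges M)"
    using cmap.card_edges[OF cm] card_edges g by (simp add: edges_def sel card_image)
  then have "card (verts (skeleton ?N)) + card (faces ?N) = card (edges ?N) + 2"
    using Mp(1) card_faces f by (simp add: sel card_image)
  then show "rooted_bipartite_plane_map ?N"
    unfolding rooted_bipartite_plane_map_iff using cm out Mp(2,3) corners faces arc Mp(4)
    by (auto simp: sel mt_in)
qed

lemma nat_representative:
  assumes "rooted_bipartite_plane_map M"
  shows "\<exists>N :: (nat, nat) rooted_map. rooted_bipartite_plane_map N \<and> isomorphic_maps M N"
proof -
  interpret cmap "verts (skeleton M)" "arcs (skeleton M)" "tail (skeleton M)" "rot M" "mate M" "map_sign M"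
    using assms by (rule rooted_bipartite_plane_map_cmap)
  obtain f :: "_ \<Rightarrow> nat" where "inj_on f (verts (skeleton M))" using finite_imp_inj_to_nat_seg[OF finite_V] by blast
  moreover obtain g :: "_ \<Rightarrow> nat" where "inj_on g (arcs (skeleton M))"
    using finite_imp_inj_to_nat_seg[OF finite_H] by blast
  ultimately show ?thesis using relabel[OF assms] by blast
qed

lemma map_class_eq:
  assumes "rooted_bipartite_plane_map M" "rooted_bipartite_plane_map N" "isomorphic_maps M N"
  shows "map_class M = map_class N"
  using isomorphic_maps_trans[OF assms(3)] isomorphic_maps_trans[OF isomorphic_maps_sym[OF assms(1,3)]]
  by (auto simp: map_class_def)

lemma isomorphic_maps_degree_distribution:
  assumes M: "rooted_bipartite_plane_map M" and iso: "isomorphic_maps M N"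
  shows "degree_distribution N = degree_distribution M" "root_colour N = root_colour M"
proof -
  let ?V = "verts (skeleton M)" and ?H = "arcs (skeleton M)"
  interpret cmap ?V ?H "tail (skeleton M)" "rot M" "mate M" "map_sign M"
    using M by (rule rooted_bipartite_plane_map_cmap)
  obtain f g where fg0: "bij_betw f ?V (verts (skeleton N))" "bij_betw g ?H (arcs (skeleton N))"
    "\<forall>h \<in> ?H. tail (skeleton N) (g h) = f (tail (skeleton M) h)"
    "\<forall>h \<in> ?H. head (skeleton N) (g h) = f (head (skeleton M) h)"
    "\<forall>h \<in> ?H. mate N (g h) = g (mate M h)"
    "\<forall>h \<in> ?H. rot N (g h) = g (rot M h)"
    "\<forall>v \<in> ?V. colour_of N (f v) = colour_of M v"
    "root_corner N = map_corner f g (root_corner M)" "outer_face N = map_corner f g ` outer_face M"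
    using isomorphic_mapsE[OF iso] .
  note fg = fg0(1,2) fg0(3-7)[THEN bspec] fg0(8,9)
  have inj: "inj_on f ?V" "inj_on g ?H" and im: "verts (skeleton N) = f ` ?V" "arcs (skeleton N) = g ` ?H"
    using fg(1,2) by (auto simp: bij_betw_def)
  have "card (out_arcs (skeleton N) (f v)) = card (out_arcs (skeleton M) v)" if "v \<in> ?V" for v
  proof -
    have "out_arcs (skeleton N) (f v) = g ` out_arcs (skeleton M) v"
      using fg(3) tl_in inj(1) that by (auto simp: out_arcs_def im inj_on_def)
    moreover have "inj_on g (out_arcs (skeleton M) v)"
      by (rule inj_on_subset[OF inj(2)]) (auto simp: out_arcs_def)
    ultimately show ?thesis by (simp add: card_image)
  qed
  then have eq: "{w \<in> verts (skeleton N). colour_of N w = c \<and> card (out_arcs (skeleton N) w) = k} =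
      f ` {v \<in> ?V. colour_of M v = c \<and> card (out_arcs (skeleton M) v) = k}" for c k
    using fg(7) by (auto simp: im)
  have "card (f ` {v \<in> ?V. colour_of M v = c \<and> card (out_arcs (skeleton M) v) = k}) =
      card {v \<in> ?V. colour_of M v = c \<and> card (out_arcs (skeleton M) v) = k}" for c k
    by (rule card_image) (rule inj_on_subset[OF inj(1)], auto)
  then show "degree_distribution N = degree_distribution M"
    by (simp add: fun_eq_iff degree_distribution_def eq)
  have "root_corner M \<in> corners M" using M by (simp add: rooted_bipartite_plane_map_iff)
  then show "root_colour N = root_colour M"
    using fg(3,7,8) tl_in by (auto simp: corners_def root_colour_def)
qed

section \<open>The closure of a well-charged tree is a plane map\<close>

lemma closure_map_sel [simp]:
  "verts (skeleton (closure_map t)) = tree_vertices t"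
  "arcs (skeleton (closure_map t)) = half_edges t"
  "tail (skeleton (closure_map t)) = origin"
  "head (skeleton (closure_map t)) = (\<lambda>h. origin (closure_mate t h))"
  "mate (closure_map t) = closure_mate t"
  "rot (closure_map t) = (\<lambda>h. if h \<in> half_edges t then next_clockwise t h else h)"
  "colour_of (closure_map t) = (\<lambda>p. vertex_colour (subtree t p))"
  "root_corner (closure_map t) = tree_root_corner t"
  "outer_face (closure_map t) = {x \<in> tree_corners t. \<not> enclosed t x}"
  by (simp_all add: closure_map_def closure_skeleton_def)

lemma map_sign_closure_map: "map_sign (closure_map t) = vertex_sign t"
  by (simp add: fun_eq_iff map_sign_def vertex_sign_def)

lemma half_edges_empty_iff: "half_edges t = {} \<longleftrightarrow> branches t = []"
proof
  assume "branches t = []"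
  then have "contour t = []" by (cases t) (simp add: contour_def)
  then show "half_edges t = {}" using set_contour[of t] by simp
next
  assume "half_edges t = {}"
  then have "ToBranch [] 0 \<notin> half_edges t" by simp
  then show "branches t = []" by simp
qed

lemma tree_corners_eq: "branches t \<noteq> [] \<Longrightarrow> tree_corners t = Before ` half_edges t"
  by (simp add: tree_corners_def)

lemma outer_face_closure_map:
  assumes "branches t \<noteq> []"
  shows "outer_face (closure_map t) = Before ` {h \<in> half_edges t. enclosing t h = {}}"
  using assms by (auto simp: tree_corners_eq enclosed_iff)

text \<open>The one-vertex tree without stems has a corner that precedes no half-edge, so arguments
  on half-edges do not see it and it is treated apart.\<close>

lemma trivial_tree:
  assumes "branches t = []"
  shows "tree_vertices t = {[]}" "half_edges t = {}" "tree_corners t = {Isolated []}"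
    "tree_root_corner t = Isolated []" "outer_face (closure_map t) = {Isolated []}"
proof -
  show "tree_vertices t = {[]}" using assms by (cases t) (simp add: tree_vertices_Vertex)
  show H: "half_edges t = {}" using assms half_edges_empty_iff by blast
  show C: "tree_corners t = {Isolated []}" using assms H by (simp add: tree_corners_def)
  show "tree_root_corner t = Isolated []" using assms by (simp add: tree_root_corner_def)
  show "outer_face (closure_map t) = {Isolated []}" using C not_enclosed_Isolated by auto
qed

context well_charged_tree
begin

lemma cmap_closure_map:
  "cmap (verts (skeleton (closure_map t))) (arcs (skeleton (closure_map t)))
    (tail (skeleton (closure_map t))) (rot (closure_map t)) (mate (closure_map t)) (map_sign (closure_map t))"
  unfolding closure_map_sel map_sign_closure_map
proof -
  have "cmap ((\<lambda>p. p) ` tree_vertices t) ((\<lambda>h. h) ` half_edges t) origin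
      (\<lambda>h. if h \<in> half_edges t then next_clockwise t h else h) (closure_mate t) (vertex_sign t)"
    by (rule cmap_transport[OF cmap_axioms]) simp_all
  then show "cmap (tree_vertices t) (half_edges t) origin
      (\<lambda>h. if h \<in> half_edges t then next_clockwise t h else h) (closure_mate t) (vertex_sign t)" by simp
qed

lemma orbit_closure_map:
  assumes "h \<in> half_edges t"
  shows "orbit (\<lambda>h. rot (closure_map t) (mate (closure_map t) h)) h = orbit face_step h"
proof -
  have "orbit (\<lambda>h. rot (closure_map t) (mate (closure_map t) h)) (id h) = id ` orbit face_step h"
  proof (rule orbit_conjugate[OF assms])
    fix h assume h: "h \<in> half_edges t"
    then show "face_step h \<in> half_edges t" by (rule face_step_in)
    show "rot (closure_map t) (mate (closure_map t) (id h)) = id (face_step h)"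
      using closure_mate_in[OF h] by (simp add: face_step_def)
  qed
  then show ?thesis by simp
qed

lemma closure_map_is_map: "rooted_bipartite_plane_map (closure_map t)"
proof (cases "branches t = []")
  case True
  note T = trivial_tree[OF True]
  have corners: "corners (closure_map t) = {Isolated []}"
    by (auto simp: corners_def T out_arcs_def)
  have "orbit (next_corner (closure_map t)) (Isolated []) = {Isolated []}"
    by (simp add: orbit_eq_singleton_iff)
  then have faces: "faces (closure_map t) = {{Isolated []}}" by (simp add: faces_def corners)
  have "edges (closure_map t) = {}" by (simp add: edges_def T)
  moreover have "closure_mate t h = h" for h using closure_mate_outside T(2) by simp
  ultimately show ?thesis
    unfolding rooted_bipartite_plane_map_iff using cmap_closure_map faces corners T
    by (simp del: closure_map_sel(9))
next
  case False
  then have ne: "half_edges t \<noteq> {}" using half_edges_empty_iff by blast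
  then have ne': "arcs (skeleton (closure_map t)) \<noteq> {}" by simp
  have orb: "orbit (\<lambda>h. rot (closure_map t) (mate (closure_map t) h)) ` half_edges t = orbit face_step ` half_edges t"
    by (rule image_cong) (simp_all only: orbit_closure_map)
  have "card (tree_vertices t) \<noteq> 0"
    by (metis Nil_in_tree_vertices card_0_eq empty_iff finite_tree_vertices)
  then obtain n where "card (tree_vertices t) = Suc n" using not0_implies_Suc by blast
  \<comment> \<open>With \<open>n + 1\<close> vertices and \<open>c\<close> closing stems there are
    \<open>c + 1\<close> faces and \<open>n + c\<close> edges.\<close>
  then have "2 * (card (tree_vertices t) + card (orbit face_step ` half_edges t)) = card (half_edges t) + 4"
    using card_orbits[OF ne] card_half_edges by simp
  then have "card (verts (skeleton (closure_map t))) + card (faces (closure_map t)) = card (edges (closure_map t)) + 2"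
    using euler_iff[OF cmap_closure_map ne', unfolded closure_map_sel(1,2) orb]
    unfolding closure_map_sel(1) by blast
  moreover have "root_corner (closure_map t) \<in> corners (closure_map t)"
    using False by (simp add: corners_eq(1)[OF cmap_closure_map ne'] tree_root_corner_def)
  moreover have "outer_face (closure_map t) \<in> faces (closure_map t)"
  proof -
    obtain h where h: "h \<in> half_edges t" "enclosing t h = {}" using unenclosed_exists[OF ne] by blast
    have "outer_face (closure_map t) = Before ` orbit face_step h"
      unfolding outer_face_closure_map[OF False] orbit_of_unenclosed_eq[OF h] ..
    moreover have "faces (closure_map t) = (`) Before ` orbit face_step ` half_edges t"
      unfolding corners_eq(2)[OF cmap_closure_map ne'] closure_map_sel(2) orb ..
    ultimately show ?thesis using h(1) by simp
  qed
  ultimately show ?thesis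
    unfolding rooted_bipartite_plane_map_iff using cmap_closure_map closure_mate_outside by simp
qed

end

lemma well_charged_treeI: "t \<in> well_charged_trees_0 \<Longrightarrow> well_charged_tree t"
  by unfold_locales (simp_all add: well_charged_trees_0_def)

lemma degree_distribution_closure_map: "degree_distribution (closure_map t) = tree_degree_distribution t"
  by (simp add: fun_eq_iff degree_distribution_def tree_degree_distribution_def out_arcs_def)

lemma root_colour_closure_map: "root_colour (closure_map t) = vertex_colour t"
  by (simp add: root_colour_def tree_root_corner_def)

section \<open>The tree is determined by its closure\<close>

text \<open>The isomorphism carries the flow along, so the tree edges of both trees are optimal for
  the same lengths and correspond to each other by uniqueness. Since the root corner is preserved as
  well, the trees can be compared from the root downwards.\<close>

lemma closure_injective:
  assumes t: "t \<in> well_charged_trees_0" and t': "t' \<in> well_charged_trees_0"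
    and iso: "isomorphic_maps (closure_map t) (closure_map t')"
  shows "t = t'"
proof -
  interpret T: well_charged_tree t using t by (rule well_charged_treeI)
  interpret T': well_charged_tree t' using t' by (rule well_charged_treeI)
  let ?H = "half_edges t" and ?H' = "half_edges t'"
  obtain f g where fg0: "bij_betw f (tree_vertices t) (tree_vertices t')" "bij_betw g ?H ?H'"
    "\<forall>h \<in> ?H. origin (g h) = f (origin h)"
    "\<forall>h \<in> ?H. closure_mate t' (g h) = g (closure_mate t h)"
    "\<forall>h \<in> ?H. rot (closure_map t') (g h) = g (rot (closure_map t) h)"
    "\<forall>p \<in> tree_vertices t. vertex_colour (subtree t' (f p)) = vertex_colour (subtree t p)"
    "tree_root_corner t' = map_corner f g (tree_root_corner t)"
    "outer_face (closure_map t') = map_corner f g ` outer_face (closure_map t)"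
    using isomorphic_mapsE[OF iso, unfolded closure_map_sel(1-5,7,8)] by metis
  note fg = fg0(1,2) fg0(3-6)[THEN bspec] fg0(7,8)
  have g_in: "g h \<in> ?H'" if "h \<in> ?H" for h using fg(2) that by (rule bij_betwE[THEN bspec])
  have f_in: "f p \<in> tree_vertices t'" if "p \<in> tree_vertices t" for p using fg(1) that by (rule bij_betwE[THEN bspec])
  have g_next: "next_clockwise t' (g h) = g (next_clockwise t h)" if "h \<in> ?H" for h
    using fg(5)[OF that] that g_in[OF that] by simp
  have g_inj: "g h = g k \<longleftrightarrow> h = k" if "h \<in> ?H" "k \<in> ?H" for h k
    using fg(2) that by (auto simp: bij_betw_def inj_on_def)
  have g_surj: "\<exists>h \<in> ?H. k = g h" if "k \<in> ?H'" for k
    using fg(2) that by (auto simp: bij_betw_def)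
  have g_phi: "T'.phi (g h) = g (T.phi h)" if "h \<in> ?H" for h
    using that by (simp add: T.phi_def T'.phi_def fg(4) g_next T.closure_mate_in)
  have sign: "vertex_sign t' (f p) = vertex_sign t p" if "p \<in> tree_vertices t" for p
    using fg(6)[OF that] by (simp add: vertex_sign_def)
  have root: "f [] = []" "branches t = [] \<longleftrightarrow> branches t' = []"
    "branches t \<noteq> [] \<Longrightarrow> g (ToBranch [] 0) = ToBranch [] 0"
  proof -
    show br: "branches t = [] \<longleftrightarrow> branches t' = []"
      using fg(7) by (auto simp: tree_root_corner_def split: if_splits)
    show gr: "g (ToBranch [] 0) = ToBranch [] 0" if "branches t \<noteq> []"
      using fg(7) br that by (simp add: tree_root_corner_def)
    show "f [] = []"
    proof (cases "branches t = []")
      case True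
      then show ?thesis using fg(7) br by (simp add: tree_root_corner_def)
    next
      case False
      then have "ToBranch [] 0 \<in> ?H" by simp
      then show ?thesis using fg(3)[of "ToBranch [] 0"] gr[OF False] by simp
    qed
  qed
  have card_at: "card {k \<in> ?H'. origin k = f p} = card {h \<in> ?H. origin h = p}"
    and div_at: "(\<Sum>k | k \<in> ?H' \<and> origin k = f p. z k) = (\<Sum>h | h \<in> ?H \<and> origin h = p. z (g h))"
    if p: "p \<in> tree_vertices t" for p and z :: "half_edge \<Rightarrow> int"
  proof -
    have im: "{k \<in> ?H'. origin k = f p} = g ` {h \<in> ?H. origin h = p}"
    proof
      show "{k \<in> ?H'. origin k = f p} \<subseteq> g ` {h \<in> ?H. origin h = p}"
      proof
        fix k assume k: "k \<in> {k \<in> ?H'. origin k = f p}"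
        then obtain h where h: "h \<in> ?H" "k = g h" using g_surj by blast
        then have "f (origin h) = f p" using k fg(3) by simp
        then have "origin h = p"
          using fg(1) p origin_in_tree_vertices[OF h(1)] by (auto simp: bij_betw_def inj_on_def)
        then show "k \<in> g ` {h \<in> ?H. origin h = p}" using h by blast
      qed
      show "g ` {h \<in> ?H. origin h = p} \<subseteq> {k \<in> ?H'. origin k = f p}" using fg(3) g_in by auto
    qed
    have inj: "inj_on g {h \<in> ?H. origin h = p}" using g_inj by (auto simp: inj_on_def)
    show "card {k \<in> ?H'. origin k = f p} = card {h \<in> ?H. origin h = p}"
      unfolding im using inj by (rule card_image)
    show "(\<Sum>k | k \<in> ?H' \<and> origin k = f p. z k) = (\<Sum>h | h \<in> ?H \<and> origin h = p. z (g h))"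
      unfolding im using inj by (simp add: sum.reindex)
  qed
  obtain y where y: "T.antisymmetric y" "\<And>p. p \<in> tree_vertices t - {[]} \<Longrightarrow> T.divergence y p = 1"
    using T.unit_supply_flow_exists[of "[]"] by auto
  \<comment> \<open>One weight for both trees, larger than either number of vertices.\<close>
  define N where "N = int (tree_size t) + int (tree_size t') + 1"
  \<comment> \<open>The flow of \<open>t\<close> carried over to \<open>t'\<close>; as
    \<open>f\<close> fixes the root, the sink stays the root.\<close>
  define y' where "y' k = y (inv_into ?H g k)" for k
  have y'g: "y' (g h) = y h" if "h \<in> ?H" for h
    using fg(2) that by (simp add: y'_def bij_betw_def)
  have "T'.antisymmetric y'"
    unfolding T'.antisymmetric_def
  proof
    fix k assume "k \<in> ?H'"
    then obtain h where h: "h \<in> ?H" "k = g h" using g_surj by blast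
    then show "y' (closure_mate t' k) = - y' k"
      using y(1) y'g[OF h(1)] y'g[OF T.closure_mate_in[OF h(1)]] by (simp add: fg(4) T.antisymmetric_def)
  qed
  moreover have "T'.divergence y' q = 1" if q: "q \<in> tree_vertices t'" "q \<noteq> []" for q
  proof -
    obtain p where p: "p \<in> tree_vertices t" "q = f p" using fg(1) q(1) by (auto simp: bij_betw_def)
    then have "p \<noteq> []" using q(2) root(1) by auto
    have "T'.divergence y' q = (\<Sum>h | h \<in> ?H \<and> origin h = p. y' (g h))"
      unfolding T'.divergence_def p(2) using div_at[OF p(1)] .
    also have "\<dots> = T.divergence y p" unfolding T.divergence_def by (rule sum.cong) (auto simp: y'g)
    finally show ?thesis using y(2) p(1) \<open>p \<noteq> []\<close> by simp
  qed
  ultimately have opt': "T'.optimal {h \<in> ?H'. enclosing t' h = {}}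
      (\<lambda>h. N * vertex_sign t' (origin h) + y' h) {h \<in> ?H'. \<not> stem t' h}"
    by (intro T'.tree_edges_optimal) (auto simp: N_def)
  have opt: "T.optimal {h \<in> ?H. enclosing t h = {}}
      (\<lambda>h. N * vertex_sign t (origin h) + y h) {h \<in> ?H. \<not> stem t h}"
    by (intro T.tree_edges_optimal) (use y in \<open>auto simp: N_def\<close>)
  have outer: "enclosing t' (g h) = {} \<longleftrightarrow> enclosing t h = {}" if h: "h \<in> ?H" for h
  proof -
    have br: "branches t \<noteq> []" using h half_edges_empty_iff by blast
    then have br': "branches t' \<noteq> []" using root(2) by simp
    have "Before ` {h \<in> ?H'. enclosing t' h = {}} = map_corner f g ` Before ` {h \<in> ?H. enclosing t h = {}}"
      using fg(8) unfolding outer_face_closure_map[OF br] outer_face_closure_map[OF br'] .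
    then have "(Before ` {h \<in> ?H'. enclosing t' h = {}} :: (nat list, half_edge) corner set) =
        Before ` g ` {h \<in> ?H. enclosing t h = {}}"
      by (simp add: image_image)
    then have "{h \<in> ?H'. enclosing t' h = {}} = g ` {h \<in> ?H. enclosing t h = {}}"
      by (subst (asm) inj_image_eq_iff) (simp_all add: inj_def)
    then have "g h \<in> {h \<in> ?H'. enclosing t' h = {}} \<longleftrightarrow> g h \<in> g ` {h \<in> ?H. enclosing t h = {}}" by simp
    then show ?thesis using g_in[OF h] g_inj[OF h] h by auto
  qed
  \<comment> \<open>The tree edges of \<open>t'\<close> pulled back to \<open>t\<close>. They are
    optimal there by the potential \<open>D'\<close> composed with \<open>g\<close>.\<close>
  let ?X = "{h \<in> ?H. \<not> stem t' (g h)}" and ?F = "{h \<in> ?H. enclosing t h = {}}"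
  have "T.optimal ?F (\<lambda>h. N * vertex_sign t (origin h) + y h) ?X"
  proof -
    obtain D' where D0: "\<forall>k \<in> ?H'. D' (T'.phi k) = D' k"
      "\<forall>k \<in> {h \<in> ?H'. enclosing t' h = {}}. D' k = 0"
      "\<forall>k \<in> ?H'. T'.black k \<longrightarrow>
        0 \<le> N * vertex_sign t' (origin k) + y' k + D' k - D' (closure_mate t' k) \<and>
        (k \<in> {h \<in> ?H'. \<not> stem t' h} \<longleftrightarrow>
          0 < N * vertex_sign t' (origin k) + y' k + D' k - D' (closure_mate t' k))"
      using opt' unfolding T'.optimal_def by blast
    have D': "D' (T'.phi k) = D' k" "enclosing t' k = {} \<Longrightarrow> D' k = 0"
      "vertex_sign t' (origin k) = 1 \<Longrightarrow>
        0 \<le> N * vertex_sign t' (origin k) + y' k + D' k - D' (closure_mate t' k) \<and>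
        (\<not> stem t' k \<longleftrightarrow> 0 < N * vertex_sign t' (origin k) + y' k + D' k - D' (closure_mate t' k))"
      if "k \<in> ?H'" for k
      using D0 that by simp_all
    have reach: "\<exists>h \<in> ?H. k = g h \<and> dual_reach T.phi (closure_mate t) {h \<in> ?H. h \<notin> ?X \<and> T.black h} ?F h"
      if "dual_reach T'.phi (closure_mate t') {h \<in> ?H'. h \<notin> {h \<in> ?H'. \<not> stem t' h} \<and> T'.black h}
        {h \<in> ?H'. enclosing t' h = {}} k" for k
      using that
    proof (induction rule: dual_reach.induct)
      case (dual_reach_base k)
      then obtain h where h: "h \<in> ?H" "k = g h" using g_surj by blast
      then have "h \<in> ?F" using outer dual_reach_base by simp
      then show ?case using h dual_reach.dual_reach_base[of h ?F] by blast
    next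
      case (dual_reach_face k)
      then obtain h where h: "h \<in> ?H" "k = g h"
        "dual_reach T.phi (closure_mate t) {h \<in> ?H. h \<notin> ?X \<and> T.black h} ?F h" by blast
      show ?case
      proof (intro bexI conjI)
        show "T'.phi k = g (T.phi h)" using g_phi[OF h(1)] h(2) by simp
        show "dual_reach T.phi (closure_mate t) {h \<in> ?H. h \<notin> ?X \<and> T.black h} ?F (T.phi h)"
          by (rule dual_reach.dual_reach_face[OF h(3)])
        show "T.phi h \<in> ?H" by (rule T.phi_in[OF h(1)])
      qed
    next
      case (dual_reach_cross k)
      then obtain h where h: "h \<in> ?H" "k = g h"
        "dual_reach T.phi (closure_mate t) {h \<in> ?H. h \<notin> ?X \<and> T.black h} ?F h" by blast
      have "h \<in> {h \<in> ?H. h \<notin> ?X \<and> T.black h}"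
        using dual_reach_cross.hyps(2) h(1,2) sign[OF origin_in_tree_vertices[OF h(1)]] by (simp add: fg(3))
      note cross = dual_reach.dual_reach_cross[OF h(3) this]
      show ?case
      proof (intro bexI conjI)
        show "closure_mate t' k = g (closure_mate t h)" using fg(4)[OF h(1)] h(2) by simp
        show "dual_reach T.phi (closure_mate t) {h \<in> ?H. h \<notin> ?X \<and> T.black h} ?F (closure_mate t h)"
          by (rule cross)
        show "closure_mate t h \<in> ?H" by (rule T.closure_mate_in[OF h(1)])
      qed
    qed
    have "dual_reach T.phi (closure_mate t) {h \<in> ?H. h \<notin> ?X \<and> T.black h} ?F h" if h: "h \<in> ?H" for h
    proof -
      obtain h' where "h' \<in> ?H" "g h = g h'"
        "dual_reach T.phi (closure_mate t) {h \<in> ?H. h \<notin> ?X \<and> T.black h} ?F h'"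
        using reach[OF T'.dual_reach_all[OF g_in[OF h]]] by blast
      then show ?thesis using g_inj[OF h] by simp
    qed
    moreover have "closure_mate t h \<in> ?X" if "h \<in> ?X" for h
      using that T'.closure_mate_stem[OF g_in, of h] by (simp add: fg(4) T.closure_mate_in)
    moreover have "\<forall>h \<in> ?H. D' (g (T.phi h)) = D' (g h)" using D'(1) g_phi g_in by metis
    moreover have "\<forall>h \<in> ?F. D' (g h) = 0" using D'(2) outer g_in by simp
    moreover have "\<forall>h \<in> ?H. T.black h \<longrightarrow>
        0 \<le> N * vertex_sign t (origin h) + y h + D' (g h) - D' (g (closure_mate t h)) \<and>
        (h \<in> ?X \<longleftrightarrow> 0 < N * vertex_sign t (origin h) + y h + D' (g h) - D' (g (closure_mate t h)))"
    proof (intro ballI impI)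
      fix h assume h: "h \<in> ?H" "T.black h"
      have "vertex_sign t' (origin (g h)) = vertex_sign t (origin h)"
        using fg(3)[OF h(1)] sign[OF origin_in_tree_vertices[OF h(1)]] by simp
      then show "0 \<le> N * vertex_sign t (origin h) + y h + D' (g h) - D' (g (closure_mate t h)) \<and>
        (h \<in> ?X \<longleftrightarrow> 0 < N * vertex_sign t (origin h) + y h + D' (g h) - D' (g (closure_mate t h)))"
        using D'(3)[OF g_in[OF h(1)]] h y'g[OF h(1)] fg(4)[OF h(1)] by simp
    qed
    ultimately show ?thesis
      unfolding T.optimal_def by (intro conjI exI[of _ "D' \<circ> g"]) simp_all
  qed
  from T.optimal_unique[OF _ opt this] have X_eq: "{h \<in> ?H. \<not> stem t h} = ?X" by auto
  have stem_iff: "stem t' (g h) \<longleftrightarrow> stem t h" if "h \<in> ?H" for h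
  proof -
    have "h \<in> {h \<in> ?H. \<not> stem t h} \<longleftrightarrow> h \<in> ?X" by (simp only: X_eq)
    then show ?thesis using that by simp
  qed
  \<comment> \<open>\<open>g\<close> commutes with the rotations, so it fixes all half-edges at a
    vertex once it fixes the first; equal degrees make the two lists equal.\<close>
  have at_vertex: "half_edges_at t' p = half_edges_at t p \<and> (\<forall>h \<in> ?H. origin h = p \<longrightarrow> g h = h)"
    if p: "p \<in> tree_vertices t" "p \<in> tree_vertices t'" "f p = p"
      and start: "half_edges_at t p \<noteq> [] \<Longrightarrow> g (hd (half_edges_at t p)) = hd (half_edges_at t p)" for p
  proof -
    let ?L = "half_edges_at t p" and ?L' = "half_edges_at t' p"
    have set_L: "set ?L = {h \<in> ?H. origin h = p}" "set ?L' = {h \<in> ?H'. origin h = p}"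
      using p by (simp_all add: set_half_edges_at)
    have dist: "distinct ?L" "distinct ?L'" using half_edges_at_cyclic by (auto simp: cyclic_list_def)
    have "card (set ?L') = card (set ?L)" using card_at[OF p(1)] p(3) set_L by simp
    then have len: "length ?L' = length ?L" using dist by (simp add: distinct_card)
    then have br: "length (branches (subtree t' p)) = length (branches (subtree t p))"
      by (auto simp: half_edges_at_def split: if_splits)
    then have L_eq: "?L' = ?L" by (simp add: half_edges_at_def)
    have "map g ?L = ?L"
    proof (cases "?L = []")
      case False
      have w: "walk (next_clockwise t) ?L" "walk (next_clockwise t') ?L"
        using cyclic_list_walk half_edges_at_cyclic L_eq by metis+
      have "walk (next_clockwise t') (map g ?L)"
      proof (rule walkI)
        fix i assume i: "Suc i < length (map g ?L)"
        then have "?L ! i \<in> ?H" using nth_mem[of i ?L] set_L(1) by auto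
        then show "map g ?L ! Suc i = next_clockwise t' (map g ?L ! i)"
          using i walk_nth[OF w(1), of i] g_next by simp
      qed
      then show ?thesis
        using w(2) start[OF False] False by (intro walk_unique[of "next_clockwise t'"]) (simp_all add: hd_map)
    qed simp
    then have "\<forall>h \<in> set ?L. g h = h" by (metis map_eq_conv map_ident)
    then show ?thesis using L_eq set_L(1) by simp
  qed
  \<comment> \<open>Going down the tree: if the half-edge to a child is fixed, so is its mate, which
    is the first half-edge at the child.\<close>
  have fixed: "p \<in> tree_vertices t' \<and> f p = p \<and> half_edges_at t' p = half_edges_at t p \<and>
      (\<forall>h \<in> ?H. origin h = p \<longrightarrow> g h = h)" if "p \<in> tree_vertices t" for p
    using that
  proof (induction p rule: rev_induct)
    case Nil
    have "g (hd (half_edges_at t [])) = hd (half_edges_at t [])" if "half_edges_at t [] \<noteq> []"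
    proof -
      have "branches t \<noteq> []" using that by (auto simp: half_edges_at_def)
      moreover from this have "hd (half_edges_at t []) = ToBranch [] 0"
        by (simp add: half_edges_at_def hd_map hd_upt)
      ultimately show ?thesis using root(3) by simp
    qed
    then show ?case using at_vertex[of "[]"] root(1) by simp
  next
    case (snoc i p)
    let ?q = "p @ [i]" and ?h = "ToBranch p i"
    have p: "p \<in> tree_vertices t" using snoc.prems tree_vertices_prefix by blast
    have h: "?h \<in> ?H" "\<not> stem t ?h"
      using snoc.prems by (auto simp: snoc_in_tree_vertices_iff stem_def)
    have gh: "g ?h = ?h" using snoc.IH[OF p] h(1) by simp
    have h': "?h \<in> ?H'" "\<not> stem t' ?h" using g_in[OF h(1)] stem_iff[OF h(1)] h(2) gh by simp_all
    then have q': "?q \<in> tree_vertices t'" by simp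
    have "g (ToParent ?q) = ToParent ?q"
      using fg(4)[OF h(1)] gh closure_mate_neutral[OF h] closure_mate_neutral[OF h'] by simp
    moreover have "ToParent ?q \<in> ?H" using snoc.prems by simp
    ultimately have "f ?q = ?q" using fg(3)[of "ToParent ?q"] by simp
    then show ?case
      using at_vertex[OF snoc.prems q'] \<open>g (ToParent ?q) = ToParent ?q\<close> q'
      by (simp add: half_edges_at_def)
  qed
  show "t = t'"
  proof (rule tree_eqI)
    fix p s s' assume s: "subtree_at t p = Some s" "subtree_at t' p = Some s'"
    have p: "p \<in> tree_vertices t" "p \<in> tree_vertices t'" "subtree t p = s" "subtree t' p = s'"
      using s by (auto simp: tree_vertices_def)
    note F = fixed[OF p(1)]
    have col: "vertex_colour s = vertex_colour s'" using fg(6)[OF p(1)] F p by simp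
    have "length (half_edges_at t' p) = length (half_edges_at t p)" using F by simp
    then have len: "length (branches s) = length (branches s')"
      using p by (auto simp: half_edges_at_def split: if_splits)
    have "same_kind (branches s ! i) (branches s' ! i)" if i: "i < length (branches s)" for i
    proof -
      let ?h = "ToBranch p i"
      have h: "?h \<in> ?H" "?h \<in> ?H'" using i len p by simp_all
      then have st: "stem t' ?h \<longleftrightarrow> stem t ?h" using F stem_iff[OF h(1)] by simp
      \<comment> \<open>The sign of the vertex decides whether a stem opens or closes, so it is
        enough that stems correspond to stems.\<close>
      have sg: "vertex_sign t p = vertex_sign t' p" using col p by (simp add: vertex_sign_def)
      show ?thesis
      proof (cases "branches s ! i")
        case Opening
        then have o: "opening_stem t ?h" using i p by simp
        then have "vertex_sign t' p = 1" using vertex_sign_stem(1)[OF T.coloured h(1)] sg by simp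
        moreover have "stem t' ?h" using o st by (simp add: stem_def)
        ultimately have "opening_stem t' ?h"
          using vertex_sign_stem(2)[OF T'.coloured h(2)] by (auto simp: stem_def)
        then show ?thesis using Opening p by simp
      next
        case Closing
        then have o: "closing_stem t ?h" using i p by simp
        then have "vertex_sign t' p = - 1" using vertex_sign_stem(2)[OF T.coloured h(1)] sg by simp
        moreover have "stem t' ?h" using o st by (simp add: stem_def)
        ultimately have "closing_stem t' ?h"
          using vertex_sign_stem(1)[OF T'.coloured h(2)] by (auto simp: stem_def)
        then show ?thesis using Closing p by simp
      next
        case (Edge r)
        then have "\<not> stem t ?h" using p by (simp add: stem_def)
        then have "?h \<in> ?H' \<and> \<not> stem t' ?h" using st h(2) by simp
        then obtain r' where "branches s' ! i = Edge r'" using p(4) by (auto simp: snoc_in_tree_vertices_iff)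
        then show ?thesis using Edge by simp
      qed
    qed
    then show "vertex_colour s = vertex_colour s' \<and> list_all2 same_kind (branches s) (branches s')"
      using col len by (simp add: list_all2_conv_all_nth)
  qed
qed

section \<open>Every plane map is the closure of a tree\<close>

lemma trivial_map_is_closure:
  assumes M: "rooted_bipartite_plane_map M" and "arcs (skeleton M) = {}"
  shows "\<exists>t \<in> well_charged_trees_0. isomorphic_maps (closure_map t) M"
proof -
  interpret cmap "verts (skeleton M)" "arcs (skeleton M)" "tail (skeleton M)" "rot M" "mate M" "map_sign M"
    using M by (rule rooted_bipartite_plane_map_cmap)
  obtain v where v: "v \<in> verts (skeleton M)" using V_nonempty by blast
  then have V: "verts (skeleton M) = {v}" using V_singleton assms(2) by blast
  have corners: "corners M = {Isolated v}" using V assms(2) by (auto simp: corners_def out_arcs_def)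
  have "orbit (next_corner M) (Isolated v) = {Isolated v}" by (simp add: orbit_eq_singleton_iff)
  then have "faces M = {{Isolated v}}" by (simp add: faces_def corners)
  then have face: "outer_face M = {Isolated v}" and root: "root_corner M = Isolated v"
    using M corners by (simp_all add: rooted_bipartite_plane_map_iff)
  let ?t = "Vertex (colour_of M v) []"
  have "branches ?t = []" by simp
  note T = trivial_tree[OF this]
  have "well_charged ?t" by (simp add: well_charged_def T)
  then have "?t \<in> well_charged_trees_0" by (simp add: well_charged_trees_0_def)
  moreover have "isomorphic_maps (closure_map ?t) M"
    unfolding isomorphic_maps_def
    by (intro exI[of _ "\<lambda>_. v"] exI[of _ undefined])
       (simp add: T V assms(2) face root bij_betw_def del: closure_map_sel(9))
  ultimately show ?thesis by blast
qed

section \<open>Opening a map along shortest dual paths\<close>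

locale opened_map = shortest_dual_paths +
  fixes r :: 'a and y :: "'b \<Rightarrow> int" and N :: int and h0 :: 'b
  assumes h0_in: "h0 \<in> H" and r: "r = tl h0"
    and y: "antisymmetric y" "v \<in> V \<Longrightarrow> v \<noteq> r \<Longrightarrow> divergence y v = 1"
    and N: "int (card V) < N"
    and ls: "ls h = N * sg (tl h) + y h"
    and D_le: "h \<in> H \<Longrightarrow> sg (tl h) = 1 \<Longrightarrow> 0 \<le> ls h + D h - D (mt h)"
    and euler: "2 * (card V + card (orbit phi ` H)) = card H + 4"
begin

sublocale spanning_tree V H tl rt mt sg tree_part h0
  by unfold_locales
    (use tree_part_subset mt_tree_part tree_part_connected card_tree_part[OF euler] h0_in in blast)+

definition label :: "'b \<Rightarrow> half_edge" where "label = inv_into (half_edges tree) half_edge_at"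

lemma label_half_edge_at: "h \<in> half_edges tree \<Longrightarrow> label (half_edge_at h) = h"
  using half_edge_at_bij by (simp add: label_def bij_betw_def)

lemma label_props:
  assumes "k \<in> H"
  shows "label k \<in> half_edges tree" "half_edge_at (label k) = k"
proof -
  have "k \<in> half_edge_at ` half_edges tree" using half_edge_at_bij assms by (simp add: bij_betw_def)
  then show "label k \<in> half_edges tree" "half_edge_at (label k) = k"
    by (auto simp: label_def inv_into_into f_inv_into_f)
qed

lemma H_cases: "h \<in> H \<Longrightarrow> h \<notin> tree_part \<longleftrightarrow> h \<in> openers \<or> h \<in> closers"
  by (auto simp: tree_part_def)

lemma stem_label:
  assumes "k \<in> H"
  shows "opening_stem tree (label k) \<longleftrightarrow> k \<in> openers" "closing_stem tree (label k) \<longleftrightarrow> k \<in> closers"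
  using opening_stem_tree_iff[OF label_props(1)[OF assms]] label_props(2)[OF assms]
    H_cases[OF assms] openers_props closers_props by auto

text \<open>Links the contour of the unfolded tree to the one foreseen in the map, so that
  \<open>closer_walk\<close> yields matched stems.\<close>

lemma tour_label:
  assumes "k \<in> H"
  shows "tour tree (label k) = label (tau k)"
proof -
  note l = label_props[OF assms]
  have st: "stem tree (label k) \<longleftrightarrow> k \<notin> tree_part" using stem_tree_iff[OF l(1)] l(2) by simp
  have "half_edge_at (tour tree (label k)) = tau k"
  proof (cases "k \<in> tree_part")
    case True
    then have "half_edge_at (tree_mate (label k)) = mt k" "tree_mate (label k) \<in> half_edges tree"
      using half_edge_at_tree_mate[OF l(1)] tree_mate_simps(1)[OF l(1)] st l(2) by simp_all
    then show ?thesis using True st half_edge_at_props(3) by (simp add: tour_def tau_def phi_def)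
  next
    case False
    then show ?thesis using st half_edge_at_props(3)[OF l(1)] l(2) by (simp add: tour_def tau_def)
  qed
  then show ?thesis using label_half_edge_at[OF tour_in_half_edges[OF l(1)]] by simp
qed

text \<open>The nested walk from an opener to its closer becomes a piece of the contour of the tree,
  so the closure glues together exactly what was cut.\<close>

lemma closer_closure_edge:
  assumes "g \<in> face_set - {F}"
  shows "\<exists>u. closure_edge tree (label (mt (closer g))) (map label u) (label (closer g)) \<and>
    g \<subseteq> set (u @ [closer g]) \<and> set (u @ [closer g]) \<subseteq> H - F"
proof -
  note c = closer_props[OF assms]
  obtain u where u: "nested u" "walk tau (mt (closer g) # u @ [closer g])" "g \<subseteq> set (u @ [closer g])"
    "set (u @ [closer g]) \<subseteq> H - F" using closer_walk[OF assms] by blast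
  have m: "mt (closer g) \<in> H" using c(2) mt_in by blast
  let ?w = "mt (closer g) # u @ [closer g]"
  have w: "set ?w \<subseteq> H" using u(4) m by auto
  have cl: "closer g \<in> closers" using assms by (auto simp: closers_def)
  have "balanced tree (map label u)"
    unfolding balanced_iff_wbal by (rule wbal_map[OF u(1)]) (use stem_label w in auto)
  moreover have "opening_stem tree (label (mt (closer g)))" "closing_stem tree (label (closer g))"
    using stem_label m c(2) cl mt_closers by simp_all
  moreover have "walk (tour tree) (map label ?w)"
  proof (rule walkI)
    fix i assume i: "Suc i < length (map label ?w)"
    then have i': "Suc i < length ?w" by (simp only: length_map)
    then have "?w ! i \<in> H" using w nth_mem[of i ?w] by (meson Suc_lessD subsetD)
    then have "tour tree (label (?w ! i)) = label (?w ! Suc i)"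
      using walk_nth[OF u(2) i'] tour_label by simp
    then show "map label ?w ! Suc i = tour tree (map label ?w ! i)"
      using i' by (simp only: nth_map Suc_lessD)
  qed
  moreover have "distinct (map label ?w)"
  proof -
    have "inj_on label H" using label_props(2) by (rule inj_on_inverseI)
    then have "inj_on label (set ?w)" using w by (rule inj_on_subset)
    then show ?thesis using closer_walk_distinct[OF u(2) m u(4)] by (simp only: distinct_map)
  qed
  ultimately have "closure_edge tree (label (mt (closer g))) (map label u) (label (closer g))"
    by (intro closure_edgeI) simp_all
  then show ?thesis using u(3,4) by blast
qed

lemma closure_mate_half_edge_at:
  assumes "h \<in> half_edges tree"
  shows "half_edge_at (closure_mate tree h) = mt (half_edge_at h)"
proof (cases "stem tree h")
  case False
  then show ?thesis using half_edge_at_tree_mate[OF assms] closure_mate_neutral[OF assms] by simp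
next
  case True
  let ?k = "half_edge_at h"
  have k: "?k \<in> H" "label ?k = h" using half_edge_at_props(1) label_half_edge_at assms by simp_all
  have "?k \<in> openers \<or> ?k \<in> closers" using True stem_tree_iff[OF assms] H_cases k(1) by blast
  then obtain g where g: "g \<in> face_set - {F}" "?k = mt (closer g) \<or> ?k = closer g"
    unfolding openers_def closers_def by blast
  note c = closer_props[OF g(1)]
  obtain u where "closure_edge tree (label (mt (closer g))) u (label (closer g))"
    using closer_closure_edge[OF g(1)] by blast
  note e = closure_mate_closure_edge[OF this]
  have m: "mt (closer g) \<in> H" using c(2) mt_in by blast
  from g(2) show ?thesis
  proof
    assume "?k = mt (closer g)"
    then have "closure_mate tree h = label (closer g)" using e(1) k(2) by simp
    then show ?thesis using label_props(2)[OF c(2)] mt_mt[OF c(2)] \<open>?k = mt (closer g)\<close> by simp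
  next
    assume "?k = closer g"
    then have "closure_mate tree h = label (mt (closer g))" using e(2) k(2) by simp
    then show ?thesis using label_props(2)[OF m] \<open>?k = closer g\<close> by simp
  qed
qed

text \<open>The walk to the closer of a face covers this face, and all these walks avoid
  \<open>F\<close>.\<close>

lemma enclosing_iff_F:
  assumes "h \<in> half_edges tree"
  shows "enclosing tree h = {} \<longleftrightarrow> half_edge_at h \<in> F"
proof
  let ?k = "half_edge_at h"
  have k: "?k \<in> H" "label ?k = h" using half_edge_at_props(1) label_half_edge_at assms by simp_all
  {
    assume e: "enclosing tree h = {}"
    show "?k \<in> F"
    proof (rule ccontr)
      assume nF: "?k \<notin> F"
      let ?g = "orbit phi ?k"
      have g: "?g \<in> face_set - {F}" "?k \<in> ?g" using nF k phi_self by auto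
      obtain u where u: "closure_edge tree (label (mt (closer ?g))) (map label u) (label (closer ?g))"
        "?g \<subseteq> set (u @ [closer ?g])" using closer_closure_edge[OF g(1)] by blast
      have "label ?k \<in> label ` set (u @ [closer ?g])" using u(2) g(2) by blast
      then have "h \<in> insert (label (closer ?g)) (set (map label u))" using k(2) by auto
      then show False using e u(1) unfolding enclosing_def by blast
    qed
  }
  assume F: "?k \<in> F"
  show "enclosing tree h = {}"
  proof (rule ccontr)
    assume "enclosing tree h \<noteq> {}"
    then obtain a u b where ab: "closure_edge tree a u b" "h \<in> insert b (set u)" by (auto simp: enclosing_def)
    note D = closure_edgeD[OF ab(1)]
    have a: "a \<in> half_edges tree" using D(6) by simp
    then have "half_edge_at a \<in> openers"
      using stem_label(1)[OF half_edge_at_props(1)] label_half_edge_at D(1) by metis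
    then obtain g where g: "g \<in> face_set - {F}" "half_edge_at a = mt (closer g)"
      unfolding openers_def closers_def by blast
    obtain u' where u': "closure_edge tree (label (mt (closer g))) (map label u') (label (closer g))"
      "set (u' @ [closer g]) \<subseteq> H - F" using closer_closure_edge[OF g(1)] by blast
    have "label (mt (closer g)) = a" using label_half_edge_at[OF a] g(2) by simp
    then have "u = map label u'" "b = label (closer g)"
      using closure_edge_unique_closing[OF ab(1), of "map label u'" "label (closer g)"] u'(1) by simp_all
    then have "h \<in> label ` set (u' @ [closer g])" using ab(2) by auto
    then obtain x where x: "x \<in> H - F" "h = label x" using u'(2) by blast
    then have "?k = x" using label_props(2) by simp
    then show False using F x(1) by simp
  qed
qed

text \<open>Openers and closers correspond under \<open>mt\<close>, and they enter the height of the
  contour with opposite signs.\<close>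

lemma charge_tree: "charge tree = 0"
proof -
  define val where "val k = (if k \<in> openers then 1 else if k \<in> closers then - 1 else (0::int))" for k
  have fin: "finite openers" "finite closers"
    using openers_props(1) closers_props(1) finite_H by (meson finite_subset subsetI)+
  have disj: "openers \<inter> closers = {}" using openers_props(2) closers_props(2) by blast
  have "stems.height tree (contour tree) =
      (\<Sum>h \<in> half_edges tree. if opening_stem tree h then 1 else if closing_stem tree h then - 1 else 0)"
    unfolding stems.height_def set_contour[symmetric]
    by (rule sum.distinct_set_conv_list[OF distinct_contour, symmetric])
  also have "\<dots> = (\<Sum>h \<in> half_edges tree. val (half_edge_at h))"
  proof (rule sum.cong)
    fix h assume h: "h \<in> half_edges tree"
    note s = stem_label[OF half_edge_at_props(1)[OF h]]
    show "(if opening_stem tree h then 1 else if closing_stem tree h then - 1 else 0) = val (half_edge_at h)"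
      using s by (simp add: label_half_edge_at[OF h] val_def)
  qed simp
  also have "\<dots> = (\<Sum>k \<in> H. val k)" by (rule sum.reindex_bij_betw[OF half_edge_at_bij])
  also have "\<dots> = (\<Sum>k \<in> openers \<union> closers. val k)"
    using openers_props(1) closers_props(1) finite_H by (intro sum.mono_neutral_right) (auto simp: val_def)
  also have "\<dots> = (\<Sum>k \<in> openers. val k) + (\<Sum>k \<in> closers. val k)"
    using fin disj by (rule sum.union_disjoint)
  also have "(\<Sum>k \<in> openers. val k) = int (card openers)" by (simp add: val_def)
  also have "(\<Sum>k \<in> closers. val k) = (\<Sum>k \<in> closers. - 1)"
    by (rule sum.cong) (use disj in \<open>auto simp: val_def\<close>)
  also have "card openers = card closers"
    unfolding openers_def using mt_bij closers_props(1) by (intro card_image) (auto simp: bij_betw_def inj_on_def)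
  finally show ?thesis using height_contour[of tree] by simp
qed

lemma tree_well_charged: "well_charged tree"
proof -
  define xs where "xs k = ls k + D k - D (mt k)" for k
  have anti: "xs (mt k) = - xs k" if "k \<in> H" for k
    using that y(1) sg_mt mt_mt by (simp add: xs_def ls antisymmetric_def)
  have zero: "xs k = 0" if k: "k \<in> H" "k \<notin> tree_part" for k
  proof -
    obtain g where g: "g \<in> face_set - {F}" "k = mt (closer g) \<or> k = closer g"
      using H_cases[OF k(1)] k(2) unfolding openers_def closers_def by blast
    note c = closer_props[OF g(1)]
    have "xs (mt (closer g)) = 0" using c(5) mt_mt[OF c(2)] by (simp add: xs_def)
    then show ?thesis using g(2) anti[OF c(2)] by auto
  qed
  have tvs: "vertex_sign tree p = sg (vertex_at p)" if "p \<in> tree_vertices tree" for p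
    using vertex_at_props(1,3)[OF that] sg_cases[of "vertex_at p"]
    by (auto simp: vertex_sign_def colour_at_def)
  have at: "bij_betw half_edge_at {h \<in> half_edges tree. origin h = p} {k \<in> H. tl k = vertex_at p}"
    if p: "p \<in> tree_vertices tree" for p
  proof -
    have "half_edge_at ` set (half_edges_at tree p) = set (around (vertex_at p))"
      using map_half_edges_at[OF p] by (metis list.set_map)
    then have "half_edge_at ` {h \<in> half_edges tree. origin h = p} = {k \<in> H. tl k = vertex_at p}"
      using set_half_edges_at[OF p] around_props(4)[OF vertex_at_props(1)[OF p]] by simp
    moreover have "inj_on half_edge_at {h \<in> half_edges tree. origin h = p}"
      using half_edge_at_bij by (auto simp: bij_betw_def inj_on_def)
    ultimately show ?thesis by (simp add: bij_betw_def)
  qed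
  have div: "(\<Sum>h | h \<in> half_edges tree \<and> origin h = p. xs (half_edge_at h)) =
      N * vertex_sign tree p * int (card {h \<in> half_edges tree. origin h = p}) + 1"
    if p: "p \<in> tree_vertices tree" "p \<noteq> []" for p
  proof -
    let ?v = "vertex_at p"
    have v: "?v \<in> V" "?v \<noteq> r" using vertex_at_props(1)[OF p(1)] vertex_at_eq_root[OF p(1)] p(2) r by (simp_all add: root_def)
    have "(\<Sum>h | h \<in> half_edges tree \<and> origin h = p. xs (half_edge_at h)) = divergence xs ?v"
      unfolding divergence_def by (rule sum.reindex_bij_betw[OF at[OF p(1)]])
    also have "\<dots> = divergence ls ?v"
      unfolding xs_def by (rule divergence_potential) (rule D_phi)
    also have "\<dots> = N * sg ?v * int (card {k \<in> H. tl k = ?v}) + divergence y ?v"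
      by (simp add: divergence_def ls sum.distrib)
    finally show ?thesis
      using y(2)[OF v] tvs[OF p(1)] bij_betw_same_card[OF at[OF p(1)]] by simp
  qed
  have flow: "xs (half_edge_at (ToParent p)) =
      N * (vertex_sign tree p - charge (subtree tree p)) + int (tree_size (subtree tree p))"
    if p: "p \<in> tree_vertices tree" "p \<noteq> []" for p
  proof (rule tree_flow[OF properly_coloured_tree, where xs = "\<lambda>h. xs (half_edge_at h)"])
    show "xs (half_edge_at (tree_mate h)) = - xs (half_edge_at h)" if "h \<in> half_edges tree" "\<not> stem tree h" for h
      using half_edge_at_tree_mate[OF that] anti[OF half_edge_at_props(1)[OF that(1)]] by simp
    show "xs (half_edge_at h) = 0" if "h \<in> half_edges tree" "stem tree h" for h
      using zero half_edge_at_props(1)[OF that(1)] stem_tree_iff[OF that(1)] that(2) by blast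
  qed (use div p in auto)
  have nonneg: "0 \<le> sg (tl k) * xs k" if k: "k \<in> H" for k
  proof (cases "black k")
    case True
    then show ?thesis using D_le[OF k] by (simp add: xs_def)
  next
    case False
    then have "sg (tl k) = - 1" "black (mt k)" using sg_h[OF k] sg_mt[OF k] by auto
    then show ?thesis using D_le[OF mt_in[OF k]] anti[OF k] by (simp add: xs_def)
  qed
  have "tree_size tree = card V"
    unfolding tree_size_def using vertex_at_bij by (rule bij_betw_same_card)
  then have size: "0 < tree_size (subtree tree p)" "int (tree_size (subtree tree p)) < N"
    if "p \<in> tree_vertices tree" for p
    using tree_size_pos tree_size_subtree[OF subtree_at_Some[OF that]] N by auto
  \<comment> \<open>Feasibility of \<open>D\<close> only gives a weak inequality for the flow. As
    the size lies strictly between 0 and \<open>N\<close>, a charge that misses its bound by one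
    already violates it.\<close>
  have charge: "(vertex_colour (subtree tree p) = Black \<longrightarrow> charge (subtree tree p) \<le> 1) \<and>
      (vertex_colour (subtree tree p) = White \<longrightarrow> 0 \<le> charge (subtree tree p))"
    if p: "p \<in> tree_vertices tree" "p \<noteq> []" for p
  proof -
    let ?c = "charge (subtree tree p)"
    have h: "ToParent p \<in> half_edges tree" using p by simp
    have "sg (tl (half_edge_at (ToParent p))) = vertex_sign tree p"
      using half_edge_at_props(2)[OF h] tvs[OF p(1)] by simp
    then have pos: "0 \<le> vertex_sign tree p * (N * (vertex_sign tree p - ?c) + int (tree_size (subtree tree p)))"
      using nonneg[OF half_edge_at_props(1)[OF h]] flow[OF p] by simp
    have "?c \<le> 1" if "vertex_colour (subtree tree p) = Black"
    proof (rule ccontr)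
      assume "\<not> ?c \<le> 1"
      then have "N * (1 - ?c) \<le> N * (- 1)" using size[OF p(1)] by (intro mult_left_mono) auto
      then show False using pos size[OF p(1)] that by (simp add: vertex_sign_def)
    qed
    moreover have "0 \<le> ?c" if "vertex_colour (subtree tree p) = White"
    proof (rule ccontr)
      assume "\<not> 0 \<le> ?c"
      then have "N * 0 \<le> N * (- 1 - ?c)" using size[OF p(1)] by (intro mult_left_mono) auto
      then show False using pos size[OF p(1)] that by (simp add: vertex_sign_def)
    qed
    ultimately show ?thesis by blast
  qed
  show ?thesis
    using properly_coloured_tree charge unfolding well_charged_def properly_coloured_def by blast
qed

end

lemma map_is_closure:
  assumes M: "rooted_bipartite_plane_map M"
  shows "\<exists>t \<in> well_charged_trees_0. isomorphic_maps (closure_map t) M"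
proof (cases "arcs (skeleton M) = {}")
  case True
  then show ?thesis using trivial_map_is_closure[OF M] by blast
next
  case False
  let ?V = "verts (skeleton M)" and ?H = "arcs (skeleton M)"
  have cm: "cmap ?V ?H (tail (skeleton M)) (rot M) (mate M) (map_sign M)"
    using M by (rule rooted_bipartite_plane_map_cmap)
  then interpret cmap ?V ?H "tail (skeleton M)" "rot M" "mate M" "map_sign M" .
  note ce = corners_eq[OF cm False]
  have phi: "(\<lambda>h. rot M (mate M h)) = phi" by (simp add: fun_eq_iff phi_def)
  have R: "card ?V + card (faces M) = card (edges M) + 2" "root_corner M \<in> corners M" "outer_face M \<in> faces M"
    "\<And>h. h \<in> ?H \<Longrightarrow> head (skeleton M) h = tail (skeleton M) (mate M h)"
    using M by (simp_all add: rooted_bipartite_plane_map_iff)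
  have euler: "2 * (card ?V + card (orbit phi ` ?H)) = card ?H + 4"
    using R(1) euler_iff[OF cm False] by (simp add: phi)
  obtain h0 where h0: "h0 \<in> ?H" "root_corner M = Before h0" using R(2) ce(1) by auto
  obtain F where F: "F \<in> orbit phi ` ?H" "outer_face M = Before ` F" using R(3) ce(2) phi by auto
  then obtain k where k: "k \<in> ?H" "F = orbit phi k" by blast
  obtain y where y: "antisymmetric y" "\<And>v. v \<in> ?V - {tail (skeleton M) h0} \<Longrightarrow> divergence y v = 1"
    using unit_supply_flow_exists[OF tl_in[OF h0(1)]] by blast
  \<comment> \<open>\<open>card ?V\<close> bounds the sizes of all subtrees, and the sum of absolute
    values makes the length \<open>N + y h\<close> of each black half-edge positive.\<close>
  define N where "N = 1 + int (card ?V) + (\<Sum>h \<in> ?H. \<bar>y h\<bar>)"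
  define ls where "ls h = N * map_sign M (tail (skeleton M) h) + y h" for h
  have y_le: "\<bar>y h\<bar> \<le> (\<Sum>h \<in> ?H. \<bar>y h\<bar>)" if "h \<in> ?H" for h
    using member_le_sum[of h ?H "\<lambda>h. \<bar>y h\<bar>"] finite_H that by simp
  have ls_pos: "0 < ls h" if "h \<in> ?H" "black h" for h
    using y_le[OF that(1)] that(2) by (simp add: ls_def N_def)
  have F_sub: "F \<subseteq> ?H" using bij_orbit_subset[OF phi_bij finite_H k(1)] k(2) by simp
  have F_ne: "F \<noteq> {}" using bij_self_in_orbit[OF phi_bij finite_H k(1)] k(2) by blast
  have F_phi: "phi h \<in> F \<longleftrightarrow> h \<in> F" if h: "h \<in> ?H" for h
  proof
    assume "h \<in> F"
    then show "phi h \<in> F" using k(2) by (simp add: orbit.step)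
  next
    assume "phi h \<in> F"
    then have "orbit phi (phi h) = F" using bij_orbit_eq[OF phi_bij finite_H k(1)] k(2) by simp
    then have "orbit phi h = F" using bij_orbit_step[OF phi_bij finite_H h] by simp
    then show "h \<in> F" using bij_self_in_orbit[OF phi_bij finite_H h] by simp
  qed
  obtain D :: "_ \<Rightarrow> int" where D0: "\<forall>h \<in> ?H. D (phi h) = D h" "\<forall>h \<in> F. D h = 0"
    "\<forall>h \<in> ?H. black h \<longrightarrow> 0 \<le> ls h + D h - D (mate M h)"
    "\<forall>h \<in> ?H - F. \<exists>h' \<in> orbit phi h. \<not> black h' \<and> ls (mate M h') + D (mate M h') - D h' = 0"
    using shortest_distance_exists[of F ls, OF F_sub F_ne F_phi ls_pos] by blast
  note D = D0(1)[THEN bspec] D0(2)[THEN bspec] D0(3)[THEN bspec, THEN mp] D0(4)[THEN bspec]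
  have "0 \<le> (\<Sum>h \<in> ?H. \<bar>y h\<bar>)" by (rule sum_nonneg) simp
  then have N: "int (card ?V) < N" unfolding N_def by linarith
  interpret O: opened_map ?V ?H "tail (skeleton M)" "rot M" "mate M" "map_sign M" F ls D
      "tail (skeleton M) h0" y N h0
    by unfold_locales
      (use F(1) ls_pos D h0(1) y N euler in \<open>auto simp: ls_def\<close>)
  let ?t = O.tree
  have t: "?t \<in> well_charged_trees_0"
    using O.tree_well_charged O.charge_tree by (simp add: well_charged_trees_0_def)
  have "isomorphic_maps (closure_map ?t) M"
    unfolding isomorphic_maps_def
  proof (intro exI conjI)
    show "bij_betw O.vertex_at (verts (skeleton (closure_map ?t))) ?V" using O.vertex_at_bij by simp
    show "bij_betw O.half_edge_at (arcs (skeleton (closure_map ?t))) ?H" using O.half_edge_at_bij by simp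
    show "\<forall>h \<in> arcs (skeleton (closure_map ?t)).
       tail (skeleton M) (O.half_edge_at h) = O.vertex_at (tail (skeleton (closure_map ?t)) h) \<and>
       head (skeleton M) (O.half_edge_at h) = O.vertex_at (head (skeleton (closure_map ?t)) h) \<and>
       mate M (O.half_edge_at h) = O.half_edge_at (mate (closure_map ?t) h) \<and>
       rot M (O.half_edge_at h) = O.half_edge_at (rot (closure_map ?t) h)"
    proof
      fix h assume "h \<in> arcs (skeleton (closure_map ?t))"
      then have h: "h \<in> half_edges ?t" by simp
      have m: "closure_mate ?t h \<in> half_edges ?t"
        using well_charged_treeI[OF t] h
        by (simp add: well_charged_tree_def charge_zero_tree.closure_mate_in)
      show "tail (skeleton M) (O.half_edge_at h) = O.vertex_at (tail (skeleton (closure_map ?t)) h) \<and>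
         head (skeleton M) (O.half_edge_at h) = O.vertex_at (head (skeleton (closure_map ?t)) h) \<and>
         mate M (O.half_edge_at h) = O.half_edge_at (mate (closure_map ?t) h) \<and>
         rot M (O.half_edge_at h) = O.half_edge_at (rot (closure_map ?t) h)"
        using O.half_edge_at_props[OF h] O.half_edge_at_props(2)[OF m] O.closure_mate_half_edge_at[OF h] R(4) h
        by simp
    qed
    show "\<forall>p \<in> verts (skeleton (closure_map ?t)). colour_of M (O.vertex_at p) = colour_of (closure_map ?t) p"
    proof
      fix p assume "p \<in> verts (skeleton (closure_map ?t))"
      then have "vertex_colour (subtree ?t p) = O.colour_at (O.vertex_at p)"
        using O.vertex_at_props(3) by simp
      also have "\<dots> = colour_of M (O.vertex_at p)"
        by (cases "colour_of M (O.vertex_at p)") (simp_all add: O.colour_at_def map_sign_def)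
      finally show "colour_of M (O.vertex_at p) = colour_of (closure_map ?t) p" by simp
    qed
    show "root_corner M = map_corner O.vertex_at O.half_edge_at (root_corner (closure_map ?t))"
      using O.root_half_edge h0(2) by (simp add: tree_root_corner_def)
    have "F = O.half_edge_at ` {h \<in> half_edges ?t. enclosing ?t h = {}}"
    proof
      show "F \<subseteq> O.half_edge_at ` {h \<in> half_edges ?t. enclosing ?t h = {}}"
      proof
        fix x assume x: "x \<in> F"
        then have l: "O.label x \<in> half_edges ?t" "O.half_edge_at (O.label x) = x" using O.label_props F_sub by blast+
        then have "enclosing ?t (O.label x) = {}" using O.enclosing_iff_F x by simp
        then show "x \<in> O.half_edge_at ` {h \<in> half_edges ?t. enclosing ?t h = {}}"
          using l by (intro image_eqI[of _ _ "O.label x"]) simp_all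
      qed
      show "O.half_edge_at ` {h \<in> half_edges ?t. enclosing ?t h = {}} \<subseteq> F" using O.enclosing_iff_F by auto
    qed
    from arg_cong[OF this, of "(`) Before"]
    show "outer_face M = map_corner O.vertex_at O.half_edge_at ` outer_face (closure_map ?t)"
      unfolding outer_face_closure_map[OF O.root_half_edge(1)] F(2)
      by (rule trans) (simp add: image_image)
  qed
  then show ?thesis using t by blast
qed

theorem theorem2p5:
  shows "bij_betw tree_closure well_charged_trees_0 rooted_bipartite_plane_maps \<and>
    (\<forall>t \<in> well_charged_trees_0. \<forall>M \<in> tree_closure t.
       degree_distribution M = tree_degree_distribution t \<and>
       root_colour M = vertex_colour t)"
proof (intro conjI ballI)
  have is_map: "rooted_bipartite_plane_map (closure_map t)" if "t \<in> well_charged_trees_0" for t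
    using well_charged_tree.closure_map_is_map[OF well_charged_treeI[OF that]] .
  have "inj_on tree_closure well_charged_trees_0"
  proof (rule inj_onI)
    fix t t' assume t: "t \<in> well_charged_trees_0" "t' \<in> well_charged_trees_0" "tree_closure t = tree_closure t'"
    \<comment> \<open>A common representative turns the equality of the classes into an
      isomorphism.\<close>
    obtain N :: "(nat, nat) rooted_map" where N: "rooted_bipartite_plane_map N" "isomorphic_maps (closure_map t) N"
      using nat_representative[OF is_map[OF t(1)]] by blast
    then have "N \<in> tree_closure t'" using t(3) by (auto simp: tree_closure_def map_class_def)
    then have "isomorphic_maps (closure_map t') N" by (simp add: tree_closure_def map_class_def)
    then have "isomorphic_maps N (closure_map t')" by (rule isomorphic_maps_sym[OF is_map[OF t(2)]])
    then show "t = t'" using closure_injective[OF t(1,2)] isomorphic_maps_trans[OF N(2)] by blast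
  qed
  moreover have "tree_closure ` well_charged_trees_0 = rooted_bipartite_plane_maps"
  proof
    show "tree_closure ` well_charged_trees_0 \<subseteq> rooted_bipartite_plane_maps"
    proof
      fix c assume "c \<in> tree_closure ` well_charged_trees_0"
      then obtain t where t: "t \<in> well_charged_trees_0" "c = map_class (closure_map t)"
        by (auto simp: tree_closure_def)
      obtain N :: "(nat, nat) rooted_map" where N: "rooted_bipartite_plane_map N" "isomorphic_maps (closure_map t) N"
        using nat_representative[OF is_map[OF t(1)]] by blast
      then have "c = map_class N" using map_class_eq[OF is_map[OF t(1)]] t(2) by simp
      then show "c \<in> rooted_bipartite_plane_maps" using N(1) by (auto simp: rooted_bipartite_plane_maps_def)
    qed
    show "rooted_bipartite_plane_maps \<subseteq> tree_closure ` well_charged_trees_0"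
    proof
      fix c assume "c \<in> rooted_bipartite_plane_maps"
      then obtain M :: "(nat, nat) rooted_map" where M: "rooted_bipartite_plane_map M" "c = map_class M"
        by (auto simp: rooted_bipartite_plane_maps_def)
      obtain t where t: "t \<in> well_charged_trees_0" "isomorphic_maps (closure_map t) M"
        using map_is_closure[OF M(1)] by blast
      then have "c = tree_closure t"
        using map_class_eq[OF is_map[OF t(1)] M(1)] M(2) by (simp add: tree_closure_def)
      then show "c \<in> tree_closure ` well_charged_trees_0" using t(1) by blast
    qed
  qed
  ultimately show "bij_betw tree_closure well_charged_trees_0 rooted_bipartite_plane_maps"
    by (simp add: bij_betw_def)
  fix t M assume t: "t \<in> well_charged_trees_0" and "M \<in> tree_closure t"
  then have "isomorphic_maps (closure_map t) M" by (simp add: tree_closure_def map_class_def)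
  from isomorphic_maps_degree_distribution[OF is_map[OF t] this]
  show "degree_distribution M = tree_degree_distribution t" "root_colour M = vertex_colour t"
    by (simp_all add: degree_distribution_closure_map root_colour_closure_map)
qed

end
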